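(* Let $\Gamma=N+S$ and let $n$ be a positive integer. For any prime $p$ and all $\tau\in\mathbb H$, $$\bigl(J_{\Gamma,n}|U^*_p\bigr)(\tau)+J_{\Gamma,n}^{(p)}(p\tau)=J_{\Gamma,pn}(\tau)+p\,J_{\Gamma,\frac np}^{(p)}(\tau).$$
   Context: Groups. $\mathbb H$ is the complex upper half-plane, $\tau\in\mathbb H$, $q=e^{2\pi i\tau}$. For a positive integer $N$, an exact divisor of $N$ is $Q\mid N$ with $\gcd(Q,N/Q)=1$ (written $Q\parallel N$); $W_{Q,N}$ denotes any matrix $\begin{pmatrix}Qx&y\\ Nz&Qw\end{pmatrix}$ with $x,y,z,w\in\mathbb Z$ and determinant $Q$ (Atkin-Lehner involution). For a set $S$ of exact divisors of $N$, $\Gamma=N+S$ is the subgroup of $\mathrm{PSL}_2(\mathbb R)$ generated by $\Gamma_0(N)$ and all $W_{Q,N}$, $Q\in S$. Among the sets of exact divisors $>1$ generating the same group, $S$ is taken to be the largest one, so $\Gamma$ is the disjoint union of $\Gamma_0(N)$ and the cosets $\Gamma_0(N)W_{Q,N}$, $Q\in S$. Groups $\Gamma^{(m)}$. For a prime $p$, $\Gamma^{(p)}=N^{(p)}+S^{(p)}$ where $N^{(p)}=N/\gcd(p,N)$ and $S^{(p)}$ is the set of $Q\in S$ dividing $N^{(p)}$. The functions $J_{\Gamma,n}$. Let $\Gamma_\infty=\{\pm\begin{pmatrix}1&t\\0&1\end{pmatrix}:t\in\mathbb Z\}$, $e(x)=e^{2\pi i x}$, and for $n\in\mathbb N$, $\mathrm{Re}(s)>1$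 put $$G_{\Gamma,-n}(\tau,s)=2\pi\sum_{\gamma\in\Gamma_\infty\backslash\Gamma}f_n(\gamma\tau),\qquad f_n(\tau)=e(-n\,\mathrm{Re}\,\tau)\,(n\,\mathrm{Im}\,\tau)^{1/2}I_{s-\frac12}(2\pi n\,\mathrm{Im}\,\tau),$$ with $I$ the $I$-Bessel function. It continues analytically to $\mathrm{Re}(s)>1/2$; set $j_{\Gamma,n}(\tau)=G_{\Gamma,-n}(\tau,1)$, a $\Gamma$-invariant harmonic function with expansion $j_{\Gamma,n}=q^{-n}-\bar q^n+c_\Gamma(n,0)+\sum_{\ell\ge1}(c_\Gamma(n,\ell)q^\ell+c_\Gamma(n,-\ell)\bar q^\ell)$. Define $J_{\Gamma,n}=j_{\Gamma,n}-c_\Gamma(n,0)$ for $n\ge1$, $J_{\Gamma,0}=1$, and $J_{\Gamma,x}=0$ if $x$ is not an integer. The $p$-plicate is $J_{\Gamma,n}^{(p)}=J_{\Gamma^{(p)},n}$. For $f:\mathbb H\to\mathbb C$, $(f|U^*_p)(\tau)=\sum_{i=0}^{p-1}f\left(\frac{\tau+i}{p}\right)$. *)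

theory Defs
  imports "HOL-Complex_Analysis.Complex_Analysis" "HOL-Algebra.Coset" "HOL-Algebra.Generated_Groups"
    "HOL-Computational_Algebra.Primes"
begin

definition upper_half_plane :: "complex set" where
  "upper_half_plane = {\<tau>. Im \<tau> > 0}"

definition ee :: "real \<Rightarrow> complex" where
  "ee x = exp (2 * of_real pi * \<i> * of_real x)"

definition qq :: "complex \<Rightarrow> complex" where
  "qq \<tau> = exp (2 * of_real pi * \<i> * \<tau>)"

definition mat2 :: "real \<Rightarrow> real \<Rightarrow> real \<Rightarrow> real \<Rightarrow> real ^ 2 ^ 2" where
  "mat2 a b c d = vector [vector [a, b], vector [c, d]]"

definition moeb :: "real ^ 2 ^ 2 \<Rightarrow> complex \<Rightarrow> complex" where
  "moeb A \<tau> = (of_real (A $ 1 $ 1) * \<tau> + of_real (A $ 1 $ 2)) /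
              (of_real (A $ 2 $ 1) * \<tau> + of_real (A $ 2 $ 2))"

text \<open>
  Subgroups of \<open>PSL\<^sub>2(\<real>)\<close> are represented by their full preimages in \<open>SL\<^sub>2(\<real>)\<close>.
  All groups below contain minus the identity, so generated subgroups and the coset
  space of \<open>\<Gamma>\<^sub>\<infinity>\<close> are the same whether computed upstairs or downstairs.
\<close>

definition SL2R :: "(real ^ 2 ^ 2) monoid" where
  "SL2R = \<lparr>carrier = {A. det A = 1}, mult = (**), one = mat 1\<rparr>"

definition Gamma0 :: "nat \<Rightarrow> (real ^ 2 ^ 2) set" where
  "Gamma0 N = {mat2 (of_int a) (of_int b) (of_int c) (of_int d) | a b c d :: int.
     a * d - b * c = 1 \<and> int N dvd c}"

definition exact_divisors :: "nat \<Rightarrow> nat set" where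
  "exact_divisors N = {Q. Q dvd N \<and> coprime Q (N div Q)}"

text \<open>
  The matrices \<open>W\<^sub>Q\<^sub>,\<^sub>N\<close> have determinant \<open>Q\<close>; dividing by \<open>sqrt Q\<close> gives the
  representatives of the same projective class that lie in \<open>SL\<^sub>2(\<real>)\<close>.
\<close>

definition atkin_lehner :: "nat \<Rightarrow> nat \<Rightarrow> (real ^ 2 ^ 2) set" where
  "atkin_lehner Q N = {(1 / sqrt (real Q)) *\<^sub>R
       mat2 (of_int (int Q * x)) (of_int y) (of_int (int N * z)) (of_int (int Q * w)) | x y z w :: int.
     (int Q * x) * (int Q * w) - y * (int N * z) = int Q}"

definition Gamma_plus :: "nat \<Rightarrow> nat set \<Rightarrow> (real ^ 2 ^ 2) set" where
  "Gamma_plus N S = generate SL2R (Gamma0 N \<union> (\<Union>Q\<in>S. atkin_lehner Q N))"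

text \<open>
  The convention on the symbol \<open>N + S\<close>: \<open>S\<close> is the largest set of exact divisors
  \<open>> 1\<close> of \<open>N\<close> generating the given group.
\<close>

definition largest_generating_set :: "nat \<Rightarrow> nat set \<Rightarrow> bool" where
  "largest_generating_set N S \<longleftrightarrow>
     S \<subseteq> exact_divisors N - {1} \<and>
     (\<forall>T. T \<subseteq> exact_divisors N - {1} \<and> Gamma_plus N T = Gamma_plus N S \<longrightarrow> T \<subseteq> S)"

definition plicate_level :: "nat \<Rightarrow> nat \<Rightarrow> nat" where
  "plicate_level p N = N div gcd p N"

definition plicate_set :: "nat \<Rightarrow> nat \<Rightarrow> nat set \<Rightarrow> nat set" where
  "plicate_set p N S = {Q \<in> S. Q dvd plicate_level p N}"

definition Gamma_plicate :: "nat \<Rightarrow> nat \<Rightarrow> nat set \<Rightarrow> (real ^ 2 ^ 2) set" where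
  "Gamma_plicate p N S = Gamma_plus (plicate_level p N) (plicate_set p N S)"

definition Gamma_inf :: "(real ^ 2 ^ 2) set" where
  "Gamma_inf = {mat2 1 (of_int t) 0 1 | t :: int. True} \<union>
               {mat2 (-1) (of_int t) 0 (-1) | t :: int. True}"

text \<open>The \<open>I\<close>-Bessel function of complex order, for positive real argument.\<close>

definition bessel_I :: "complex \<Rightarrow> real \<Rightarrow> complex" where
  "bessel_I \<nu> x = (\<Sum>k. of_real (x / 2) powr (\<nu> + 2 * of_nat k) * rGamma (\<nu> + of_nat k + 1) / fact k)"

definition niebur_f :: "nat \<Rightarrow> complex \<Rightarrow> complex \<Rightarrow> complex" where
  "niebur_f n s \<tau> = ee (- real n * Re \<tau>) * of_real (sqrt (real n * Im \<tau>)) *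
                     bessel_I (s - 1 / 2) (2 * pi * real n * Im \<tau>)"

text \<open>
  The sum over \<open>\<Gamma>\<^sub>\<infinity>\<close>-cosets in \<open>\<Gamma>\<close>; the summand does not depend on the chosen
  representative because \<open>niebur_f n s\<close> is invariant under integer translations.
\<close>

definition niebur_G :: "(real ^ 2 ^ 2) set \<Rightarrow> nat \<Rightarrow> complex \<Rightarrow> complex \<Rightarrow> complex" where
  "niebur_G \<Gamma> n \<tau> s = 2 * of_real pi *
     (\<Sum>\<^sub>\<infinity>C \<in> rcosets\<^bsub>SL2R\<lparr>carrier := \<Gamma>\<rparr>\<^esub> Gamma_inf. niebur_f n s (moeb (SOME \<gamma>. \<gamma> \<in> C) \<tau>))"

text \<open>
  The value at \<open>s = 1\<close> of the analytic continuation in \<open>s\<close> from \<open>Re s > 1\<close>. It is the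
  same for every half-plane \<open>Re s > \<sigma>\<close> with \<open>\<sigma> < 1\<close> to which the series continues;
  fixing \<open>\<sigma> = 1/2\<close> would make the definition depend on the absence of exceptional
  Laplace eigenvalues, which can produce poles in the real interval between \<open>1/2\<close> and \<open>1\<close>.
\<close>

definition niebur_j :: "(real ^ 2 ^ 2) set \<Rightarrow> nat \<Rightarrow> complex \<Rightarrow> complex" where
  "niebur_j \<Gamma> n \<tau> = (THE v. \<exists>\<sigma><1. \<exists>g. g holomorphic_on {s. Re s > \<sigma>} \<and>
     (\<forall>s. Re s > 1 \<longrightarrow> g s = niebur_G \<Gamma> n \<tau> s) \<and> v = g 1)"

definition is_niebur_expansion :: "(real ^ 2 ^ 2) set \<Rightarrow> nat \<Rightarrow> (int \<Rightarrow> complex) \<Rightarrow> bool" where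
  "is_niebur_expansion \<Gamma> n c \<longleftrightarrow> (\<forall>\<tau> \<in> upper_half_plane.
     (\<lambda>l. c (int l) * qq \<tau> ^ l) summable_on {1..} \<and>
     (\<lambda>l. c (- int l) * cnj (qq \<tau>) ^ l) summable_on {1..} \<and>
     niebur_j \<Gamma> n \<tau> = inverse (qq \<tau>) ^ n - cnj (qq \<tau>) ^ n + c 0 +
       (\<Sum>\<^sub>\<infinity>l\<in>{1..}. c (int l) * qq \<tau> ^ l + c (- int l) * cnj (qq \<tau>) ^ l))"

text \<open>The coefficients are unique, by comparing Fourier coefficients in \<open>Re \<tau>\<close>.\<close>

definition niebur_c :: "(real ^ 2 ^ 2) set \<Rightarrow> nat \<Rightarrow> int \<Rightarrow> complex" where
  "niebur_c \<Gamma> n = (THE c. is_niebur_expansion \<Gamma> n c)"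

text \<open>
  The index is rational so that \<open>n / p\<close> makes sense; negative integers never occur as
  indices and get the value \<open>0\<close>.
\<close>

definition niebur_J :: "(real ^ 2 ^ 2) set \<Rightarrow> rat \<Rightarrow> complex \<Rightarrow> complex" where
  "niebur_J \<Gamma> x \<tau> =
     (if x = 0 then 1
      else if x \<in> \<nat> then niebur_j \<Gamma> (nat \<lfloor>x\<rfloor>) \<tau> - niebur_c \<Gamma> (nat \<lfloor>x\<rfloor>) 0
      else 0)"

definition U_star :: "nat \<Rightarrow> (complex \<Rightarrow> complex) \<Rightarrow> complex \<Rightarrow> complex" where
  "U_star p f \<tau> = (\<Sum>i<p. f ((\<tau> + of_nat i) / of_nat p))"

end

theory Submission
  imports Defs "HOL-Number_Theory.Number_Theory"
begin

text \<open>
  For \<open>Re s > 1\<close> the identity is the Hecke correspondence at \<open>p\<close> applied to the Niebur--Poincare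
  series: up to integer translations, the integral matrices of determinant \<open>p\<close> obtained by
  multiplying representatives of \<open>\<Gamma>\<^sub>\<infinity>\<backslash>\<Gamma>\<close> and of \<open>\<Gamma>\<^sub>\<infinity>\<backslash>\<Gamma>\<^sup>(\<^sup>p\<^sup>)\<close> on the right by
  \<open>(1 i; 0 p)\<close> and \<open>(p 0; 0 1)\<close> are those obtained by multiplying them on the left by
  \<open>(p 0; 0 1)\<close> and \<open>(1 j; 0 p)\<close>, and averaging \<open>f\<^sub>n\<close> over \<open>j\<close> gives \<open>p f\<^sub>n\<^sub>/\<^sub>p\<close> or \<open>0\<close>.

  The identity is carried to \<open>s = 1\<close> by a continuation to \<open>Re s > 15/16\<close> that needs no spectral
  theory. The part of the summand that does not converge absolutely is a constant multiple of
  \<open>e(-n a/c) (Im \<gamma>\<tau>)\<^sup>s\<close>; for fixed \<open>c\<close> it is summed over \<open>d\<close> by completion, which brings in Kloosterman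
  sums, and Kloosterman's elementary bound of order \<open>c\<^sup>3\<^sup>/\<^sup>4\<close> (up to the number of divisors of \<open>c\<close>) suffices.

  At \<open>s = 1\<close> the Bessel function is a hyperbolic sine, so the continued series splits into a
  holomorphic and an antiholomorphic periodic function and a series of Poisson kernels. This
  gives the Fourier expansion, and comparing its constant terms removes the constants
  \<open>c\<^sub>\<Gamma>(n, 0)\<close> from the identity for \<open>j\<^sub>\<Gamma>\<^sub>,\<^sub>n\<close>.
\<close>

section \<open>Kloosterman sums\<close>

text \<open>The summand has size |c \<tau> + d|^(-2 Re s), so absolute convergence ends at Re s = 1,
  and the trivial bound c for a Kloosterman sum modulo c stops there too. Since
  \<open>niebur_j\<close> accepts a continuation to any half-plane Re s > \<sigma> with \<sigma> <
  1, every saving of a power of c is enough. With c^(3/4) the sum over c behaves like that of c^(3/4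
  - 2 Re s), which converges for Re s > 7/8; 15/16 lies halfway from there to 1 and leaves room for
  the divisor function, a logarithm and the convergence of the sum over d.

  Everything is done for one Q in S \<union> {1} at a time. Passing from Gamma_0(N) to the coset of
  W_Q changes which c occur, replaces the inverse of d modulo c by that of Q d, and puts n / Q for n
  in the analytic factors, so one weighted series serves all Q. The Hecke identity also holds for
  each Q. If p divides Q, the plicate has no such coset, and the two families of matrices of level N
  agree by themselves.

  The constants c_\<Gamma>(n, 0) enter only as means over a period, so the relation between them is
  the integrated identity for j.\<close>

lemma ee_add: "ee (x + y) = ee x * ee y"
  by (simp add: ee_def algebra_simps exp_add)

lemma ee_0 [simp]: "ee 0 = 1"
  by (simp add: ee_def)

lemma ee_of_int [simp]: "ee (of_int k) = 1"
  by (simp add: ee_def exp_eq_1)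

lemma norm_ee [simp]: "norm (ee x) = 1"
  by (simp add: ee_def)

lemma cnj_ee: "cnj (ee x) = ee (- x)"
  by (simp add: ee_def exp_cnj)

definition ec :: "nat \<Rightarrow> int \<Rightarrow> complex" where
  "ec c a = ee (of_int a / of_nat c)"

lemma ec_add: "ec c (a + b) = ec c a * ec c b"
  by (simp add: ec_def add_divide_distrib ee_add)

lemma ec_0 [simp]: "ec c 0 = 1"
  by (simp add: ec_def)

lemma norm_ec [simp]: "norm (ec c a) = 1"
  by (simp add: ec_def)

lemma cnj_ec: "cnj (ec c a) = ec c (- a)"
  by (simp add: ec_def cnj_ee)

lemma ec_mult_self: "c > 0 \<Longrightarrow> ec c (int c * k) = 1"
  by (simp add: ec_def)

lemma ec_cong:
  assumes "c > 0" "[a = b] (mod int c)"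
  shows "ec c a = ec c b"
proof -
  obtain k where "a = b + int c * k"
    using assms(2) by (metis cong_iff_lin cong_sym)
  thus ?thesis by (simp add: ec_add ec_mult_self assms)
qed

lemma ec_power: "ec c a ^ k = ec c (a * int k)"
  by (induction k) (auto simp: ec_add algebra_simps)

lemma ec_eq_1_iff:
  assumes "c > 0"
  shows "ec c a = 1 \<longleftrightarrow> int c dvd a"
proof
  assume "ec c a = 1"
  then obtain k :: int where k: "2 * pi * (of_int a / of_nat c) = of_int (2 * k) * pi"
    by (auto simp: ec_def ee_def exp_eq_1)
  hence "real_of_int a = of_int k * of_nat c"
    using assms by (simp add: field_simps)
  hence "a = k * int c"
    by (metis of_int_eq_iff of_int_mult of_int_of_nat_eq)
  thus "int c dvd a" by simp
qed (use assms ec_mult_self in auto)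

lemma sum_ec:
  assumes "c > 0"
  shows "(\<Sum>m<c. ec c (a * int m)) = (if int c dvd a then of_nat c else 0)"
proof (cases "int c dvd a")
  case True
  thus ?thesis using assms by (auto simp: ec_mult_self mult.assoc)
next
  case False
  hence "ec c a \<noteq> 1" by (simp add: ec_eq_1_iff assms)
  have "(\<Sum>m<c. ec c (a * int m)) = (\<Sum>m<c. ec c a ^ m)"
    by (simp add: ec_power)
  also have "\<dots> = (ec c a ^ c - 1) / (ec c a - 1)"
    using \<open>ec c a \<noteq> 1\<close> by (rule geometric_sum)
  also have "ec c a ^ c = 1"
    using ec_mult_self[OF assms, of a] by (simp add: ec_power mult.commute)
  finally show ?thesis using False by simp
qed

text \<open>Parseval on (Z/c)^2: after expanding the square, orthogonality in m and in k keeps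
  exactly the pairs (v, v') at which both exponents agree.\<close>

lemma sum_sq_norm_ec:
  fixes s t :: "'a \<Rightarrow> int"
  assumes "finite V" "c > 0"
  shows "(\<Sum>m<c. \<Sum>k<c. (cmod (\<Sum>v\<in>V. ec c (int m * s v + int k * t v)))\<^sup>2)
    = real c ^ 2 * real (card {(v, v') \<in> V \<times> V. [s v = s v'] (mod int c) \<and> [t v = t v'] (mod int c)})"
proof -
  have eq: "complex_of_real ((cmod (\<Sum>v\<in>V. ec c (int m * s v + int k * t v)))\<^sup>2)
     = (\<Sum>v\<in>V. \<Sum>v'\<in>V. ec c ((s v - s v') * int m) * ec c ((t v - t v') * int k))" for m k :: nat
    unfolding complex_norm_square cnj_sum cnj_ec sum_product ec_add [symmetric]
    by (simp add: algebra_simps)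
  have "complex_of_real (\<Sum>m<c. \<Sum>k<c. (cmod (\<Sum>v\<in>V. ec c (int m * s v + int k * t v)))\<^sup>2)
      = (\<Sum>m<c. \<Sum>k<c. \<Sum>v\<in>V. \<Sum>v'\<in>V. ec c ((s v - s v') * int m) * ec c ((t v - t v') * int k))"
    unfolding of_real_sum eq ..
  also have "\<dots> = (\<Sum>m<c. \<Sum>v\<in>V. \<Sum>v'\<in>V. \<Sum>k<c. ec c ((s v - s v') * int m) * ec c ((t v - t v') * int k))"
    by (intro sum.cong refl, subst sum.swap, intro sum.cong refl, rule sum.swap)
  also have "\<dots> = (\<Sum>v\<in>V. \<Sum>v'\<in>V. \<Sum>m<c. \<Sum>k<c. ec c ((s v - s v') * int m) * ec c ((t v - t v') * int k))"
    by (subst sum.swap, intro sum.cong refl, rule sum.swap)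
  also have "\<dots> = (\<Sum>v\<in>V. \<Sum>v'\<in>V. (\<Sum>m<c. ec c ((s v - s v') * int m)) * (\<Sum>k<c. ec c ((t v - t v') * int k)))"
    by (simp add: sum_product)
  also have "\<dots> = (\<Sum>v\<in>V. \<Sum>v'\<in>V. if [s v = s v'] (mod int c) \<and> [t v = t v'] (mod int c) then of_nat c ^ 2 else 0)"
    using assms by (intro sum.cong refl) (auto simp: sum_ec cong_iff_dvd_diff power2_eq_square)
  also have "\<dots> = (\<Sum>(v,v')\<in>V \<times> V. if [s v = s v'] (mod int c) \<and> [t v = t v'] (mod int c) then of_nat c ^ 2 else 0)"
    by (rule sum.cartesian_product)
  also have "\<dots> = (\<Sum>x\<in>{(v, v') \<in> V \<times> V. [s v = s v'] (mod int c) \<and> [t v = t v'] (mod int c)}. of_nat c ^ 2)"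
    using assms by (intro sum.mono_neutral_cong_right) (auto split: if_splits)
  also have "\<dots> = complex_of_real (real c ^ 2 * real (card {(v, v') \<in> V \<times> V. [s v = s v'] (mod int c) \<and> [t v = t v'] (mod int c)}))"
    by simp
  finally show ?thesis using of_real_eq_iff by blast
qed

section \<open>The fourth moment of Kloosterman sums\<close>

definition runits :: "nat \<Rightarrow> int set" where
  "runits c = {w \<in> {0..<int c}. coprime w (int c)}"

lemma finite_runits [simp]: "finite (runits c)"
  by (rule finite_subset[of _ "{0..<int c}"]) (auto simp: runits_def)

definition kloosterman :: "nat \<Rightarrow> int \<Rightarrow> int \<Rightarrow> complex" where
  "kloosterman c m k = (\<Sum>w\<in>runits c. ec c (m * w + k * modular_inverse (int c) w))"

definition kl_sols :: "nat \<Rightarrow> ((int \<times> int) \<times> (int \<times> int)) set" where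
  "kl_sols c = {((w1, w2), (w3, w4)) \<in> (runits c \<times> runits c) \<times> (runits c \<times> runits c).
     [w1 + w2 = w3 + w4] (mod int c) \<and>
     [modular_inverse (int c) w1 + modular_inverse (int c) w2 =
      modular_inverse (int c) w3 + modular_inverse (int c) w4] (mod int c)}"

text \<open>Apply \<open>sum_sq_norm_ec\<close> to the square of the sum, whose terms are indexed by
  pairs of units; hence the two variables on either side in \<open>kl_sols\<close>.\<close>

lemma sum_kloosterman_power4:
  assumes "c > 0"
  shows "(\<Sum>m<c. \<Sum>k<c. cmod (kloosterman c (int m) (int k)) ^ 4)
    = real c ^ 2 * real (card (kl_sols c))"
proof -
  define s where "s = (\<lambda>(w1::int, w2::int). w1 + w2)"
  define t where "t = (\<lambda>(w1, w2). modular_inverse (int c) w1 + modular_inverse (int c) w2)"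
  have "cmod (kloosterman c m k) ^ 4
     = (cmod (\<Sum>v\<in>runits c \<times> runits c. ec c (m * s v + k * t v)))\<^sup>2" for m k
  proof -
    have "kloosterman c m k ^ 2 = (\<Sum>v\<in>runits c \<times> runits c. ec c (m * s v + k * t v))"
      unfolding kloosterman_def power2_eq_square sum_product sum.cartesian_product ec_add [symmetric]
      by (intro sum.cong) (auto simp: s_def t_def algebra_simps)
    thus ?thesis
      by (metis mult_2 norm_power numeral_Bit0 power2_eq_square power_add)
  qed
  hence "(\<Sum>m<c. \<Sum>k<c. cmod (kloosterman c (int m) (int k)) ^ 4)
     = (\<Sum>m<c. \<Sum>k<c. (cmod (\<Sum>v\<in>runits c \<times> runits c. ec c (int m * s v + int k * t v)))\<^sup>2)"
    by simp
  also have "\<dots> = real c ^ 2 * real (card {(v, v') \<in> (runits c \<times> runits c) \<times> (runits c \<times> runits c).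
       [s v = s v'] (mod int c) \<and> [t v = t v'] (mod int c)})"
    by (rule sum_sq_norm_ec) (use assms in auto)
  also have "{(v, v') \<in> (runits c \<times> runits c) \<times> (runits c \<times> runits c).
       [s v = s v'] (mod int c) \<and> [t v = t v'] (mod int c)} = kl_sols c"
    by (auto simp: kl_sols_def s_def t_def)
  finally show ?thesis .
qed

text \<open>Eliminating w4 by the first congruence and clearing denominators in the second leaves
  this product. For prime c it says that w1 = -w2 or that w3 is w1 or w2 modulo c; as a divisibility
  it also serves composite c.\<close>

lemma kl_sols_dvd:
  assumes "((w1, w2), (w3, w4)) \<in> kl_sols c"
  shows "int c dvd (w1 + w2) * (w3 - w1) * (w3 - w2)"
proof -
  define i where "i = modular_inverse (int c)"
  have w: "coprime w1 (int c)" "coprime w2 (int c)" "coprime w3 (int c)" "coprime w4 (int c)"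
    and s: "[w1 + w2 = w3 + w4] (mod int c)" and t: "[i w1 + i w2 = i w3 + i w4] (mod int c)"
    using assms by (auto simp: kl_sols_def runits_def i_def)
  obtain k1 k2 k3 k4 where k: "w1 * i w1 = 1 + int c * k1" "w2 * i w2 = 1 + int c * k2"
     "w3 * i w3 = 1 + int c * k3" "w4 * i w4 = 1 + int c * k4"
    using w unfolding i_def by (metis cong_iff_lin cong_modular_inverse1 cong_sym)
  obtain e where e: "w4 = w1 + w2 - w3 + int c * e"
  proof -
    obtain e where "w3 + w4 = w1 + w2 + int c * e" using s by (metis cong_iff_lin)
    thus ?thesis using that[of e] by (simp add: algebra_simps)
  qed
  obtain f where f: "i w1 + i w2 - i w3 - i w4 = int c * f"
    using t by (metis cong_iff_dvd_diff diff_diff_eq dvdE)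
  have "w1 * w2 * w3 * w4 * (i w1 + i w2 - i w3 - i w4)
     = w2 * w3 * w4 * (w1 * i w1) + w1 * w3 * w4 * (w2 * i w2) - w1 * w2 * w4 * (w3 * i w3) - w1 * w2 * w3 * (w4 * i w4)"
    by (simp add: algebra_simps)
  also have "\<dots> = w2 * w3 * w4 + w1 * w3 * w4 - w1 * w2 * w4 - w1 * w2 * w3
      + int c * (w2 * w3 * w4 * k1 + w1 * w3 * w4 * k2 - w1 * w2 * w4 * k3 - w1 * w2 * w3 * k4)"
    unfolding k by (simp add: algebra_simps)
  \<comment> \<open>Modulo c the left side is (w1 + w2) (w3 w4 - w1 w2), and w3 w4 - w1 w2 = -(w3 -
    w1) (w3 - w2) as soon as w3 + w4 = w1 + w2.\<close>
  also have "w2 * w3 * w4 + w1 * w3 * w4 - w1 * w2 * w4 - w1 * w2 * w3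
     = - ((w1 + w2) * (w3 - w1) * (w3 - w2)) + int c * e * ((w1 + w2) * w3 - w1 * w2)"
    unfolding e by (simp add: algebra_simps)
  finally have "(w1 + w2) * (w3 - w1) * (w3 - w2) = int c * (e * ((w1 + w2) * w3 - w1 * w2)
     + (w2 * w3 * w4 * k1 + w1 * w3 * w4 * k2 - w1 * w2 * w4 * k3 - w1 * w2 * w3 * k4)
     - w1 * w2 * w3 * w4 * f)"
    unfolding f by (simp add: algebra_simps)
  thus ?thesis by simp
qed

text \<open>Measured from the least solution v0, the integer n (v - v0) / d labels the solutions
  injectively by an interval of length n g; no common factor of n and d has to be discussed.\<close>

lemma card_mult_cong_le:
  fixes c :: nat and n e :: int
  assumes "n > 0"  "d > 0"
  shows "card {v \<in> {0..<int d * int g}. int d dvd n * v - e} \<le> nat n * g"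
proof (cases "g = 0")
  case False
  define A where "A = {v \<in> {0..<int d * int g}. int d dvd n * v - e}"
  show ?thesis
  proof (cases "A = {}")
    case False
    have fin: "finite A" by (rule finite_subset[of _ "{0..<int d * int g}"]) (auto simp: A_def)
    define v0 where "v0 = Min A"
    have v0: "v0 \<in> A" "\<And>v. v \<in> A \<Longrightarrow> v0 \<le> v" using fin False by (auto simp: v0_def)
    define h where "h = (\<lambda>v. n * (v - v0) div int d)"
    have dv: "int d dvd n * (v - v0)" if "v \<in> A" for v
    proof -
      have "int d dvd n * v - e" "int d dvd n * v0 - e" using that v0(1) by (auto simp: A_def)
      hence "int d dvd (n * v - e) - (n * v0 - e)" by (rule dvd_diff)
      thus ?thesis by (simp add: algebra_simps)
    qed
    have "inj_on h A"
    proof (rule inj_onI)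
      fix v v' assume *: "v \<in> A" "v' \<in> A" "h v = h v'"
      have "n * (v - v0) = h v * int d" "n * (v' - v0) = h v' * int d"
        using dv[OF *(1)] dv[OF *(2)] by (auto simp: h_def)
      hence "n * (v - v0) = n * (v' - v0)" using *(3) by metis
      hence "v - v0 = v' - v0" using assms(1) by (metis mult_left_cancel less_irrefl)
      thus "v = v'" by simp
    qed
    moreover have "h ` A \<subseteq> {0..<n * int g}"
    proof safe
      fix v assume v: "v \<in> A"
      have 1: "n * (v - v0) = h v * int d" using dv[OF v] by (auto simp: h_def)
      have 2: "v0 \<le> v" using v0 v by auto
      have "v - v0 < int d * int g" using v v0 by (auto simp: A_def)
      hence "n * (v - v0) < n * (int d * int g)" using assms by simp
      hence "h v * int d < (n * int g) * int d" using 1 by (simp add: algebra_simps)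
      hence "h v < n * int g" using assms by (simp add: mult_less_cancel_right)
      moreover have "0 \<le> h v" using 2 assms unfolding h_def by (intro pos_imp_zdiv_nonneg_iff[THEN iffD2]) auto
      ultimately show "h v \<in> {0..<n * int g}" by simp
    qed
    ultimately have "card A \<le> card {0..<n * int g}"
      by (metis card_image card_mono finite_atLeastLessThan_int)
    thus ?thesis using assms by (simp add: A_def nat_mult_distrib)
  next
    case True
    thus ?thesis unfolding A_def [symmetric] by simp
  qed
qed auto

definition ndiv :: "nat \<Rightarrow> nat" where "ndiv c = card {d. d dvd c}"

text \<open>The gcd of a and c is one of the divisors d of c that divide a, so it is at most their
  sum; after exchanging the sums each d contributes at most d (c / d) = c.\<close>

lemma sum_gcd_le:
  assumes "c > 0"
  shows "(\<Sum>a<c. gcd a c) \<le> c * ndiv c"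
proof -
  have "(\<Sum>a<c. gcd a c) \<le> (\<Sum>a<c. \<Sum>d | d dvd c. if d dvd a then d else 0)"
  proof (rule sum_mono)
    fix a
    have "gcd a c = (\<Sum>d\<in>{gcd a c}. if d dvd a then d else 0)" by simp
    also have "\<dots> \<le> (\<Sum>d | d dvd c. if d dvd a then d else 0)"
      using assms by (intro sum_mono2) auto
    finally show "gcd a c \<le> (\<Sum>d | d dvd c. if d dvd a then d else 0)" .
  qed
  also have "\<dots> = (\<Sum>d | d dvd c. \<Sum>a<c. if d dvd a then d else 0)"
    by (rule sum.swap)
  also have "\<dots> \<le> (\<Sum>d | d dvd c. c)"
  proof (rule sum_mono)
    fix d assume "d \<in> {d. d dvd c}"
    then obtain e where e: "c = d * e" by auto
    have "{a. a < c \<and> d dvd a} \<subseteq> (\<lambda>k. d * k) ` {..<e}"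
      using e assms by (auto elim!: dvdE)
    hence "card {a. a < c \<and> d dvd a} \<le> e"
      by (metis card_lessThan finite_lessThan surj_card_le)
    hence "card {a. a < c \<and> d dvd a} * d \<le> c" using e by (simp add: mult.commute)
    moreover have "(\<Sum>a<c. if d dvd a then d else 0) = card {a. a < c \<and> d dvd a} * d"
      by (subst sum.inter_filter [symmetric]) (auto intro!: arg_cong2[where f = "(*)"] arg_cong[where f = card])
    ultimately show "(\<Sum>a<c. if d dvd a then d else 0) \<le> c" by simp
  qed
  finally show ?thesis by (simp add: ndiv_def mult.commute)
qed

text \<open>A solution is determined by a = w3 - w1, b = w3 - w2 and w3. Since w1 + w2 = 2 w3 - a -
  b, \<open>kl_sols_dvd\<close> is a linear congruence for w3 once a and b are fixed, with at most 2
  gcd(a, c) gcd(b, c) solutions.\<close>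

lemma card_kl_sols_le:
  assumes "c > 0"
  shows "card (kl_sols c) \<le> 2 * c ^ 2 * ndiv c ^ 2"
proof -
  define B where "B = (\<lambda>(a::nat, b::nat). {w \<in> {0..<int c}. int c dvd (2 * w - int a - int b) * (int a * int b)})"
  define h where "h = (\<lambda>((w1::int, w2::int), (w3::int, w4::int)).
     ((nat ((w3 - w1) mod int c), nat ((w3 - w2) mod int c)), w3))"
  have cB: "card (B (a, b)) \<le> 2 * (gcd a c * gcd b c)" for a b
  proof -
    \<comment> \<open>After division by g the factor a b / g is prime to d = c / g and cancels,
      which leaves 2 w = a + b modulo d for w in an interval of g periods.\<close>
    define g where "g = gcd (a * b) c"
    obtain d where d: "c = d * g" unfolding g_def by (metis dvd_div_mult_self gcd_dvd2)
    have "d > 0" "g > 0" using d assms by (auto intro: gr0I)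
    have "g dvd a * b" by (simp add: g_def)
    then obtain r where r: "a * b = g * r" by auto
    have cop: "coprime r d"
    proof -
      have "g * gcd r d = gcd (a * b) c" by (simp add: r d gcd_mult_distrib_nat mult.commute)
      hence "g * gcd r d = g * 1" by (simp only: g_def mult_1_right)
      hence "gcd r d = 1" using \<open>g > 0\<close> by (metis mult_left_cancel less_irrefl)
      thus ?thesis by (simp only: coprime_iff_gcd_eq_1)
    qed
    have "B (a, b) = {w \<in> {0..<int d * int g}. int d dvd 2 * w - (int a + int b)}"
    proof -
      have "int c dvd (2 * w - int a - int b) * (int a * int b) \<longleftrightarrow> int d dvd 2 * w - (int a + int b)" for w
      proof -
        have "(2 * w - int a - int b) * (int a * int b) = int g * ((2 * w - (int a + int b)) * int r)"
          using r by (simp add: algebra_simps flip: of_nat_mult)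
        hence "int c dvd (2 * w - int a - int b) * (int a * int b) \<longleftrightarrow>
            int g * int d dvd int g * ((2 * w - (int a + int b)) * int r)"
          by (simp only: d of_nat_mult mult.commute)
        also have "\<dots> \<longleftrightarrow> int d dvd (2 * w - (int a + int b)) * int r"
          using \<open>g > 0\<close> by simp
        also have "\<dots> \<longleftrightarrow> int d dvd (2 * w - (int a + int b))"
          using cop by (intro coprime_dvd_mult_left_iff) (simp add: coprime_commute)
        finally show ?thesis .
      qed
      thus ?thesis by (auto simp: B_def d)
    qed
    hence "card (B (a, b)) \<le> 2 * g"
      using card_mult_cong_le[of 2 d g "int a + int b"] \<open>d > 0\<close> by simp
    also have "g \<le> gcd a c * gcd b c"
    proof (rule dvd_imp_le)
      have "g dvd gcd (b * a) (b * c)"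
        by (intro gcd_greatest) (auto simp: g_def mult.commute)
      also have "gcd (b * a) (b * c) = gcd a c * b"
        by (metis gcd_mult_distrib_nat mult.commute)
      finally have "g dvd gcd (gcd a c * b) (gcd a c * c)"
        by (intro gcd_greatest) (auto simp: g_def)
      thus "g dvd gcd a c * gcd b c"
        by (simp only: gcd_mult_distrib_nat)
    qed (use assms in auto)
    finally show ?thesis by simp
  qed
  have finB: "finite (B x)" for x
    by (rule finite_subset[of _ "{0..<int c}"]) (auto simp: B_def split: prod.splits)
  have "inj_on h (kl_sols c)"
  proof (rule inj_onI)
    fix x y assume xy: "x \<in> kl_sols c" "y \<in> kl_sols c" "h x = h y"
    obtain w1 w2 w3 w4 v1 v2 v3 v4 where [simp]: "x = ((w1,w2),(w3,w4))" "y = ((v1,v2),(v3,v4))"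
      by (metis surj_pair)
    have r: "w1 \<in> {0..<int c}" "w2 \<in> {0..<int c}" "w3 \<in> {0..<int c}" "w4 \<in> {0..<int c}"
       "v1 \<in> {0..<int c}" "v2 \<in> {0..<int c}" "v3 \<in> {0..<int c}" "v4 \<in> {0..<int c}"
      using xy by (auto simp: kl_sols_def runits_def)
    have 1: "w3 = v3" "nat ((w3 - w1) mod int c) = nat ((v3 - v1) mod int c)"
      "nat ((w3 - w2) mod int c) = nat ((v3 - v2) mod int c)"
      using xy(3) by (auto simp: h_def)
    have eqI: "u = v" if "[u = v] (mod int c)" "u \<in> {0..<int c}" "v \<in> {0..<int c}" for u v
      using that by (auto simp: cong_def)
    have "[w3 - w1 = v3 - v1] (mod int c)" "[w3 - w2 = v3 - v2] (mod int c)"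
      using 1 assms by (auto simp: cong_def nat_eq_iff2 eq_nat_nat_iff)
    from cong_diff[OF cong_refl[of w3] this(1)] cong_diff[OF cong_refl[of w3] this(2)]
    have 2: "[w1 = v1] (mod int c)" "[w2 = v2] (mod int c)" using \<open>w3 = v3\<close> by auto
    hence w12: "w1 = v1" "w2 = v2" using r eqI by auto
    have "[w1 + w2 = w3 + w4] (mod int c)" "[v1 + v2 = v3 + v4] (mod int c)"
      using xy by (auto simp: kl_sols_def)
    hence "[w3 + w4 = w3 + v4] (mod int c)" using w12 1(1) by (metis cong_sym cong_trans)
    hence "[w4 = v4] (mod int c)" by (simp add: cong_add_lcancel)
    hence "w4 = v4" using r eqI by auto
    thus "x = y" using w12 1 by simp
  qed
  moreover have "h ` kl_sols c \<subseteq> Sigma ({..<c} \<times> {..<c}) B"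
  proof (rule image_subsetI)
    fix x assume "x \<in> kl_sols c"
    moreover obtain w1 w2 w3 w4 where x: "x = ((w1, w2), (w3, w4))"
      by (metis surj_pair)
    ultimately have *: "((w1, w2), (w3, w4)) \<in> kl_sols c" by simp
    define a where "a = (w3 - w1) mod int c"
    define b where "b = (w3 - w2) mod int c"
    have ab: "0 \<le> a" "a < int c" "0 \<le> b" "b < int c" using assms by (auto simp: a_def b_def)
    have ca: "[a = w3 - w1] (mod int c)" "[b = w3 - w2] (mod int c)" by (auto simp: a_def b_def)
    have "[(2 * w3 - a - b) * (a * b) = (2 * w3 - (w3 - w1) - (w3 - w2)) * ((w3 - w1) * (w3 - w2))] (mod int c)"
      by (intro cong_mult cong_diff ca cong_refl)
    also have "(2 * w3 - (w3 - w1) - (w3 - w2)) * ((w3 - w1) * (w3 - w2)) = (w1 + w2) * (w3 - w1) * (w3 - w2)"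
      by (simp add: algebra_simps)
    finally have "int c dvd (2 * w3 - a - b) * (a * b)"
      using kl_sols_dvd[OF *] cong_dvd_iff by blast
    moreover have "w3 \<in> {0..<int c}" using * by (auto simp: kl_sols_def runits_def)
    ultimately show "h x \<in> Sigma ({..<c} \<times> {..<c}) B"
      using ab by (auto simp: x h_def B_def simp flip: a_def b_def)
  qed
  ultimately have "card (kl_sols c) \<le> card (Sigma ({..<c} \<times> {..<c}) B)"
    by (rule card_inj_on_le) (auto intro!: finite_SigmaI finB)
  also have "\<dots> = (\<Sum>x\<in>{..<c}\<times>{..<c}. card (B x))"
    by (rule card_SigmaI) (auto simp: finB)
  also have "\<dots> \<le> (\<Sum>(a,b)\<in>{..<c}\<times>{..<c}. 2 * (gcd a c * gcd b c))"
    using cB by (intro sum_mono) auto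
  also have "\<dots> = 2 * (\<Sum>a<c. gcd a c) ^ 2"
    by (simp only: power2_eq_square sum_product sum.cartesian_product)
       (simp only: sum_distrib_left case_prod_unfold)
  also have "\<dots> \<le> 2 * (c * ndiv c) ^ 2"
    by (intro mult_left_mono power_mono sum_gcd_le assms) auto
  finally show ?thesis by (simp add: power_mult_distrib mult.assoc)
qed

text \<open>c is the sum of the totients of its divisors, each at most the totient of c. The loss is
  only a divisor function, which the final exponents can afford.\<close>

lemma card_runits:
  assumes "c > 0"
  shows "c \<le> card (runits c) * ndiv c"
proof -
  have "card (runits c) = totient c"
  proof -
    \<comment> \<open>\<open>totatives\<close> takes representatives in 1..c and
      \<open>runits\<close> in 0..c-1; they differ only for c = 1.\<close>
    have "bij_betw (\<lambda>w. if w = c then 0 else int w) (totatives c) (runits c)"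
      using assms
      by (intro bij_betwI[of _ _ _ "\<lambda>w. if w = 0 then c else nat w"])
         (auto simp: in_totatives_iff runits_def coprime_int_iff split: if_splits
            simp flip: coprime_int_iff)
    thus ?thesis by (simp add: totient_def bij_betw_same_card)
  qed
  moreover have "c \<le> (\<Sum>d | d dvd c. totient c)"
    using assms by (subst totient_divisor_sum[symmetric], intro sum_mono) (auto intro!: dvd_imp_le totient_dvd)
  ultimately show ?thesis by (simp add: ndiv_def mult.commute)
qed

text \<open>The substitution w -> u w permutes the units and multiplies the inverse of w by that of
  u.\<close>

lemma kloosterman_scale:
  assumes "c > 0" "u \<in> runits c"
  shows "kloosterman c (m * u) (k * modular_inverse (int c) u) = kloosterman c m k"
proof -
  define i where "i = modular_inverse (int c)"
  have i: "[i w * w = 1] (mod int c)" "i w \<in> runits c" if "w \<in> runits c" for w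
    using that assms by (auto simp: i_def runits_def cong_modular_inverse2 modular_inverse_int_nonneg modular_inverse_int_less)
  have iu: "i u \<in> runits c" using i assms by auto
  have mem: "u * w mod int c \<in> runits c" if "u \<in> runits c" "w \<in> runits c" for u w
    using that assms by (auto simp: runits_def)
  have cancel: "[u * (v * w) = w] (mod int c)" if "[v * u = 1] (mod int c)" for u v w
    using cong_mult[OF that cong_refl[of w]] by (simp add: mult_ac)
  have canc: "u * (v * w mod int c) mod int c = w" if "[v * u = 1] (mod int c)" "w \<in> runits c" for u v w
    using cancel[OF that(1), of w] that(2) by (simp add: cong_def mod_mult_right_eq runits_def)
  show ?thesis
    unfolding kloosterman_def
  proof (rule sum.reindex_bij_witness[of _ "\<lambda>w. i u * w mod int c" "\<lambda>w. u * w mod int c"])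
    fix w assume w: "w \<in> runits c"
    show "i u * (u * w mod int c) mod int c = w"
      using i[OF assms(2)] w by (intro canc) (auto simp: mult.commute)
    show "u * w mod int c \<in> runits c" using mem assms w by auto
    show "u * (i u * w mod int c) mod int c = w"
      using i[OF assms(2)] w by (intro canc) (auto simp: mult.commute)
    show "i u * w mod int c \<in> runits c" using mem iu w by auto
    have "[i (u * w mod int c) = i u * i w] (mod int c)"
    proof -
      have "modular_inverse (int c) (u * w mod int c) = i u * i w mod int c"
      proof (rule modular_inverse_int_eqI)
        have "[(u * w mod int c) * (i u * i w mod int c) = (u * w) * (i u * i w)] (mod int c)"
          by (simp add: cong_def mod_mult_eq)
        also have "(u * w) * (i u * i w) = (i u * u) * (i w * w)" by simp
        also have "[(i u * u) * (i w * w) = 1 * 1] (mod int c)"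
          by (intro cong_mult i assms w)
        finally show "[(u * w mod int c) * (i u * i w mod int c) = 1] (mod int c)" by simp
      qed (use assms in auto)
      thus ?thesis by (simp add: i_def cong_def)
    qed
    hence "[m * (u * w mod int c) + k * i (u * w mod int c) = m * (u * w) + k * (i u * i w)] (mod int c)"
      by (intro cong_add cong_mult cong_refl) auto
    from ec_cong[OF assms(1) this]
    show "ec c (m * (u * w mod int c) + k * modular_inverse (int c) (u * w mod int c)) =
       ec c (m * u * w + k * modular_inverse (int c) u * modular_inverse (int c) w)"
      by (simp add: i_def mult.assoc)
  qed
qed

lemma kloosterman_cong:
  assumes "c > 0" "[m = m'] (mod int c)" "[k = k'] (mod int c)"
  shows "kloosterman c m k = kloosterman c m' k'"
  unfolding kloosterman_def
  by (intro sum.cong refl ec_cong assms cong_add cong_mult cong_refl)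

text \<open>Kloosterman's fourth-moment argument: \<open>K(m, k) = K(m u, k / u)\<close> for every unit \<open>u\<close>, and for
  \<open>k = n q\<close> with a unit \<open>q\<close> at most \<open>2 n\<close> units give the same second argument.\<close>

lemma kloosterman_bound:
  assumes "c > 0" "coprime q (int c)" "n > 0"
  shows "cmod (kloosterman c m (int n * q)) \<le> 4 * real n * real c powr (3 / 4) * real (ndiv c)"
proof -
  define i where "i = modular_inverse (int c)"
  define k where "k = int n * q"
  define F where "F = (\<lambda>k'. \<Sum>m'<c. cmod (kloosterman c (int m') k') ^ 4)"
  \<comment> \<open>\<open>g u\<close> is the second argument after scaling by u, so |K(m, k)|^4 is
    one of the terms of the column sum \<open>F (g u)\<close>.\<close>
  define g where "g = (\<lambda>u. nat ((k * i u) mod int c))"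
  have i: "[i w * w = 1] (mod int c)" "i w \<in> runits c" if "w \<in> runits c" for w
    using that assms by (auto simp: i_def runits_def cong_modular_inverse2 modular_inverse_int_nonneg modular_inverse_int_less)
  have F: "cmod (kloosterman c m k) ^ 4 \<le> F (int (g u))" if u: "u \<in> runits c" for u
  proof -
    define m' where "m' = nat ((m * u) mod int c)"
    have "int m' = (m * u) mod int c" using assms by (simp add: m'_def)
    moreover have "m' < c" using assms by (simp add: m'_def nat_less_iff)
    moreover have "int (g u) = (k * i u) mod int c" using assms by (simp add: g_def)
    ultimately have "kloosterman c m k = kloosterman c (int m') (int (g u))"
      using kloosterman_scale[OF assms(1) u, of m k] kloosterman_cong[OF assms(1)]
      by (metis cong_mod_left cong_refl i_def)
    thus ?thesis unfolding F_def using \<open>m' < c\<close>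
      by (auto intro!: member_le_sum[where f = "\<lambda>m'. cmod (kloosterman c (int m') (int (g u))) ^ 4"])
  qed
  have F0: "F k' \<ge> 0" for k' by (auto simp: F_def intro: sum_nonneg)
  have fib: "card {u \<in> runits c. g u = k'} \<le> n" for k'
  proof -
    \<comment> \<open>If g u = k' then v = 1/u solves n v = k' / q modulo c, so the number of such u
      is at most the number n of solutions allowed by \<open>card_mult_cong_le\<close>.\<close>
    define V where "V = {v \<in> {0..<int c * int 1}. int c dvd int n * v - int k' * modular_inverse (int c) q}"
    have "inj_on i {u \<in> runits c. g u = k'}"
    proof (rule inj_onI)
      fix u v assume *: "u \<in> {u \<in> runits c. g u = k'}" "v \<in> {u \<in> runits c. g u = k'}" "i u = i v"
      have "[u * (i v * v) = u * 1] (mod int c)" "[v * (i u * u) = v * 1] (mod int c)"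
        using * by (intro cong_mult cong_refl i; simp)+
      hence "[u = v] (mod int c)" using * by (simp add: mult_ac) (metis cong_sym cong_trans)
      thus "u = v" using * by (auto simp: cong_def runits_def)
    qed
    moreover have "i ` {u \<in> runits c. g u = k'} \<subseteq> V"
    proof safe
      fix u assume u: "u \<in> runits c" "k' = g u"
      have "[int n * q * i u = int (g u)] (mod int c)"
        using assms by (simp add: g_def k_def cong_def)
      hence "[int n * q * i u * modular_inverse (int c) q = int (g u) * modular_inverse (int c) q] (mod int c)"
        by (intro cong_mult cong_refl)
      moreover have "[int n * q * i u * modular_inverse (int c) q = int n * i u * 1] (mod int c)"
        using cong_mult[OF cong_refl[of "int n * i u"] cong_modular_inverse1[OF assms(2)]]
        by (simp add: mult_ac)
      ultimately have "[int n * i u = int (g u) * modular_inverse (int c) q] (mod int c)"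
        by (metis cong_sym cong_trans mult.right_neutral)
      moreover have "i u \<in> {0..<int c}" using i(2)[OF u(1)] by (auto simp: runits_def)
      ultimately show "i u \<in> V" by (auto simp: V_def u(2) cong_iff_dvd_diff)
    qed
    moreover have "finite V" by (rule finite_subset[of _ "{0..<int c}"]) (auto simp: V_def)
    ultimately have "card {u \<in> runits c. g u = k'} \<le> card V"
      by (rule card_inj_on_le)
    also have "\<dots> \<le> n" unfolding V_def using card_mult_cong_le[of "int n" c 1] assms by simp
    finally show ?thesis .
  qed
  have gc: "g u < c" for u using assms by (simp add: g_def nat_less_iff)
  \<comment> \<open>One and the same value is found once for every unit, while each column is hit at
    most n times: compared with the full fourth moment this gains the number of units, nearly a
    factor c.\<close>
  have "real (card (runits c)) * cmod (kloosterman c m k) ^ 4 \<le> (\<Sum>u\<in>runits c. F (int (g u)))"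
    using sum_bounded_below[of "runits c" "cmod (kloosterman c m k) ^ 4" "\<lambda>u. F (int (g u))"] F by simp
  also have "\<dots> = (\<Sum>k'<c. \<Sum>u\<in>{u \<in> runits c. g u = k'}. F (int (g u)))"
    using gc by (intro sum.group[symmetric]) auto
  also have "\<dots> = (\<Sum>k'<c. real (card {u \<in> runits c. g u = k'}) * F (int k'))"
    by (intro sum.cong refl) simp
  also have "\<dots> \<le> (\<Sum>k'<c. real n * F (int k'))"
    using fib F0 by (intro sum_mono mult_right_mono) auto
  also have "\<dots> = real n * (\<Sum>k'<c. \<Sum>m'<c. cmod (kloosterman c (int m') (int k')) ^ 4)"
    by (simp add: F_def sum_distrib_left)
  also have "\<dots> = real n * (real c ^ 2 * real (card (kl_sols c)))"
    by (subst sum.swap, subst sum_kloosterman_power4) (use assms in auto)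
  also have "\<dots> \<le> real n * (real c ^ 2 * real (2 * c ^ 2 * ndiv c ^ 2))"
    by (intro mult_left_mono of_nat_mono card_kl_sols_le assms) auto
  finally have 1: "real (card (runits c)) * cmod (kloosterman c m k) ^ 4 \<le> 2 * real n * real c ^ 4 * real (ndiv c) ^ 2"
    by (simp add: algebra_simps flip: power_add)
  have nd: "ndiv c \<ge> 1"
  proof -
    have "{1} \<subseteq> {d. d dvd c}" by auto
    hence "card {1::nat} \<le> ndiv c" unfolding ndiv_def using assms by (intro card_mono) auto
    thus ?thesis by simp
  qed
  have "real c * cmod (kloosterman c m k) ^ 4 \<le> real (card (runits c) * ndiv c) * cmod (kloosterman c m k) ^ 4"
    by (intro mult_right_mono of_nat_mono card_runits assms) auto
  also have "\<dots> = real (ndiv c) * (real (card (runits c)) * cmod (kloosterman c m k) ^ 4)" by simp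
  also have "\<dots> \<le> real (ndiv c) * (2 * real n * real c ^ 4 * real (ndiv c) ^ 2)"
    by (intro mult_left_mono 1) auto
  also have "\<dots> = real c * (2 * real n * real c ^ 3 * real (ndiv c) ^ 3)"
    by (simp add: power_numeral_reduce algebra_simps)
  finally have "cmod (kloosterman c m k) ^ 4 \<le> 2 * real n * real c ^ 3 * real (ndiv c) ^ 3"
    using assms by simp
  \<comment> \<open>Rounding up to a perfect fourth power; a power of 4 n and one more factor
    \<open>ndiv c\<close> are given away.\<close>
  also have "\<dots> \<le> (4 * real n) ^ 4 * real c ^ 3 * real (ndiv c) ^ 4"
  proof (intro mult_mono power_increasing)
    have "2 * real n \<le> 4 * real n * 1" by simp
    also have "\<dots> \<le> 4 * real n * (4 * real n) ^ 3" using assms by (intro mult_left_mono one_le_power) auto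
    finally show "2 * real n \<le> (4 * real n) ^ 4" by (simp add: power_numeral_reduce)
  qed (use nd assms in auto)
  also have "\<dots> = (4 * real n * real c powr (3 / 4) * real (ndiv c)) ^ 4"
    using assms by (simp add: power_mult_distrib powr_powr flip: powr_numeral[of "real c powr (3 / 4)"])
  finally show ?thesis unfolding k_def by (subst (asm) power_mono_iff) auto
qed

text \<open>Writing c = d e for each divisor d of c bounds the partial sums by the square of the sum
  of a^(-\<alpha>), as in the Dirichlet series of the divisor function.\<close>

lemma ndiv_powr_summable:
  assumes "\<alpha> > 1"
  shows "summable (\<lambda>c. real (ndiv c) * real c powr - \<alpha>)"
proof (rule summableI_nonneg_bounded)
  define S where "S = (\<Sum>a. real a powr - \<alpha>)"
  have sm: "summable (\<lambda>a. real a powr - \<alpha>)" using assms by (simp add: summable_real_powr_iff)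
  fix n
  have "(\<Sum>c<n. real (ndiv c) * real c powr - \<alpha>) = (\<Sum>c\<in>{1..<n}. \<Sum>d | d dvd c. real c powr - \<alpha>)"
    by (intro sum.mono_neutral_cong_right) (auto simp: ndiv_def)
  also have "\<dots> = (\<Sum>c\<in>{1..<n}. \<Sum>d | d dvd c. real d powr - \<alpha> * real (c div d) powr - \<alpha>)"
    by (intro sum.cong refl) (auto elim!: dvdE simp: powr_mult)
  also have "\<dots> = (\<Sum>(c,d)\<in>Sigma {1..<n} (\<lambda>c. {d. d dvd c}). real d powr - \<alpha> * real (c div d) powr - \<alpha>)"
    by (intro sum.Sigma) auto
  also have "\<dots> = (\<Sum>(d,e)\<in>(\<lambda>(c,d). (d, c div d)) ` Sigma {1..<n} (\<lambda>c. {d. d dvd c}). real d powr - \<alpha> * real e powr - \<alpha>)"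
    by (subst sum.reindex) (auto simp: inj_on_def case_prod_unfold elim!: dvdE)
  also have "\<dots> \<le> (\<Sum>(d,e)\<in>{..<n} \<times> {..<n}. real d powr - \<alpha> * real e powr - \<alpha>)"
    by (intro sum_mono2) (auto dest: dvd_imp_le intro: le_less_trans[OF div_le_dividend])
  also have "\<dots> = (\<Sum>d<n. real d powr - \<alpha>) * (\<Sum>d<n. real d powr - \<alpha>)"
    by (simp add: sum_product sum.cartesian_product)
  also have "\<dots> \<le> S * S"
    unfolding S_def by (intro mult_mono sum_le_suminf sm suminf_nonneg sum_nonneg) auto
  finally show "(\<Sum>c<n. real (ndiv c) * real c powr - \<alpha>) \<le> S * S" .
qed auto

section \<open>Series and completion\<close>

lemma has_sum_diff:
  fixes f g :: "_ \<Rightarrow> 'a :: real_normed_vector"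
  assumes "(f has_sum a) A" "(g has_sum b) A"
  shows "((\<lambda>x. f x - g x) has_sum (a - b)) A"
  using has_sum_add[OF assms(1), of "\<lambda>x. - g x" "- b"] assms(2) by (simp add: has_sum_uminus)

lemma has_sum_finite_sum:
  fixes f :: "_ \<Rightarrow> _ \<Rightarrow> 'a :: topological_comm_monoid_add"
  assumes "\<And>i. i \<in> I \<Longrightarrow> (f i has_sum s i) A"
  shows "((\<lambda>x. \<Sum>i\<in>I. f i x) has_sum (\<Sum>i\<in>I. s i)) A"
  using assms by (induction I rule: infinite_finite_induct) (auto intro!: has_sum_add)

text \<open>Weierstrass's theorem for unordered sums: a summable majorant on a closed ball makes the
  finite partial sums converge uniformly there.\<close>

lemma holomorphic_on_infsum:
  fixes f :: "'i \<Rightarrow> complex \<Rightarrow> complex"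
  assumes "open U" "\<And>i. i \<in> I \<Longrightarrow> f i holomorphic_on U"
    and "\<And>z. z \<in> U \<Longrightarrow> \<exists>r>0. \<exists>M. M summable_on I \<and> cball z r \<subseteq> U \<and> (\<forall>i\<in>I. \<forall>w\<in>cball z r. norm (f i w) \<le> M i)"
  shows "(\<lambda>z. \<Sum>\<^sub>\<infinity>i\<in>I. f i z) holomorphic_on U"
proof -
  have "(\<lambda>z. \<Sum>\<^sub>\<infinity>i\<in>I. f i z) analytic_on U"
    unfolding analytic_on_def
  proof
    fix z assume "z \<in> U"
    from assms(3)[OF this] obtain r M where r: "r > 0" "M summable_on I" "cball z r \<subseteq> U"
      and M: "\<And>i w. i \<in> I \<Longrightarrow> w \<in> cball z r \<Longrightarrow> norm (f i w) \<le> M i" by blast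
    have "uniform_limit (cball z r) (\<lambda>X w. \<Sum>i\<in>X. f i w) (\<lambda>w. \<Sum>\<^sub>\<infinity>i\<in>I. f i w) (finite_subsets_at_top I)"
      by (rule Weierstrass_m_test_general) (use M r in auto)
    moreover have "eventually (\<lambda>X. continuous_on (cball z r) (\<lambda>w. \<Sum>i\<in>X. f i w) \<and>
       (\<lambda>w. \<Sum>i\<in>X. f i w) holomorphic_on ball z r) (finite_subsets_at_top I)"
    proof (rule eventually_finite_subsets_at_top_weakI)
      fix X assume X: "finite X" "X \<subseteq> I"
      have "(\<lambda>w. \<Sum>i\<in>X. f i w) holomorphic_on cball z r"
        using X assms(2) r(3) by (intro holomorphic_on_sum holomorphic_on_subset[OF assms(2)]) auto
      thus "continuous_on (cball z r) (\<lambda>w. \<Sum>i\<in>X. f i w) \<and> (\<lambda>w. \<Sum>i\<in>X. f i w) holomorphic_on ball z r"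
        using holomorphic_on_imp_continuous_on holomorphic_on_subset ball_subset_cball by blast
    qed
    ultimately have "(\<lambda>w. \<Sum>\<^sub>\<infinity>i\<in>I. f i w) holomorphic_on ball z r"
      by (metis holomorphic_uniform_limit finite_subsets_at_top_neq_bot)
    thus "\<exists>e>0. (\<lambda>z. \<Sum>\<^sub>\<infinity>i\<in>I. f i z) holomorphic_on ball z e" using r by blast
  qed
  thus ?thesis by (rule analytic_imp_holomorphic)
qed

lemma summable_on_int_nat:
  fixes f :: "int \<Rightarrow> real"
  assumes "(\<lambda>n::nat. f (int n)) summable_on UNIV" "(\<lambda>n::nat. f (- int n)) summable_on UNIV"
  shows "f summable_on UNIV"
proof -
  have "f summable_on range int" using assms(1) by (subst summable_on_reindex) (auto simp: o_def)
  moreover have "f summable_on range (\<lambda>n. - int n)" using assms(2) by (subst summable_on_reindex) (auto simp: o_def inj_def)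
  ultimately have "f summable_on (range int \<union> range (\<lambda>n. - int n))"
    by (rule summable_on_union)
  moreover have "x \<in> range int \<union> range (\<lambda>n. - int n)" for x
    by (cases x rule: int_cases2) auto
  hence "range int \<union> range (\<lambda>n. - int n) = UNIV" by blast
  ultimately show ?thesis by simp
qed

lemma summable_on_nat_powr:
  assumes "a > 1"
  shows "(\<lambda>n::nat. (1 + real n) powr - a) summable_on UNIV"
proof -
  have "summable (\<lambda>n. real n powr - a)" using assms by (simp add: summable_real_powr_iff)
  hence "summable (\<lambda>n. real (Suc n) powr - a)" by (subst summable_Suc_iff)
  thus ?thesis by (intro summable_nonneg_imp_summable_on) (auto simp: add.commute)
qed

lemma summable_on_int_powr:
  assumes "a > 1"
  shows "(\<lambda>w::int. (1 + real_of_int \<bar>w\<bar>) powr - a) summable_on UNIV"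
  by (rule summable_on_int_nat) (use summable_on_nat_powr[OF assms] in simp_all)

lemma summable_on_real_times:
  fixes f g :: "_ \<Rightarrow> real"
  assumes "f summable_on A" "g summable_on B" "\<And>x. x \<in> A \<Longrightarrow> f x \<ge> 0" "\<And>x. x \<in> B \<Longrightarrow> g x \<ge> 0"
  shows "(\<lambda>(x, y). f x * g y) summable_on A \<times> B"
proof (rule summable_on_SigmaI[where g = "\<lambda>x. f x * infsum g B"])
  show "((\<lambda>y. case (x, y) of (x, y) \<Rightarrow> f x * g y) has_sum f x * infsum g B) B" for x
    using assms(2) by (auto intro!: has_sum_cmult_right)
qed (use assms in \<open>auto intro!: summable_on_cmult_left\<close>)

section \<open>Sums over lower rows (c, w)\<close>

definition cw_index :: "(nat \<times> int) set" where
  "cw_index = {1..} \<times> UNIV"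

lemma summable_on_cw_index:
  assumes "a > 1" "b > 1"
  shows "(\<lambda>(c, w). real c powr - a * (1 + real_of_int \<bar>w\<bar>) powr - b) summable_on cw_index"
  unfolding cw_index_def
proof (rule summable_on_real_times)
  have "summable (\<lambda>n. real n powr - a)" using assms by (simp add: summable_real_powr_iff)
  thus "(\<lambda>c. real c powr - a) summable_on {1..}"
    by (intro summable_on_subset_banach[OF summable_nonneg_imp_summable_on]) auto
qed (use assms summable_on_int_powr in auto)

text \<open>An explicit constant instead of an infimum over the lattice: local uniformity in \<tau>
  then means bounding its reciprocal, a continuous function of \<tau>, on compact sets.\<close>

definition lattice_const :: "complex \<Rightarrow> real" where
  "lattice_const \<tau> = 1 / (1 / Im \<tau> + 1 + cmod \<tau> / Im \<tau>)"

lemma lattice_const_pos: "Im \<tau> > 0 \<Longrightarrow> lattice_const \<tau> > 0"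
  by (auto simp: lattice_const_def intro!: divide_pos_pos add_pos_nonneg)

lemma lattice_bound:
  assumes "Im \<tau> > 0"
  shows "lattice_const \<tau> * (\<bar>c\<bar> + \<bar>w\<bar>) \<le> cmod (of_real c * \<tau> + of_real w)"
proof -
  define r where "r = cmod (of_real c * \<tau> + of_real w)"
  have "\<bar>c\<bar> * Im \<tau> = \<bar>Im (of_real c * \<tau> + of_real w)\<bar>"
    using assms by (simp add: abs_mult)
  also have "\<dots> \<le> r" unfolding r_def by (rule abs_Im_le_cmod)
  finally have c: "\<bar>c\<bar> \<le> r / Im \<tau>" using assms by (simp add: field_simps)
  have "\<bar>w\<bar> = cmod ((of_real c * \<tau> + of_real w) - of_real c * \<tau>)" by simp
  also have "\<dots> \<le> r + \<bar>c\<bar> * cmod \<tau>" unfolding r_def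
    by (rule order.trans[OF norm_triangle_ineq4]) (simp add: norm_mult)
  also have "\<dots> \<le> r + r / Im \<tau> * cmod \<tau>" using c by (intro add_mono mult_right_mono) auto
  finally have "\<bar>c\<bar> + \<bar>w\<bar> \<le> r * (1 / Im \<tau> + 1 + cmod \<tau> / Im \<tau>)"
    using c by (simp add: algebra_simps)
  moreover have "1 / Im \<tau> + 1 + cmod \<tau> / Im \<tau> > 0"
    using assms by (auto intro!: add_pos_nonneg)
  ultimately show ?thesis by (simp add: lattice_const_def field_simps r_def)
qed

section \<open>Summation against a periodic weight\<close>

lemma harm_powr_bound:
  assumes "n > 0" "\<epsilon> > 0"
  shows "harm n \<le> (1 + 1 / \<epsilon>) * real n powr \<epsilon>"
proof -
  have "harm n - ln (real n) \<le> (harm 1 - ln (real 1) :: real)"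
    using assms(1) decseq_harm_diff_ln[unfolded decseq_def, rule_format, of 0 "n - 1"] by simp
  hence "harm n \<le> 1 + ln (real n)" by (simp add: harm_def)
  also have "\<dots> \<le> real n powr \<epsilon> + real n powr \<epsilon> / \<epsilon>"
    using assms by (intro add_mono ge_one_powr_ge_zero ln_powr_bound) auto
  finally show ?thesis by (simp add: algebra_simps)
qed

lemma sin_ge_half:
  assumes "0 \<le> x" "x \<le> pi / 2"
  shows "x / 2 \<le> sin x"
proof -
  \<comment> \<open>With x^2 at most 3 the cubic Taylor remainder x^3 / 6 is at most x / 2.\<close>
  have "x * x \<le> (pi / 2) * (pi / 2)" using assms by (intro mult_mono) auto
  also have "\<dots> \<le> (3.4 / 2) * (3.4 / 2)" using pi_less_4 pi_approx by (intro mult_mono) auto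
  finally have "x * x \<le> 3" by simp
  hence "x * (x * x) \<le> x * 3" using assms by (intro mult_left_mono) auto
  hence "x ^ 3 \<le> 3 * x" by (simp add: power3_eq_cube)
  moreover have "\<bar>sin x - (\<Sum>m<3. sin_coeff m * x ^ m)\<bar> \<le> inverse (fact 3) * \<bar>x\<bar> ^ 3"
    by (rule Maclaurin_sin_bound)
  hence "\<bar>sin x - x\<bar> \<le> x ^ 3 / 6"
    using assms by (simp add: numeral_3_eq_3 sin_coeff_def fact_numeral)
  ultimately have "\<bar>sin x - x\<bar> \<le> x / 2" by simp
  thus ?thesis by linarith
qed

lemma norm_ee_minus_1: "cmod (ee t - 1) = 2 * \<bar>sin (pi * t)\<bar>"
proof -
  have "ee t - 1 = ee (t / 2) * (ee (t / 2) - cnj (ee (t / 2)))"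
    by (simp add: algebra_simps cnj_ee flip: ee_add)
  also have "ee (t / 2) - cnj (ee (t / 2)) = 2 * \<i> * of_real (sin (pi * t))"
    by (simp add: complex_eq_iff ee_def Re_exp Im_exp)
  finally have "cmod (ee t - 1) = cmod (ee (t / 2)) * cmod (2 * \<i> * of_real (sin (pi * t)))"
    by (simp only: norm_mult)
  thus ?thesis by (simp add: norm_mult)
qed

text \<open>The two terms are the reciprocal distances of m / c from 0 and from 1. Adding both
  instead of choosing the nearer point makes the sum over m two harmonic sums.\<close>

lemma norm_ec_minus_1_inverse_le:
  assumes "0 < m" "m < c"
  shows "1 / cmod (ec c (int m) - 1) \<le> real c / real m + real c / real (c - m)"
proof -
  have *: "1 / cmod (ee t - 1) \<le> 1 / t" if "0 < t" "t \<le> 1/2" for t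
  proof -
    have "t \<le> pi * t / 2 * 2" using that pi_gt3 by (simp add: field_simps)
    also have "pi * t / 2 \<le> sin (pi * t)" using that by (intro sin_ge_half) (auto simp: field_simps)
    finally have "t \<le> cmod (ee t - 1)" by (simp add: norm_ee_minus_1)
    thus ?thesis using that by (simp add: frac_le)
  qed
  define t where "t = real m / real c"
  have t: "0 < t" "t < 1" using assms by (auto simp: t_def)
  have "1 / cmod (ee t - 1) \<le> 1 / t + 1 / (1 - t)"
  proof (cases "t \<le> 1/2")
    case True
    thus ?thesis using *[of t] t by (simp add: add_increasing2)
  next
    case False
    have "cmod (ee t - 1) = cmod (ee (1 - t) - 1)"
    proof -
      have "sin (pi * (1 - t)) = sin (pi * t)" by (simp add: algebra_simps sin_diff)
      thus ?thesis by (simp add: norm_ee_minus_1)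
    qed
    thus ?thesis using *[of "1 - t"] t False by (simp add: add_increasing)
  qed
  also have "1 / t = real c / real m" by (simp add: t_def)
  also have "1 / (1 - t) = real c / real (c - m)" using assms by (simp add: t_def of_nat_diff field_simps)
  finally show ?thesis by (simp add: ec_def t_def)
qed

lemma sum_norm_ec_minus_1_inverse:
  assumes "c > 0"
  shows "(\<Sum>m\<in>{1..<c}. 1 / cmod (ec c (int m) - 1)) \<le> 2 * real c * harm c"
proof -
  have 1: "(\<Sum>m\<in>{1..<c}. 1 / real m) \<le> harm c"
    unfolding harm_def inverse_eq_divide by (intro sum_mono2) auto
  have "(\<Sum>m\<in>{1..<c}. 1 / cmod (ec c (int m) - 1)) \<le> (\<Sum>m\<in>{1..<c}. real c / real m + real c / real (c - m))"
    by (intro sum_mono norm_ec_minus_1_inverse_le) auto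
  also have "\<dots> = real c * (\<Sum>m\<in>{1..<c}. 1 / real m) + real c * (\<Sum>m\<in>{1..<c}. 1 / real (c - m))"
    by (simp add: sum.distrib sum_distrib_left)
  also have "(\<Sum>m\<in>{1..<c}. 1 / real (c - m)) = (\<Sum>m\<in>{1..<c}. 1 / real m)"
    by (rule sum.reindex_bij_witness[of _ "\<lambda>m. c - m" "\<lambda>m. c - m"]) auto
  also have "real c * (\<Sum>m\<in>{1..<c}. 1 / real m) + real c * (\<Sum>m\<in>{1..<c}. 1 / real m) \<le> real c * harm c + real c * harm c"
    by (intro add_mono mult_left_mono 1) auto
  finally show ?thesis by (simp add: algebra_simps)
qed

lemma finite_fourier_inversion:
  assumes "c > 0" "\<And>w. \<psi> (w + int c) = \<psi> w"
  shows "\<psi> w = (\<Sum>m<c. (\<Sum>v\<in>{0..<int c}. \<psi> v * ec c (int m * v)) * ec c (- (int m * w))) / of_nat c"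
proof -
  have per: "\<psi> (w + int c * int k) = \<psi> w" for w k
  proof (induction k)
    case (Suc k)
    have "\<psi> (w + int c * int (Suc k)) = \<psi> (w + int c * int k + int c)"
      by (simp add: algebra_simps)
    thus ?case using Suc assms(2) by simp
  qed simp
  have per': "\<psi> (w mod int c) = \<psi> w"
  proof (cases "w div int c \<ge> 0")
    case True
    thus ?thesis using per[of "w mod int c" "nat (w div int c)"] by simp
  next
    case False
    have "w mod int c = w + int c * int (nat (- (w div int c)))"
      using False minus_mult_div_eq_mod[of w "int c"] by simp
    thus ?thesis using per[of w "nat (- (w div int c))"] by simp
  qed
  have "(\<Sum>m<c. (\<Sum>v\<in>{0..<int c}. \<psi> v * ec c (int m * v)) * ec c (- (int m * w)))
      = (\<Sum>m<c. \<Sum>v\<in>{0..<int c}. \<psi> v * ec c ((v - w) * int m))"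
    unfolding sum_distrib_right
    by (intro sum.cong refl) (simp add: algebra_simps flip: ec_add)
  also have "\<dots> = (\<Sum>v\<in>{0..<int c}. \<Sum>m<c. \<psi> v * ec c ((v - w) * int m))"
    by (rule sum.swap)
  also have "\<dots> = (\<Sum>v\<in>{0..<int c}. \<psi> v * (if int c dvd v - w then of_nat c else 0))"
    by (simp only: sum_distrib_left [symmetric] sum_ec[OF assms(1)])
  also have "\<dots> = (\<Sum>v\<in>{w mod int c}. \<psi> v * (if int c dvd v - w then of_nat c else 0))"
  proof (rule sum.mono_neutral_right)
    show "\<forall>i\<in>{0..<int c} - {w mod int c}. \<psi> i * (if int c dvd i - w then of_nat c else 0) = 0"
    proof
      fix i assume i: "i \<in> {0..<int c} - {w mod int c}"
      have "\<not> int c dvd i - w"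
      proof
        assume "int c dvd i - w"
        hence "i mod int c = w mod int c" by (simp add: mod_eq_dvd_iff)
        thus False using i by auto
      qed
      thus "\<psi> i * (if int c dvd i - w then of_nat c else 0) = 0" by simp
    qed
  qed (use assms in auto)
  also have "\<dots> = \<psi> w * of_nat c"
    using assms by (simp add: per' mod_eq_dvd_iff [symmetric])
  finally show ?thesis using assms by simp
qed

text \<open>Completion: expanding the periodic weight \<open>\<psi>\<close> into additive characters and summing by parts
  against each non-trivial one.\<close>

lemma completion_bound:
  fixes h :: "int \<Rightarrow> complex"
  assumes c: "c > 0" and per: "\<And>w. \<psi> (w + int c) = \<psi> w"
    and bound: "\<And>m. cmod (\<Sum>v\<in>{0..<int c}. \<psi> v * ec c (m * v)) \<le> \<kappa>"
    and h: "((\<lambda>w. cmod (h w)) has_sum H) UNIV"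
    and V: "((\<lambda>w. cmod (h (w + 1) - h w)) has_sum V) UNIV"
  shows "cmod (\<Sum>\<^sub>\<infinity>w. \<psi> w * h w) \<le> \<kappa> * (H / real c + 2 * harm c * V)"
proof -
  define E where "E = (\<lambda>m::nat. \<Sum>\<^sub>\<infinity>w. h w * ec c (- (int m * w)))"
  define X where "X = (\<lambda>m::nat. \<Sum>v\<in>{0..<int c}. \<psi> v * ec c (int m * v))"
  have summ: "(\<lambda>w. h w * ec c (- (int m * w))) summable_on UNIV" for m
    by (rule abs_summable_summable) (use h in \<open>auto simp: norm_mult dest: has_sum_imp_summable\<close>)
  have E: "((\<lambda>w. h w * ec c (- (int m * w))) has_sum E m) UNIV" for m
    unfolding E_def by (rule has_sum_infsum[OF summ])
  have V0: "V \<ge> 0" "H \<ge> 0" using h V by (auto intro: has_sum_nonneg)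
  have \<kappa>0: "\<kappa> \<ge> 0" using order.trans[OF norm_ge_zero bound] .
  have E0: "cmod (E m) \<le> H" for m
    by (rule norm_infsum_le[OF E h]) (simp add: norm_mult)
  have Em: "cmod (E m) \<le> V * (1 / cmod (ec c (int m) - 1))" if m: "0 < m" "m < c" for m
  proof -
    \<comment> \<open>Summation by parts as a reindexing: shifting w by one multiplies the character
      by a constant, so E m times \<open>ec c (int m) - 1\<close> is the series with h replaced by
      its differences.\<close>
    have "((\<lambda>w. h (w + 1) * ec c (- (int m * (w + 1)))) has_sum E m) UNIV"
      using E[of m] by (subst has_sum_reindex_bij_witness[of UNIV "\<lambda>w. w - 1" "\<lambda>w. w + 1" UNIV
         "\<lambda>w. h w * ec c (- (int m * w))" _ _ "E m"]) auto
    from has_sum_cmult_left[OF this, of "ec c (int m)"]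
    have "((\<lambda>w. h (w + 1) * ec c (- (int m * w))) has_sum E m * ec c (int m)) UNIV"
      by (simp add: mult.assoc ring_distribs flip: ec_add)
    from has_sum_diff[OF this E[of m]]
    have "((\<lambda>w. (h (w + 1) - h w) * ec c (- (int m * w))) has_sum (E m * (ec c (int m) - 1))) UNIV"
      by (simp add: algebra_simps)
    hence "cmod (E m * (ec c (int m) - 1)) \<le> V"
      by (rule norm_infsum_le[OF _ V]) (simp add: norm_mult)
    moreover have "ec c (int m) \<noteq> 1" using m c by (auto simp: ec_eq_1_iff dest: zdvd_imp_le)
    ultimately show ?thesis by (simp only: norm_mult) (simp add: pos_le_divide_eq)
  qed
  \<comment> \<open>The frequency m = 0 does not oscillate and is bounded by the full sum H; all
    others only cost the variation V.\<close>
  have "(\<Sum>m<c. cmod (E m)) = cmod (E 0) + (\<Sum>m\<in>{1..<c}. cmod (E m))"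
    using c by (simp add: lessThan_atLeast0 sum.atLeast_Suc_lessThan)
  also have "\<dots> \<le> H + (\<Sum>m\<in>{1..<c}. V * (1 / cmod (ec c (int m) - 1)))"
    by (intro add_mono E0 sum_mono Em) auto
  also have "\<dots> \<le> H + V * (2 * real c * harm c)"
    unfolding sum_distrib_left[symmetric]
    by (intro add_left_mono mult_left_mono sum_norm_ec_minus_1_inverse c V0)
  finally have S: "(\<Sum>m<c. cmod (E m)) \<le> H + V * (2 * real c * harm c)" .
  have \<psi>: "\<psi> w = (\<Sum>m<c. X m * ec c (- (int m * w))) / of_nat c" for w
    unfolding X_def by (rule finite_fourier_inversion[of c \<psi>, OF c per])
  have "(\<Sum>\<^sub>\<infinity>w. \<psi> w * h w) = (\<Sum>\<^sub>\<infinity>w. \<Sum>m<c. X m / of_nat c * (h w * ec c (- (int m * w))))"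
    by (intro infsum_cong, subst \<psi>)
       (simp add: sum_distrib_left sum_distrib_right sum_divide_distrib mult_ac)
  also have "((\<lambda>w. \<Sum>m<c. X m / of_nat c * (h w * ec c (- (int m * w)))) has_sum (\<Sum>m<c. X m / of_nat c * E m)) UNIV"
    by (intro has_sum_finite_sum has_sum_cmult_right E)
  hence "(\<Sum>\<^sub>\<infinity>w. \<Sum>m<c. X m / of_nat c * (h w * ec c (- (int m * w)))) = (\<Sum>m<c. X m / of_nat c * E m)"
    by (rule infsumI)
  also have "cmod \<dots> \<le> (\<Sum>m<c. cmod (X m / of_nat c * E m))" by (rule norm_sum)
  also have "\<dots> \<le> (\<Sum>m<c. \<kappa> / real c * cmod (E m))"
    unfolding X_def by (intro sum_mono) (auto simp: norm_mult norm_divide intro!: mult_right_mono divide_right_mono bound)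
  also have "\<dots> = \<kappa> / real c * (\<Sum>m<c. cmod (E m))" by (simp add: sum_distrib_left)
  also have "\<dots> \<le> \<kappa> / real c * (H + V * (2 * real c * harm c))"
    by (intro mult_left_mono S) (use \<kappa>0 in auto)
  also have "\<dots> = \<kappa> * (H / real c + 2 * harm c * V)"
    using c by (simp add: field_simps)
  finally show ?thesis .
qed

section \<open>The Bessel kernel\<close>

definition bes_coeff :: "complex \<Rightarrow> nat \<Rightarrow> complex" where
  "bes_coeff s k = rGamma (s + 1 / 2 + of_nat k) / fact k"

text \<open>What remains of sqrt Y * I_{s-1/2}(2 pi Y) after removing Y^s: a power series in Y^2
  with constant term \<open>bes0 s\<close>, hence harmless as Y tends to 0.\<close>

definition bes :: "complex \<Rightarrow> real \<Rightarrow> complex" where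
  "bes s Y = of_real pi powr (s - 1 / 2) * (\<Sum>k. bes_coeff s k * of_real (pi * Y) ^ (2 * k))"

definition bes0 :: "complex \<Rightarrow> complex" where
  "bes0 s = of_real pi powr (s - 1 / 2) * rGamma (s + 1 / 2)"

text \<open>From rGamma z = z rGamma (z + 1) with |z| at least 1/2, each step at most doubles the
  value. The factor 2^k is crude but keeps the bound uniform in s up to one value of rGamma.\<close>

lemma norm_bes_coeff_le:
  assumes "Re s > 0"
  shows "cmod (bes_coeff s k) \<le> cmod (rGamma (s + 1 / 2)) * 2 ^ k / fact k"
proof -
  have "cmod (rGamma (s + 1 / 2 + of_nat k)) \<le> cmod (rGamma (s + 1 / 2)) * 2 ^ k"
  proof (induction k)
    case (Suc k)
    have "rGamma (s + 1 / 2 + of_nat k) = (s + 1 / 2 + of_nat k) * rGamma (s + 1 / 2 + of_nat (Suc k))"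
      using rGamma_plus1[of "s + 1 / 2 + of_nat k"] by (simp add: add_ac)
    hence "cmod (rGamma (s + 1 / 2 + of_nat k)) =
      cmod (s + 1 / 2 + of_nat k) * cmod (rGamma (s + 1 / 2 + of_nat (Suc k)))"
      by (simp only: norm_mult)
    moreover have "1 / 2 \<le> cmod (s + 1 / 2 + of_nat k)"
      using assms complex_Re_le_cmod[of "s + 1 / 2 + of_nat k"] by simp
    hence "1 / 2 * cmod (rGamma (s + 1 / 2 + of_nat (Suc k))) \<le>
       cmod (s + 1 / 2 + of_nat k) * cmod (rGamma (s + 1 / 2 + of_nat (Suc k)))"
      by (rule mult_right_mono) auto
    ultimately have "cmod (rGamma (s + 1 / 2 + of_nat (Suc k))) \<le> 2 * cmod (rGamma (s + 1 / 2 + of_nat k))"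
      by simp
    thus ?case using Suc.IH by simp
  qed simp
  thus ?thesis by (simp add: bes_coeff_def norm_divide divide_right_mono)
qed

lemma norm_bes_term_le:
  assumes "Re s > 0"
  shows "cmod (bes_coeff s k * of_real (pi * Y) ^ (2 * k)) \<le>
    cmod (rGamma (s + 1 / 2)) * ((2 * (pi * Y)\<^sup>2) ^ k / fact k)"
proof -
  have "cmod (bes_coeff s k * of_real (pi * Y) ^ (2 * k)) = cmod (bes_coeff s k) * ((pi * Y)\<^sup>2) ^ k"
    by (simp add: norm_mult norm_power power_mult power_mult_distrib flip: power_abs)
  also have "\<dots> \<le> (cmod (rGamma (s + 1 / 2)) * 2 ^ k / fact k) * ((pi * Y)\<^sup>2) ^ k"
    by (intro mult_right_mono norm_bes_coeff_le assms) auto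
  finally show ?thesis by (simp add: power_mult_distrib)
qed

lemma summable_exp_terms: "summable (\<lambda>k. (x::real) ^ k / fact k)"
  using summable_exp[of x] by (simp add: field_simps)

lemma exp_eq_suminf: "exp (x::real) = (\<Sum>k. x ^ k / fact k)"
  by (simp add: exp_def scaleR_conv_of_real field_simps)

lemma summable_bes_terms:
  assumes "Re s > 0"
  shows "summable (\<lambda>k. bes_coeff s k * of_real (pi * Y) ^ (2 * k))"
  by (rule summable_comparison_test'[OF summable_mult[OF summable_exp_terms], OF norm_bes_term_le])
     (rule assms)

lemma bessel_I_eq_bes:
  assumes "Y > 0" "Re s > 0"
  shows "of_real (sqrt Y) * bessel_I (s - 1 / 2) (2 * pi * Y) = of_real Y powr s * bes s Y"
proof -
  have 1: "of_real (2 * pi * Y / 2) powr (s - 1 / 2 + 2 * of_nat k) =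
     of_real Y powr (s - 1 / 2) * of_real pi powr (s - 1 / 2) * of_real (pi * Y) ^ (2 * k)" for k
  proof -
    have "of_real (2 * pi * Y / 2) powr (s - 1 / 2 + 2 * of_nat k) =
       of_real (pi * Y) powr (s - 1 / 2) * of_real (pi * Y) powr of_nat (2 * k)"
      by (simp add: powr_add)
    also have "of_real (pi * Y) powr (s - 1 / 2) = of_real Y powr (s - 1 / 2) * of_real pi powr (s - 1 / 2)"
      using assms by (simp add: powr_times_real mult.commute)
    also have "complex_of_real (pi * Y) powr of_nat (2 * k) = of_real (pi * Y) ^ (2 * k)"
      using assms by (intro powr_nat') auto
    finally show ?thesis by (simp add: mult_ac)
  qed
  have "bessel_I (s - 1 / 2) (2 * pi * Y) = (\<Sum>k. (of_real Y powr (s - 1 / 2) * of_real pi powr (s - 1 / 2)) *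
     (bes_coeff s k * of_real (pi * Y) ^ (2 * k)))"
    unfolding bessel_I_def 1 bes_coeff_def by (simp add: mult_ac add_ac)
  also have "\<dots> = of_real Y powr (s - 1 / 2) * bes s Y"
    by (subst suminf_mult[OF summable_bes_terms[OF assms(2)]]) (simp add: bes_def)
  also have "of_real Y powr (s - 1 / 2) = of_real Y powr s / of_real (sqrt Y)"
    using assms by (simp add: powr_diff csqrt_of_real_nonneg flip: csqrt_conv_powr)
  finally show ?thesis using assms by simp
qed

lemma exp_minus_1_le:
  assumes "0 \<le> (x::real)"
  shows "exp x - 1 \<le> x * exp x"
proof -
  have "1 + (- x) \<le> exp (- x)" by (rule exp_ge_add_one_self)
  hence "(1 - x) * exp x \<le> exp (- x) * exp x" by (intro mult_right_mono) auto
  thus ?thesis by (simp add: algebra_simps flip: exp_add)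
qed

text \<open>Termwise comparison with an exponential series, constant terms removed on both sides.
  The bound is quadratic in small Y, which is what the estimate of \<open>nerr\<close> lives
  on.\<close>

lemma norm_bes_diff_le:
  assumes "Re s > 0"
  shows "cmod (bes s Y - bes0 s) \<le> cmod (bes0 s) * (exp (2 * (pi * Y)\<^sup>2) - 1)"
proof -
  define T where "T = (\<lambda>k. bes_coeff s k * of_real (pi * Y) ^ (2 * k))"
  define M where "M = (\<lambda>k. cmod (rGamma (s + 1 / 2)) * ((2 * (pi * Y)\<^sup>2) ^ k / fact k))"
  have sT: "summable T" unfolding T_def by (rule summable_bes_terms[OF assms])
  have sM: "summable M" unfolding M_def by (intro summable_mult summable_exp_terms)
  have TM: "cmod (T k) \<le> M k" for k unfolding T_def M_def by (rule norm_bes_term_le[OF assms])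
  have "(\<Sum>k. T k) - rGamma (s + 1 / 2) = (\<Sum>k. T (Suc k))"
    using suminf_split_head[OF sT] by (simp add: T_def bes_coeff_def)
  also have "cmod \<dots> \<le> (\<Sum>k. M (Suc k))"
    using TM sM by (intro norm_suminf_le) (auto simp: summable_Suc_iff)
  also have "\<dots> = (\<Sum>k. M k) - M 0" using suminf_split_head[OF sM] by simp
  also have "(\<Sum>k. M k) = cmod (rGamma (s + 1 / 2)) * exp (2 * (pi * Y)\<^sup>2)"
    unfolding M_def exp_eq_suminf by (rule suminf_mult[OF summable_exp_terms])
  finally have "cmod ((\<Sum>k. T k) - rGamma (s + 1 / 2)) \<le> cmod (rGamma (s + 1 / 2)) * (exp (2 * (pi * Y)\<^sup>2) - 1)"
    by (simp add: M_def algebra_simps)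
  hence "cmod (of_real pi powr (s - 1 / 2)) * cmod ((\<Sum>k. T k) - rGamma (s + 1 / 2)) \<le>
     cmod (of_real pi powr (s - 1 / 2)) * (cmod (rGamma (s + 1 / 2)) * (exp (2 * (pi * Y)\<^sup>2) - 1))"
    by (rule mult_left_mono) auto
  moreover have "bes s Y - bes0 s = of_real pi powr (s - 1 / 2) * ((\<Sum>k. T k) - rGamma (s + 1 / 2))"
    by (simp add: bes_def bes0_def T_def algebra_simps)
  ultimately show ?thesis by (simp add: bes0_def norm_mult mult.assoc)
qed

lemma bes0_holomorphic: "bes0 holomorphic_on UNIV"
  unfolding bes0_def by (auto intro!: holomorphic_intros)

lemma continuous_on_compact_norm_bound:
  assumes "continuous_on S f" "compact S"
  obtains B where "\<And>x. x \<in> S \<Longrightarrow> norm (f x) \<le> B"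
  using compact_imp_bounded[OF compact_continuous_image[OF assms]] unfolding bounded_iff by blast

lemma bes_holomorphic: "(\<lambda>s. bes s Y) holomorphic_on {s. Re s > 0}"
proof -
  have "(\<lambda>s. \<Sum>\<^sub>\<infinity>k. bes_coeff s k * of_real (pi * Y) ^ (2 * k)) holomorphic_on {s. Re s > 0}"
  proof (rule holomorphic_on_infsum)
    show "open {s. Re s > 0}" by (rule open_halfspace_Re_gt)
  next
    show "(\<lambda>s. bes_coeff s k * of_real (pi * Y) ^ (2 * k)) holomorphic_on {s. Re s > 0}" for k
      unfolding bes_coeff_def by (auto intro!: holomorphic_intros)
  next
    fix z :: complex assume z: "z \<in> {s. Re s > 0}"
    obtain r where r: "r > 0" "cball z r \<subseteq> {s. Re s > 0}"
      using open_contains_cball[THEN iffD1, OF open_halfspace_Re_gt[of 0]] z by auto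
    have "continuous_on (cball z r) (\<lambda>s. rGamma (s + 1 / 2))"
      by (intro holomorphic_on_imp_continuous_on holomorphic_intros)
    then obtain B where B: "\<And>s. s \<in> cball z r \<Longrightarrow> cmod (rGamma (s + 1 / 2)) \<le> B"
      using continuous_on_compact_norm_bound[OF _ compact_cball] by blast
    have "(\<lambda>k. B * ((2 * (pi * Y)\<^sup>2) ^ k / fact k)) summable_on UNIV"
    proof -
      have "summable (\<lambda>k. norm (B * ((2 * (pi * Y)\<^sup>2) ^ k / fact k)))"
        using summable_mult[OF summable_exp_terms[of "2 * (pi * Y)\<^sup>2"], of "\<bar>B\<bar>"]
        by (simp add: abs_mult)
      thus ?thesis by (rule norm_summable_imp_summable_on)
    qed
    moreover have "norm (bes_coeff w k * of_real (pi * Y) ^ (2 * k)) \<le> B * ((2 * (pi * Y)\<^sup>2) ^ k / fact k)"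
      if "w \<in> cball z r" for w k
    proof (rule order.trans[OF norm_bes_term_le])
      show "Re w > 0" using that r by blast
      show "cmod (rGamma (w + 1 / 2)) * ((2 * (pi * Y)\<^sup>2) ^ k / fact k) \<le> B * ((2 * (pi * Y)\<^sup>2) ^ k / fact k)"
        by (intro mult_right_mono B that) auto
    qed
    ultimately show "\<exists>r>0. \<exists>M. M summable_on UNIV \<and> cball z r \<subseteq> {s. Re s > 0} \<and>
       (\<forall>k\<in>UNIV. \<forall>w\<in>cball z r. norm (bes_coeff w k * of_real (pi * Y) ^ (2 * k)) \<le> M k)"
      using r by blast
  qed
  hence "(\<lambda>s. of_real pi powr (s - 1 / 2) * (\<Sum>\<^sub>\<infinity>k. bes_coeff s k * of_real (pi * Y) ^ (2 * k))) holomorphic_on {s. Re s > 0}"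
    by (auto intro!: holomorphic_intros)
  moreover have "(\<Sum>\<^sub>\<infinity>k. bes_coeff s k * of_real (pi * Y) ^ (2 * k)) = (\<Sum>k. bes_coeff s k * of_real (pi * Y) ^ (2 * k))"
    if "Re s > 0" for s
  proof -
    have "summable (\<lambda>k. norm (bes_coeff s k * of_real (pi * Y) ^ (2 * k)))"
    proof (rule summable_comparison_test')
      show "summable (\<lambda>k. cmod (rGamma (s + 1 / 2)) * ((2 * (pi * Y)\<^sup>2) ^ k / fact k))"
        by (intro summable_mult summable_exp_terms)
      show "norm (norm (bes_coeff s k * of_real (pi * Y) ^ (2 * k))) \<le>
          cmod (rGamma (s + 1 / 2)) * ((2 * (pi * Y)\<^sup>2) ^ k / fact k)" for k
        unfolding real_norm_def abs_norm_cancel by (rule norm_bes_term_le[OF that])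
    qed
    hence "(\<lambda>k. bes_coeff s k * of_real (pi * Y) ^ (2 * k)) summable_on UNIV"
      by (rule norm_summable_imp_summable_on)
    thus ?thesis using has_sum_infsum has_sum_imp_sums sums_unique by metis
  qed
  ultimately show ?thesis by (subst holomorphic_cong[OF refl]) (auto simp: bes_def)
qed

section \<open>The kernel at s = 1\<close>

lemma bes_coeff_1: "bes_coeff 1 k = 2 ^ (2 * k + 1) / (of_real (sqrt pi) * fact (2 * k + 1))"
proof -
  have nz: "of_nat k + 1 \<notin> (\<int>\<^sub>\<le>\<^sub>0 :: complex set)" "of_nat k + 1 + 1 / 2 \<notin> (\<int>\<^sub>\<le>\<^sub>0 :: complex set)"
    by (auto elim!: nonpos_Ints_cases simp: complex_eq_iff)
  have e: "exp ((1 - 2 * (of_nat k + 1)) * complex_of_real (ln 2)) = 1 / 2 ^ (2 * k + 1)"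
  proof -
    have "exp ((1 - 2 * (of_nat k + 1)) * complex_of_real (ln 2)) = complex_of_real (exp (- (real (2 * k + 1) * ln 2)))"
      by (simp add: exp_of_real[symmetric] algebra_simps)
    also have "exp (- (real (2 * k + 1) * ln 2)) = 1 / 2 ^ (2 * k + 1)"
      by (subst exp_minus, subst exp_of_nat_mult) (simp add: field_simps)
    finally show ?thesis by simp
  qed
  \<comment> \<open>Legendre duplication merges k! and Gamma(k + 3/2) into (2 k + 1)!, the
    denominators of the sinh series.\<close>
  have "Gamma (of_nat k + 1) * Gamma (of_nat k + 1 + 1 / 2) =
     exp ((1 - 2 * (of_nat k + 1)) * complex_of_real (ln 2)) * of_real (sqrt pi) * Gamma (2 * (of_nat k + 1))"
    by (rule Gamma_legendre_duplication[OF nz])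
  also note e
  also have "Gamma (of_nat k + 1 :: complex) = fact k"
    by (simp add: Gamma_fact add.commute)
  also have "Gamma (2 * (of_nat k + 1) :: complex) = fact (2 * k + 1)"
    using Gamma_fact[of "2 * k + 1", where 'a = complex] by (simp add: algebra_simps)
  finally have "inverse (fact k * Gamma (of_nat k + 1 + 1 / 2)) =
     inverse (1 / 2 ^ (2 * k + 1) * complex_of_real (sqrt pi) * fact (2 * k + 1))"
    by (simp only:)
  also have "\<dots> = 2 ^ (2 * k + 1) / (complex_of_real (sqrt pi) * fact (2 * k + 1))"
    by (simp add: divide_simps del: fact_Suc power_Suc)
  also have "inverse (fact k * Gamma (of_nat k + 1 + 1 / 2)) = bes_coeff 1 k"
    by (simp add: bes_coeff_def rGamma_inverse_Gamma add_ac divide_simps)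
  finally show ?thesis .
qed

lemma sinh_sums: "(\<lambda>k. (x::real) ^ (2 * k + 1) / fact (2 * k + 1)) sums sinh x"
proof -
  have "(\<lambda>n. (x ^ n /\<^sub>R fact n - (- x) ^ n /\<^sub>R fact n) / 2) sums ((exp x - exp (- x)) / 2)"
    by (intro sums_divide sums_diff exp_converges)
  also have "(\<lambda>n. (x ^ n /\<^sub>R fact n - (- x) ^ n /\<^sub>R fact n) / 2) = (\<lambda>n. if even n then 0 else x ^ n / fact n)"
    by (auto simp: fun_eq_iff field_simps)
  also have "(exp x - exp (- x)) / 2 = sinh x" by (simp add: sinh_def)
  finally have "(\<lambda>n. if even n then 0 else x ^ n / fact n) sums sinh x" .
  thus ?thesis
    using sums_mono_reindex[of "\<lambda>k. 2 * k + 1" "\<lambda>n. if even n then 0 else x ^ n / fact n" "sinh x"]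
    by (force simp: strict_mono_def elim!: oddE)
qed

text \<open>The Bessel function of order 1/2 is elementary. The two exponentials of sinh become the
  holomorphic and the antiholomorphic half of the expansion.\<close>

lemma bes_1:
  assumes "Y > 0"
  shows "of_real Y * bes 1 Y = of_real (sinh (2 * pi * Y) / pi)"
proof -
  have "(\<lambda>k. complex_of_real ((2 * pi * Y) ^ (2 * k + 1) / fact (2 * k + 1))) sums of_real (sinh (2 * pi * Y))"
    by (intro sums_of_real sinh_sums)
  hence "(\<lambda>k. complex_of_real ((2 * pi * Y) ^ (2 * k + 1) / fact (2 * k + 1)) / of_real (sqrt pi * pi * Y)) sums (of_real (sinh (2 * pi * Y)) / of_real (sqrt pi * pi * Y))"
    by (rule sums_divide)
  also have "(\<lambda>k. complex_of_real ((2 * pi * Y) ^ (2 * k + 1) / fact (2 * k + 1)) / of_real (sqrt pi * pi * Y)) =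
     (\<lambda>k. bes_coeff 1 k * of_real (pi * Y) ^ (2 * k))"
  proof
    fix k
    have nz: "fact (2 * k + 1) \<noteq> (0 :: real)" by simp
    have "(2 * pi * Y) ^ (2 * k + 1) / fact (2 * k + 1) / (sqrt pi * pi * Y) =
        2 ^ (2 * k + 1) / (sqrt pi * fact (2 * k + 1)) * (pi * Y) ^ (2 * k)"
      using assms nz
      by (simp add: power_mult_distrib divide_simps del: fact_Suc)
    hence "complex_of_real ((2 * pi * Y) ^ (2 * k + 1) / fact (2 * k + 1) / (sqrt pi * pi * Y)) =
        complex_of_real (2 ^ (2 * k + 1) / (sqrt pi * fact (2 * k + 1)) * (pi * Y) ^ (2 * k))"
      by (simp only:)
    thus "complex_of_real ((2 * pi * Y) ^ (2 * k + 1) / fact (2 * k + 1)) / of_real (sqrt pi * pi * Y) =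
        bes_coeff 1 k * of_real (pi * Y) ^ (2 * k)"
      unfolding bes_coeff_1 of_real_divide of_real_mult of_real_power of_real_fact by simp
  qed
  finally have "(\<Sum>k. bes_coeff 1 k * of_real (pi * Y) ^ (2 * k)) = of_real (sinh (2 * pi * Y)) / of_real (sqrt pi * pi * Y)"
    by (rule sums_unique[symmetric])
  moreover have "complex_of_real pi powr (1 - 1 / 2) = of_real (sqrt pi)"
    by (simp add: csqrt_of_real_nonneg flip: csqrt_conv_powr)
  ultimately show ?thesis using assms by (simp add: bes_def field_simps)
qed

lemma bes0_1: "bes0 1 = 2"
proof -
  have "complex_of_real pi powr (1 - 1 / 2) = of_real (sqrt pi)"
    by (simp add: csqrt_of_real_nonneg flip: csqrt_conv_powr)
  moreover have "rGamma (1 + 1 / 2 :: complex) = 2 / of_real (sqrt pi)"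
    using bes_coeff_1[of 0] by (simp add: bes_coeff_def)
  ultimately show ?thesis by (simp add: bes0_def)
qed

section \<open>Continuation of periodically weighted series\<close>

lemma norm_exp_diff_le: "cmod (exp u - exp v) \<le> exp (max (Re u) (Re v)) * cmod (u - v)"
proof (rule field_differentiable_bound[where S = "closed_segment v u" and f' = exp])
  show "cmod (exp z) \<le> exp (max (Re u) (Re v))" if z: "z \<in> closed_segment v u" for z
  proof -
    obtain t where t: "0 \<le> t" "t \<le> 1" "z = (1 - t) *\<^sub>R v + t *\<^sub>R u"
      using z unfolding closed_segment_def by auto
    have "Re z = (1 - t) * Re v + t * Re u" using t by simp
    also have "\<dots> \<le> (1 - t) * max (Re u) (Re v) + t * max (Re u) (Re v)"
      using t by (intro add_mono mult_left_mono) auto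
    finally show ?thesis by (simp add: algebra_simps)
  qed
qed (auto intro!: derivative_eq_intros)

lemma abs_ln_diff_le:
  assumes "0 < m" "m \<le> x" "m \<le> y"
  shows "\<bar>ln x - ln y\<bar> \<le> \<bar>x - y\<bar> / (m::real)"
proof -
  have *: "ln x - ln y \<le> \<bar>x - y\<bar> / m" if "m \<le> x" "m \<le> y" for x y
  proof -
    have "ln x - ln y \<le> (x - y) / y" using that assms ln_le_minus_one[of "x / y"] by (simp add: ln_div field_simps)
    also have "\<dots> \<le> \<bar>x - y\<bar> / y" using that assms by (intro divide_right_mono) auto
    also have "\<dots> \<le> \<bar>x - y\<bar> / m" using that assms by (intro divide_left_mono) auto
    finally show ?thesis .
  qed
  show ?thesis using *[of x y] *[of y x] assms by (auto simp: abs_minus_commute)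
qed

lemma norm_ee_minus_1_le: "cmod (ee t - 1) \<le> 2 * pi * \<bar>t\<bar>"
  using abs_sin_x_le_abs_x[of "pi * t"] by (simp add: norm_ee_minus_1 abs_mult)

text \<open>For a matrix \<open>\<gamma>\<close> of determinant \<open>Q\<close> with rows \<open>(Q x, y)\<close> and \<open>(Q c, Q w)\<close>, and \<open>a = n / Q\<close>,
  we have \<open>n \<gamma>\<tau> = n x / c - nU\<close> and \<open>nY = n Im \<gamma>\<tau> = - Im nU\<close>.\<close>

definition nY :: "real \<Rightarrow> complex \<Rightarrow> nat \<Rightarrow> int \<Rightarrow> real" where
  "nY a \<tau> c w = a * Im \<tau> / (cmod (of_nat c * \<tau> + of_int w))\<^sup>2"

definition nU :: "real \<Rightarrow> complex \<Rightarrow> nat \<Rightarrow> int \<Rightarrow> complex" where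
  "nU a \<tau> c w = of_real a / (of_nat c * (of_nat c * \<tau> + of_int w))"

definition nD :: "nat \<Rightarrow> int \<Rightarrow> real" where
  "nD c w = real c + real_of_int \<bar>w\<bar>"

text \<open>The maximum with 1 makes powers of \<open>nA\<close> increase with the exponent, so that
  one exponent R serves all s with Re s at most R.\<close>

definition nA :: "real \<Rightarrow> complex \<Rightarrow> real" where
  "nA a \<tau> = max 1 (a * Im \<tau> / (lattice_const \<tau>)\<^sup>2)"

lemma nD_ge:
  assumes "c \<ge> 1"
  shows "nD c w \<ge> real c" "nD c w \<ge> 1 + real_of_int \<bar>w\<bar>" "nD c w \<ge> 1"
  using assms by (auto simp: nD_def)

text \<open>The decay in c + |w| may be divided between c and w at will; the divisions used below
  keep the exponent of 1 + |w| above 1 and leave the rest to c.\<close>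

lemma nD_powr_le:
  assumes "c \<ge> 1" "p \<ge> 0" "q \<ge> 0"
  shows "nD c w powr - (p + q) \<le> real c powr - p * (1 + real_of_int \<bar>w\<bar>) powr - q"
proof -
  have "nD c w powr - (p + q) = nD c w powr - p * nD c w powr - q"
    by (simp flip: powr_add)
  also have "\<dots> \<le> real c powr - p * (1 + real_of_int \<bar>w\<bar>) powr - q"
    using nD_ge[OF assms(1), of w] assms by (intro mult_mono powr_mono2') auto
  finally show ?thesis .
qed

context
  fixes \<tau> :: complex and a :: real
  assumes \<tau>: "Im \<tau> > 0" and a: "a > 0"
begin

lemma lattice_bound':
  assumes "c \<ge> 1"
  shows "lattice_const \<tau> * nD c w \<le> cmod (of_nat c * \<tau> + of_int w)" "cmod (of_nat c * \<tau> + of_int w) > 0"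
proof -
  show *: "lattice_const \<tau> * nD c w \<le> cmod (of_nat c * \<tau> + of_int w)"
    using lattice_bound[OF \<tau>, of "real c" "real_of_int w"] by (simp add: nD_def)
  have "lattice_const \<tau> * nD c w > 0" using lattice_const_pos[OF \<tau>] nD_ge(3)[OF assms, of w] by simp
  thus "cmod (of_nat c * \<tau> + of_int w) > 0" using * by linarith
qed

lemma nA_ge: "nA a \<tau> \<ge> 1"
  by (simp add: nA_def)

lemma nY_pos: "c \<ge> 1 \<Longrightarrow> nY a \<tau> c w > 0"
  using lattice_bound'(2) \<tau> a by (simp add: nY_def)

lemma nY_le:
  assumes "c \<ge> 1"
  shows "nY a \<tau> c w \<le> nA a \<tau> / (nD c w)\<^sup>2"
proof -
  have "nY a \<tau> c w \<le> a * Im \<tau> / (lattice_const \<tau> * nD c w)\<^sup>2"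
    unfolding nY_def using a \<tau> lattice_bound'[OF assms, of w] lattice_const_pos[OF \<tau>] nD_ge(3)[OF assms, of w]
    by (intro divide_left_mono power_mono mult_pos_pos zero_less_power) (auto intro!: mult_nonneg_nonneg)
  also have "\<dots> = a * Im \<tau> / (lattice_const \<tau>)\<^sup>2 / (nD c w)\<^sup>2" by (simp add: power_mult_distrib)
  also have "\<dots> \<le> nA a \<tau> / (nD c w)\<^sup>2" by (intro divide_right_mono) (auto simp: nA_def)
  finally show ?thesis .
qed

lemma norm_nU_le:
  assumes "c \<ge> 1"
  shows "cmod (nU a \<tau> c w) \<le> a / lattice_const \<tau> / (real c * nD c w)"
proof -
  have "cmod (nU a \<tau> c w) = a / (real c * cmod (of_nat c * \<tau> + of_int w))"
    using a by (simp add: nU_def norm_divide norm_mult)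
  also have "\<dots> \<le> a / (real c * (lattice_const \<tau> * nD c w))"
    using a lattice_bound'[OF assms, of w] lattice_const_pos[OF \<tau>] nD_ge(3)[OF assms, of w] assms
    by (intro divide_left_mono mult_left_mono mult_pos_pos) auto
  finally show ?thesis by (simp add: mult_ac)
qed

lemma Im_nU:
  assumes "c \<ge> 1"
  shows "Im (nU a \<tau> c w) = - nY a \<tau> c w"
proof -
  define z where "z = of_nat c * \<tau> + of_int w"
  have z: "z \<noteq> 0" using lattice_bound'(2)[OF assms, of w] by (auto simp: z_def)
  have "nU a \<tau> c w = of_real a / (of_nat c * z)" by (simp add: nU_def z_def)
  also have "\<dots> = of_real (a / (real c * (cmod z)\<^sup>2)) * cnj z"
  proof -
    have "(complex_of_real (cmod z))\<^sup>2 = z * cnj z" by (metis complex_norm_square of_real_power)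
    thus ?thesis using z assms by (simp add: divide_simps)
  qed
  finally have "nU a \<tau> c w = of_real (a / (real c * (cmod z)\<^sup>2)) * cnj z" .
  hence "Im (nU a \<tau> c w) = a / (real c * (cmod z)\<^sup>2) * (- (real c * Im \<tau>))"
    by (simp add: z_def)
  thus ?thesis using assms by (simp add: nY_def z_def)
qed

lemma nY_powr_le:
  assumes "c \<ge> 1" "\<sigma> \<le> Re s" "Re s \<le> R" "0 \<le> \<sigma>"
  shows "cmod (of_real (nY a \<tau> c w) powr s) \<le> nA a \<tau> powr R * nD c w powr - (2 * \<sigma>)"
proof -
  have "cmod (of_real (nY a \<tau> c w) powr s) = nY a \<tau> c w powr Re s"
    using nY_pos[OF assms(1), of w] by (simp add: norm_powr_real_powr)
  also have "\<dots> \<le> (nA a \<tau> / (nD c w)\<^sup>2) powr Re s"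
    using nY_pos[OF assms(1), of w] nY_le[OF assms(1), of w] assms by (intro powr_mono2) auto
  also have "\<dots> = nA a \<tau> powr Re s * nD c w powr - (2 * Re s)"
    using nA_ge nD_ge(3)[OF assms(1), of w]
    by (simp add: powr_divide powr_powr powr_minus divide_simps flip: powr_numeral)
  also have "\<dots> \<le> nA a \<tau> powr R * nD c w powr - (2 * \<sigma>)"
    using nA_ge nD_ge(3)[OF assms(1), of w] assms by (intro mult_mono powr_mono) auto
  finally show ?thesis .
qed

text \<open>Writing Y^s = exp (s log Y), the logarithm changes by O(1 / D) when w moves by one. The
  difference is smaller than the terms, of order D^(-15/8), by one further power: 23/8 = 15/8 +
  1.\<close>

lemma nY_powr_diff_le:
  assumes "c \<ge> 1" "15 / 16 \<le> Re s" "cmod s \<le> R"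
  shows "cmod (of_real (nY a \<tau> c (w + 1)) powr s - of_real (nY a \<tau> c w) powr s) \<le>
    16 * R / lattice_const \<tau> * nA a \<tau> powr R * nD c w powr - (23 / 8)"
proof -
  define z where "z = of_nat c * \<tau> + of_int w"
  define \<delta> where "\<delta> = lattice_const \<tau>"
  define D where "D = nD c w"
  have D1: "D \<ge> 1" using nD_ge(3)[OF assms(1)] by (simp add: D_def)
  have \<delta>: "\<delta> > 0" using lattice_const_pos[OF \<tau>] by (simp add: \<delta>_def)
  have ReR: "Re s \<le> R" using assms(3) complex_Re_le_cmod[of s] by linarith
  \<comment> \<open>Both neighbours have to be measured by the D of w; since c is at least 1, one
    step in w cannot do worse than halve D.\<close>
  have D': "nD c (w + 1) \<ge> D / 2"
  proof -
    have "real c \<ge> 1" using assms(1) by simp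
    moreover have "\<bar>real_of_int w\<bar> \<le> \<bar>real_of_int w + 1\<bar> + 1" by linarith
    ultimately have "real c + \<bar>real_of_int w\<bar> \<le> 2 * (real c + \<bar>real_of_int w + 1\<bar>)"
      using abs_ge_zero[of "real_of_int w + 1"] by argo
    thus ?thesis by (simp add: D_def nD_def)
  qed
  have z: "\<delta> * D / 2 \<le> cmod z" "\<delta> * D / 2 \<le> cmod (z + 1)"
  proof -
    have "\<delta> * D / 2 \<le> \<delta> * D" using \<delta> D1 by simp
    also have "\<dots> \<le> cmod z" using lattice_bound'(1)[OF assms(1), of w] by (simp add: \<delta>_def D_def z_def)
    finally show "\<delta> * D / 2 \<le> cmod z" .
    have "\<delta> * D / 2 \<le> \<delta> * nD c (w + 1)" using \<delta> D' by simp
    also have "\<dots> \<le> cmod (z + 1)" using lattice_bound'(1)[OF assms(1), of "w + 1"]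
      by (simp add: \<delta>_def D_def z_def add_ac)
    finally show "\<delta> * D / 2 \<le> cmod (z + 1)" .
  qed
  have dpos: "\<delta> * D / 2 > 0" using \<delta> D1 by simp
  have Y: "nY a \<tau> c w = a * Im \<tau> / (cmod z)\<^sup>2" "nY a \<tau> c (w + 1) = a * Im \<tau> / (cmod (z + 1))\<^sup>2"
    by (simp_all add: nY_def z_def add_ac)
  have lnY: "ln (nY a \<tau> c w) = ln (a * Im \<tau>) - 2 * ln (cmod z)"
     "ln (nY a \<tau> c (w + 1)) = ln (a * Im \<tau>) - 2 * ln (cmod (z + 1))"
    using a \<tau> z dpos unfolding Y by (auto simp: ln_div ln_realpow ln_mult)
  have "\<bar>ln (cmod (z + 1)) - ln (cmod z)\<bar> \<le> \<bar>cmod (z + 1) - cmod z\<bar> / (\<delta> * D / 2)"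
    by (rule abs_ln_diff_le) (use z dpos in auto)
  also have "\<dots> \<le> 1 / (\<delta> * D / 2)"
    using norm_triangle_ineq3[of "z + 1" z] dpos by (intro divide_right_mono) auto
  finally have ln: "\<bar>ln (nY a \<tau> c (w + 1)) - ln (nY a \<tau> c w)\<bar> \<le> 4 / (\<delta> * D)"
    unfolding lnY by (simp add: field_simps)
  have powr: "of_real (nY a \<tau> c w) powr s = exp (s * of_real (ln (nY a \<tau> c w)))" for w
    using nY_pos[OF assms(1), of w] by (simp add: powr_def Ln_of_real)
  have b: "exp (Re (s * of_real (ln (nY a \<tau> c v)))) \<le> nA a \<tau> powr R * (4 * D powr - (15 / 8))"
    if v: "nD c v \<ge> D / 2" for v
  proof -
    have "exp (Re (s * of_real (ln (nY a \<tau> c v)))) = cmod (of_real (nY a \<tau> c v) powr s)"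
      unfolding powr by simp
    also have "\<dots> \<le> nA a \<tau> powr R * nD c v powr - (2 * (15 / 16))"
      using assms ReR by (intro nY_powr_le) auto
    also have "\<dots> \<le> nA a \<tau> powr R * (D / 2) powr - (15 / 8)"
      using v D1 nA_ge by (intro mult_left_mono) (auto intro!: powr_mono2')
    also have "(D / 2) powr - (15 / 8) = 2 powr (15 / 8) * D powr - (15 / 8)"
      using D1 by (simp add: powr_divide powr_minus divide_simps)
    also have "(2::real) powr (15 / 8) \<le> 2 powr 2" by (intro powr_mono) auto
    finally show ?thesis using nA_ge by (simp add: mult_left_mono mult_right_mono)
  qed
  have "cmod (of_real (nY a \<tau> c (w + 1)) powr s - of_real (nY a \<tau> c w) powr s) \<le>
     exp (max (Re (s * of_real (ln (nY a \<tau> c (w + 1))))) (Re (s * of_real (ln (nY a \<tau> c w))))) *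
     cmod (s * of_real (ln (nY a \<tau> c (w + 1))) - s * of_real (ln (nY a \<tau> c w)))"
    unfolding powr by (rule norm_exp_diff_le)
  also have "\<dots> \<le> (nA a \<tau> powr R * (4 * D powr - (15 / 8))) * (R * (4 / (\<delta> * D)))"
  proof (rule mult_mono)
    show "exp (max (Re (s * of_real (ln (nY a \<tau> c (w + 1))))) (Re (s * of_real (ln (nY a \<tau> c w))))) \<le>
       nA a \<tau> powr R * (4 * D powr - (15 / 8))"
      using b[of w] b[OF D'] D1 by (simp add: max_def D_def)
    have "cmod (s * of_real (ln (nY a \<tau> c (w + 1))) - s * of_real (ln (nY a \<tau> c w))) =
       cmod s * \<bar>ln (nY a \<tau> c (w + 1)) - ln (nY a \<tau> c w)\<bar>"
      by (metis norm_mult norm_of_real of_real_diff right_diff_distrib)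
    also have "\<dots> \<le> R * (4 / (\<delta> * D))"
      using assms ln order.trans[OF norm_ge_zero assms(3)] by (intro mult_mono) auto
    finally show "cmod (s * of_real (ln (nY a \<tau> c (w + 1))) - s * of_real (ln (nY a \<tau> c w))) \<le> R * (4 / (\<delta> * D))" .
  qed auto
  also have "\<dots> = 16 * R / \<delta> * nA a \<tau> powr R * (D powr - (15 / 8) * D powr - 1)"
    using D1 \<delta> by (simp add: powr_minus field_simps)
  also have "D powr - (15 / 8) * D powr - 1 = D powr - (23 / 8)"
    by (subst powr_add [symmetric]) simp
  finally show ?thesis by (simp add: \<delta>_def D_def)
qed

end

text \<open>\<open>\<psi>\<close> carries the arithmetic: the phase e(-n x / c), and the value 0 at
  pairs that are not lower rows. This allows summing over all of \<open>cw_index\<close> without a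
  coprimality condition, as completion requires.\<close>

definition nterm :: "(nat \<Rightarrow> int \<Rightarrow> complex) \<Rightarrow> real \<Rightarrow> complex \<Rightarrow> complex \<Rightarrow> nat \<times> int \<Rightarrow> complex" where
  "nterm \<psi> a \<tau> s = (\<lambda>(c, w). \<psi> c w * ee (Re (nU a \<tau> c w)) *
     (of_real (sqrt (nY a \<tau> c w)) * bessel_I (s - 1 / 2) (2 * pi * nY a \<tau> c w)))"

text \<open>The phase and the Bessel function deviate from their values at \<open>nU = 0\<close> by \<open>O(nU)\<close>, which makes
  \<open>nerr\<close> absolutely summable beyond \<open>Re s = 1\<close>; \<open>nmain\<close> is what remains.\<close>

definition nerr :: "(nat \<Rightarrow> int \<Rightarrow> complex) \<Rightarrow> real \<Rightarrow> complex \<Rightarrow> nat \<times> int \<Rightarrow> complex \<Rightarrow> complex" where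
  "nerr \<psi> a \<tau> = (\<lambda>(c, w) s. \<psi> c w *
     (ee (Re (nU a \<tau> c w)) * bes s (nY a \<tau> c w) - bes0 s) * of_real (nY a \<tau> c w) powr s)"

definition nmain :: "(nat \<Rightarrow> int \<Rightarrow> complex) \<Rightarrow> real \<Rightarrow> complex \<Rightarrow> nat \<Rightarrow> complex \<Rightarrow> complex" where
  "nmain \<psi> a \<tau> c s = (\<Sum>\<^sub>\<infinity>w. \<psi> c w * of_real (nY a \<tau> c w) powr s)"

text \<open>The main part is deliberately an iterated sum: for Re s at most 1 the double sum over
  (c, w) need not converge absolutely, while each sum over w still does, and the sum over c
  converges by cancellation inside \<open>nmain\<close>.\<close>

definition ncont :: "(nat \<Rightarrow> int \<Rightarrow> complex) \<Rightarrow> real \<Rightarrow> complex \<Rightarrow> complex \<Rightarrow> complex" where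
  "ncont \<psi> a \<tau> s = (\<Sum>\<^sub>\<infinity>x\<in>cw_index. nerr \<psi> a \<tau> x s) + bes0 s * (\<Sum>\<^sub>\<infinity>c\<in>{1..}. nmain \<psi> a \<tau> c s)"

text \<open>For \<open>Re s > 15/16\<close> completion bounds \<open>nmain\<close> by \<open>\<kappa> c * c powr (- 15/8)\<close> times a logarithm, which the
  exponent \<open>29/16 < 15/8\<close> absorbs.\<close>

locale niebur_weight =
  fixes \<psi> :: "nat \<Rightarrow> int \<Rightarrow> complex" and \<kappa> :: "nat \<Rightarrow> real" and a :: real
  assumes a_pos: "a > 0"
    and periodic: "\<And>c w. c \<ge> 1 \<Longrightarrow> \<psi> c (w + int c) = \<psi> c w"
    and norm_le_1: "\<And>c w. cmod (\<psi> c w) \<le> 1"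
    and cancel: "\<And>c m. c \<ge> 1 \<Longrightarrow> cmod (\<Sum>v\<in>{0..<int c}. \<psi> c v * ec c (m * v)) \<le> \<kappa> c"
    and summable_\<kappa>: "summable (\<lambda>c. \<kappa> c * real c powr - (29 / 16))"
begin

lemma \<kappa>_nonneg: "c \<ge> 1 \<Longrightarrow> \<kappa> c \<ge> 0"
  using order.trans[OF norm_ge_zero cancel] .

lemma summable_on_\<kappa>: "(\<lambda>c. \<kappa> c * real c powr - (29 / 16)) summable_on {1..}"
proof -
  have "summable (\<lambda>c. \<kappa> (Suc c) * real (Suc c) powr - (29 / 16))"
    using summable_\<kappa> by (subst summable_Suc_iff)
  hence "(\<lambda>c. \<kappa> (Suc c) * real (Suc c) powr - (29 / 16)) summable_on UNIV"
    by (intro summable_nonneg_imp_summable_on) (auto simp: \<kappa>_nonneg)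
  hence "(\<lambda>c. \<kappa> c * real c powr - (29 / 16)) summable_on range Suc"
    by (subst summable_on_reindex) (auto simp: o_def)
  moreover have "range Suc = {1..}" by (auto simp: image_iff Suc_le_eq gr0_conv_Suc)
  ultimately show ?thesis by simp
qed

context
  fixes \<tau> :: complex
  assumes \<tau>: "Im \<tau> > 0"
begin

lemma norm_main_term_le:
  assumes "c \<ge> 1" "15 / 16 \<le> Re s" "cmod s \<le> R"
  shows "cmod (of_real (nY a \<tau> c w) powr s) \<le> nA a \<tau> powr R * real c powr - (27 / 32) * (1 + real_of_int \<bar>w\<bar>) powr - (33 / 32)"
proof -
  have "Re s \<le> R" using assms(3) complex_Re_le_cmod[of s] by linarith
  hence "cmod (of_real (nY a \<tau> c w) powr s) \<le> nA a \<tau> powr R * nD c w powr - (2 * (15 / 16))"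
    using assms by (intro nY_powr_le \<tau> a_pos) auto
  also have "nD c w powr - (2 * (15 / 16)) \<le> real c powr - (27 / 32) * (1 + real_of_int \<bar>w\<bar>) powr - (33 / 32)"
    using nD_powr_le[OF assms(1), of "27 / 32" "33 / 32" w] by simp
  finally show ?thesis by (simp add: mult_left_mono mult.assoc)
qed

text \<open>Exponents: the terms decay like D^(-60/32) and their differences like D^(-92/32). Giving
  33/32 to w leaves H of order c^(-27/32) and V of order c^(-59/32), so H / c and V balance. The
  harmonic number, at most 33 c^(1/32), then turns 59/32 into 58/32 = 29/16.\<close>

lemma norm_main_le:
  fixes R :: real
  shows "\<exists>B. \<forall>c s. c \<ge> 1 \<longrightarrow> 15 / 16 \<le> Re s \<longrightarrow> cmod s \<le> R \<longrightarrow>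
    cmod (nmain \<psi> a \<tau> c s) \<le> B * (\<kappa> c * real c powr - (29 / 16))"
proof -
  define Z where "Z = (\<Sum>\<^sub>\<infinity>w::int. (1 + real_of_int \<bar>w\<bar>) powr - (33 / 32))"
  have Z: "((\<lambda>w::int. (1 + real_of_int \<bar>w\<bar>) powr - (33 / 32)) has_sum Z) UNIV"
    unfolding Z_def by (intro has_sum_infsum summable_on_int_powr) auto
  have Z0: "Z \<ge> 0" using Z by (auto intro: has_sum_nonneg)
  define K1 where "K1 = nA a \<tau> powr R"
  define K2 where "K2 = 16 * R / lattice_const \<tau> * nA a \<tau> powr R"
  define B where "B = K1 * Z + 2 * 33 * K2 * Z"
  have "cmod (nmain \<psi> a \<tau> c s) \<le> B * (\<kappa> c * real c powr - (29 / 16))"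
    if c: "c \<ge> 1" and s: "15 / 16 \<le> Re s" "cmod s \<le> R" for c s
  proof -
    have R: "R \<ge> 0" using s order.trans[OF norm_ge_zero s(2)] by simp
    have K: "K1 \<ge> 0" "K2 \<ge> 0" using lattice_const_pos[OF \<tau>] R by (auto simp: K1_def K2_def)
    define h where "h = (\<lambda>w. complex_of_real (nY a \<tau> c w) powr s)"
    have M1: "((\<lambda>w. K1 * real c powr - (27 / 32) * (1 + real_of_int \<bar>w\<bar>) powr - (33 / 32)) has_sum (K1 * real c powr - (27 / 32) * Z)) UNIV"
      by (intro has_sum_cmult_right Z)
    have h1: "cmod (h w) \<le> K1 * real c powr - (27 / 32) * (1 + real_of_int \<bar>w\<bar>) powr - (33 / 32)" for w
      unfolding h_def K1_def by (rule norm_main_term_le[OF c s])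
    have M2: "((\<lambda>w. K2 * real c powr - (59 / 32) * (1 + real_of_int \<bar>w\<bar>) powr - (33 / 32)) has_sum (K2 * real c powr - (59 / 32) * Z)) UNIV"
      by (intro has_sum_cmult_right Z)
    have h2: "cmod (h (w + 1) - h w) \<le> K2 * real c powr - (59 / 32) * (1 + real_of_int \<bar>w\<bar>) powr - (33 / 32)" for w
    proof -
      have "cmod (h (w + 1) - h w) \<le> K2 * nD c w powr - (23 / 8)"
        unfolding h_def K2_def by (rule nY_powr_diff_le[OF \<tau> a_pos c s])
      also have "nD c w powr - (23 / 8) \<le> real c powr - (59 / 32) * (1 + real_of_int \<bar>w\<bar>) powr - (33 / 32)"
        using nD_powr_le[OF c, of "59 / 32" "33 / 32" w] by simp
      finally show ?thesis using K by (simp add: mult_left_mono mult.assoc)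
    qed
    obtain H where H: "((\<lambda>w. cmod (h w)) has_sum H) UNIV"
      using Infinite_Sum.abs_summable_on_comparison_test'[OF has_sum_imp_summable[OF M1] h1] summable_on_def by blast
    obtain V where V: "((\<lambda>w. cmod (h (w + 1) - h w)) has_sum V) UNIV"
      using Infinite_Sum.abs_summable_on_comparison_test'[OF has_sum_imp_summable[OF M2] h2] summable_on_def by blast
    have H': "H \<le> K1 * real c powr - (27 / 32) * Z" by (rule has_sum_mono[OF H M1 h1])
    have V': "V \<le> K2 * real c powr - (59 / 32) * Z" by (rule has_sum_mono[OF V M2 h2])
    have "cmod (nmain \<psi> a \<tau> c s) \<le> \<kappa> c * (H / real c + 2 * harm c * V)"
    proof -
      have "cmod (\<Sum>\<^sub>\<infinity>w. \<psi> c w * h w) \<le> \<kappa> c * (H / real c + 2 * harm c * V)"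
        by (rule completion_bound[OF _ _ cancel H V]) (use c periodic in auto)
      thus ?thesis by (simp add: nmain_def h_def)
    qed
    also have "\<dots> \<le> \<kappa> c * (K1 * Z * real c powr - (29 / 16) + 2 * 33 * (K2 * Z * real c powr - (29 / 16)))"
    proof (intro mult_left_mono add_mono \<kappa>_nonneg c)
      have "H / real c \<le> K1 * Z * (real c powr - (27 / 32) * real c powr - 1)"
      proof -
        have "real c powr - 1 = 1 / real c" using c by (simp add: powr_minus_divide)
        thus ?thesis using divide_right_mono[OF H', of "real c"] by (simp only:) (simp add: mult_ac)
      qed
      also have "real c powr - (27 / 32) * real c powr - 1 = real c powr - (59 / 32)"
        by (subst powr_add [symmetric]) simp
      also have "\<dots> \<le> real c powr - (29 / 16)" using c by (intro powr_mono) auto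
      finally show "H / real c \<le> K1 * Z * real c powr - (29 / 16)"
        using K Z0 by (simp add: mult_left_mono)
    next
      have "2 * harm c * V \<le> 2 * ((1 + 1 / (1 / 32)) * real c powr (1 / 32)) * (K2 * real c powr - (59 / 32) * Z)"
        using V' c K Z0 has_sum_nonneg[OF V] harm_powr_bound[of c "1 / 32"] harm_nonneg[of c, where 'a = real]
        by (intro mult_mono) auto
      also have "\<dots> = 2 * 33 * (K2 * Z * (real c powr (1 / 32) * real c powr - (59 / 32)))" by simp
      also have "real c powr (1 / 32) * real c powr - (59 / 32) = real c powr - (29 / 16)"
        by (subst powr_add [symmetric]) simp
      finally show "2 * harm c * V \<le> 2 * 33 * (K2 * Z * real c powr - (29 / 16))" .
    qed
    also have "\<dots> = B * (\<kappa> c * real c powr - (29 / 16))" by (simp add: B_def algebra_simps)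
    finally show ?thesis .
  qed
  thus ?thesis by blast
qed

text \<open>The phase error is O(|U|) = O(1 / (c D)); the Bessel error is O(Y^2) = O(D^(-4)) and is
  weakened to the same size. With |Y^s| = O(D^(-15/8)) this gives c^(-1) D^(-23/8), and 23/8 = 7/8 +
  2 is divided between c and w.\<close>

lemma norm_err_le:
  fixes R :: real
  shows "\<exists>B. \<forall>c w s. c \<ge> 1 \<longrightarrow> 15 / 16 \<le> Re s \<longrightarrow> cmod s \<le> R \<longrightarrow>
    cmod (nerr \<psi> a \<tau> (c, w) s) \<le> B * (real c powr - (15 / 8) * (1 + real_of_int \<bar>w\<bar>) powr - 2)"
proof -
  have "continuous_on (cball 0 R) bes0"
    using bes0_holomorphic holomorphic_on_imp_continuous_on continuous_on_subset by blast
  then obtain B0 where B0: "\<And>s. s \<in> cball 0 R \<Longrightarrow> cmod (bes0 s) \<le> B0"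
    using continuous_on_compact_norm_bound[OF _ compact_cball] by blast
  define A where "A = nA a \<tau>"
  define K where "K = 2 * pi\<^sup>2 * A\<^sup>2 * exp (2 * pi\<^sup>2 * A\<^sup>2) + 2 * pi * (a / lattice_const \<tau>)"
  have K: "K \<ge> 0" using a_pos lattice_const_pos[OF \<tau>] by (auto simp: K_def intro!: add_nonneg_nonneg)
  have A: "A \<ge> 1" by (simp add: A_def nA_def)
  define B where "B = \<bar>B0\<bar> * K * A powr R"
  have "cmod (nerr \<psi> a \<tau> (c, w) s) \<le> B * (real c powr - (15 / 8) * (1 + real_of_int \<bar>w\<bar>) powr - 2)"
    if c: "c \<ge> 1" and s: "15 / 16 \<le> Re s" "cmod s \<le> R" for c w s
  proof -
    define D where "D = nD c w"
    define Y where "Y = nY a \<tau> c w"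
    define \<rho> where "\<rho> = Re (nU a \<tau> c w)"
    have D: "D \<ge> real c" "D \<ge> 1" using nD_ge[OF c] by (auto simp: D_def)
    have Y: "Y > 0" "Y \<le> A / D\<^sup>2" using nY_pos[OF \<tau> a_pos c] nY_le[OF \<tau> a_pos c] by (auto simp: Y_def A_def D_def)
    have c0: "real c > 0" using c by simp
    have Y2: "Y\<^sup>2 \<le> A\<^sup>2 / (real c * D)" "Y\<^sup>2 \<le> A\<^sup>2"
    proof -
      have "Y\<^sup>2 \<le> (A / D\<^sup>2)\<^sup>2" using Y by (intro power_mono) auto
      also have "\<dots> = A\<^sup>2 / (D\<^sup>2 * D\<^sup>2)" by (simp add: power_divide power2_eq_square)
      finally have *: "Y\<^sup>2 \<le> A\<^sup>2 / (D\<^sup>2 * D\<^sup>2)" .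
      have 1: "1 \<le> D\<^sup>2" using D by simp
      have "real c * D \<le> D * D" using D by (intro mult_right_mono) auto
      also have "\<dots> = 1 * D\<^sup>2" by (simp add: power2_eq_square)
      also have "\<dots> \<le> D\<^sup>2 * D\<^sup>2" using 1 by (intro mult_right_mono) auto
      finally have 2: "real c * D \<le> D\<^sup>2 * D\<^sup>2" .
      have "A\<^sup>2 / (D\<^sup>2 * D\<^sup>2) \<le> A\<^sup>2 / (real c * D)"
        using 2 c0 D by (intro divide_left_mono) auto
      thus "Y\<^sup>2 \<le> A\<^sup>2 / (real c * D)" using * by linarith
      have "1 * 1 \<le> D\<^sup>2 * D\<^sup>2" using 1 by (intro mult_mono) auto
      hence "A\<^sup>2 / (D\<^sup>2 * D\<^sup>2) \<le> A\<^sup>2 / 1" by (intro divide_left_mono) auto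
      thus "Y\<^sup>2 \<le> A\<^sup>2" using * by simp
    qed
    have bs: "cmod (bes0 s) \<le> \<bar>B0\<bar>" using B0[of s] s by (simp add: dist_norm)
    have "cmod (bes s Y - bes0 s) \<le> cmod (bes0 s) * (exp (2 * (pi * Y)\<^sup>2) - 1)"
      by (rule norm_bes_diff_le) (use s in auto)
    also have "\<dots> \<le> \<bar>B0\<bar> * (2 * pi\<^sup>2 * A\<^sup>2 * exp (2 * pi\<^sup>2 * A\<^sup>2) / (real c * D))"
    proof (intro mult_mono bs)
      have "exp (2 * (pi * Y)\<^sup>2) - 1 \<le> (2 * (pi * Y)\<^sup>2) * exp (2 * (pi * Y)\<^sup>2)"
        by (rule exp_minus_1_le) auto
      also have "\<dots> \<le> (2 * pi\<^sup>2 * (A\<^sup>2 / (real c * D))) * exp (2 * pi\<^sup>2 * A\<^sup>2)"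
        unfolding power_mult_distrib mult.assoc[symmetric]
      proof (rule mult_mono)
        show "2 * pi\<^sup>2 * Y\<^sup>2 \<le> 2 * pi\<^sup>2 * (A\<^sup>2 / (real c * D))" by (rule mult_left_mono[OF Y2(1)]) auto
        have "2 * pi\<^sup>2 * Y\<^sup>2 \<le> 2 * pi\<^sup>2 * A\<^sup>2" by (rule mult_left_mono[OF Y2(2)]) auto
        thus "exp (2 * pi\<^sup>2 * Y\<^sup>2) \<le> exp (2 * pi\<^sup>2 * A\<^sup>2)" by simp
      qed (use c0 D in auto)
      finally show "exp (2 * (pi * Y)\<^sup>2) - 1 \<le> 2 * pi\<^sup>2 * A\<^sup>2 * exp (2 * pi\<^sup>2 * A\<^sup>2) / (real c * D)" by simp
    qed auto
    finally have 1: "cmod (bes s Y - bes0 s) \<le> \<bar>B0\<bar> * (2 * pi\<^sup>2 * A\<^sup>2 * exp (2 * pi\<^sup>2 * A\<^sup>2) / (real c * D))" .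
    have "cmod (ee \<rho> - 1) \<le> 2 * pi * \<bar>\<rho>\<bar>" by (rule norm_ee_minus_1_le)
    also have "\<dots> \<le> 2 * pi * (a / lattice_const \<tau> / (real c * D))"
      using abs_Re_le_cmod[of "nU a \<tau> c w"] norm_nU_le[OF \<tau> a_pos c, of w]
      unfolding \<rho>_def D_def by (intro mult_left_mono) auto
    finally have 2: "cmod (ee \<rho> - 1) \<le> 2 * pi * (a / lattice_const \<tau> / (real c * D))" .
    have "cmod (ee \<rho> * bes s Y - bes0 s) = cmod (ee \<rho> * (bes s Y - bes0 s) + bes0 s * (ee \<rho> - 1))"
      by (simp add: algebra_simps)
    also have "\<dots> \<le> cmod (bes s Y - bes0 s) + cmod (bes0 s) * cmod (ee \<rho> - 1)"
      by (rule order.trans[OF norm_triangle_ineq]) (simp add: norm_mult)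
    also have "\<dots> \<le> \<bar>B0\<bar> * (2 * pi\<^sup>2 * A\<^sup>2 * exp (2 * pi\<^sup>2 * A\<^sup>2) / (real c * D)) +
        \<bar>B0\<bar> * (2 * pi * (a / lattice_const \<tau> / (real c * D)))"
      by (intro add_mono 1 mult_mono 2 bs) auto
    also have "\<dots> = \<bar>B0\<bar> * K / (real c * D)"
      by (simp add: K_def add_divide_distrib ring_distribs)
    finally have 3: "cmod (ee \<rho> * bes s Y - bes0 s) \<le> \<bar>B0\<bar> * K / (real c * D)" .
    have "Re s \<le> R" using s(2) complex_Re_le_cmod[of s] by linarith
    hence 4: "cmod (of_real Y powr s) \<le> A powr R * D powr - (15 / 8)"
      using nY_powr_le[OF \<tau> a_pos c, of "15 / 16" s R w] s by (simp add: Y_def A_def D_def)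
    have "cmod (nerr \<psi> a \<tau> (c, w) s) = cmod (\<psi> c w) * cmod (ee \<rho> * bes s Y - bes0 s) * cmod (of_real Y powr s)"
      by (simp add: nerr_def Y_def \<rho>_def norm_mult)
    also have "\<dots> \<le> 1 * (\<bar>B0\<bar> * K / (real c * D)) * (A powr R * D powr - (15 / 8))"
      using K c0 D by (intro mult_mono norm_le_1 3 4) auto
    also have "\<dots> = B * (D powr - (23 / 8) * real c powr - 1)"
    proof -
      have "D powr - (23 / 8) = D powr (- 1 + - (15 / 8))" by simp
      also have "\<dots> = D powr - 1 * D powr - (15 / 8)" by (rule powr_add)
      finally show ?thesis using D c0 by (simp add: B_def powr_minus field_simps)
    qed
    also have "\<dots> \<le> B * ((real c powr - (7 / 8) * (1 + real_of_int \<bar>w\<bar>) powr - 2) * real c powr - 1)"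
      using nD_powr_le[OF c, of "7 / 8" 2 w] K unfolding D_def B_def
      by (intro mult_left_mono mult_right_mono) (auto intro!: mult_nonneg_nonneg)
    also have "\<dots> = B * ((real c powr - (7 / 8) * real c powr - 1) * (1 + real_of_int \<bar>w\<bar>) powr - 2)"
      by simp
    also have "real c powr - (7 / 8) * real c powr - 1 = real c powr - (15 / 8)"
      by (subst powr_add [symmetric]) simp
    finally show ?thesis .
  qed
  thus ?thesis by blast
qed

lemma ncont_holomorphic: "ncont \<psi> a \<tau> holomorphic_on {s. Re s > 15 / 16}"
proof -
  have op: "open {s. Re s > 15 / 16}" by (rule open_halfspace_Re_gt)
  have ball: "\<exists>r>0. cball z r \<subseteq> {s. Re s > 15 / 16} \<and> (\<forall>s\<in>cball z r. cmod s \<le> cmod z + r)"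
    if "z \<in> {s. Re s > 15 / 16}" for z
  proof -
    have "cmod s \<le> cmod z + r" if "s \<in> cball z r" for s r
      using that norm_triangle_ineq2[of s z] by (simp add: dist_norm norm_minus_commute)
    thus ?thesis using open_contains_cball[THEN iffD1, OF op] that by blast
  qed
  have Ypos: "nY a \<tau> c w > 0" if "c \<ge> 1" for c w using nY_pos[OF \<tau> a_pos that] .
  have hol_powr: "(\<lambda>s. of_real (nY a \<tau> c w) powr s) holomorphic_on S" if "c \<ge> 1" for c w S
    using Ypos[OF that, of w] by (auto intro!: holomorphic_intros)
  have 1: "(\<lambda>s. \<Sum>\<^sub>\<infinity>x\<in>cw_index. nerr \<psi> a \<tau> x s) holomorphic_on {s. Re s > 15 / 16}"
  proof (rule holomorphic_on_infsum[OF op])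
    fix x :: "nat \<times> int" assume "x \<in> cw_index"
    then obtain c w where x: "x = (c, w)" "c \<ge> 1" by (auto simp: cw_index_def)
    have "(\<lambda>s. bes s (nY a \<tau> c w)) holomorphic_on {s. Re s > 15 / 16}"
      by (rule holomorphic_on_subset[OF bes_holomorphic]) auto
    thus "nerr \<psi> a \<tau> x holomorphic_on {s. Re s > 15 / 16}"
      unfolding x nerr_def prod.case
      by (intro holomorphic_intros hol_powr x holomorphic_on_subset[OF bes0_holomorphic]) auto
  next
    fix z assume "z \<in> {s. Re s > 15 / 16}"
    from ball[OF this] obtain r where r: "r > 0" "cball z r \<subseteq> {s. Re s > 15 / 16}" "\<forall>s\<in>cball z r. cmod s \<le> cmod z + r"
      by blast
    obtain B where B: "\<And>c w s. c \<ge> 1 \<Longrightarrow> 15 / 16 \<le> Re s \<Longrightarrow> cmod s \<le> cmod z + r \<Longrightarrow>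
       cmod (nerr \<psi> a \<tau> (c, w) s) \<le> B * (real c powr - (15 / 8) * (1 + real_of_int \<bar>w\<bar>) powr - 2)"
      using norm_err_le[of "cmod z + r"] by auto
    have "(\<lambda>x. B * (\<lambda>(c, w). real c powr - (15 / 8) * (1 + real_of_int \<bar>w\<bar>) powr - 2) x) summable_on cw_index"
      by (intro summable_on_cmult_right summable_on_cw_index) auto
    moreover have "\<forall>x\<in>cw_index. \<forall>w\<in>cball z r. cmod (nerr \<psi> a \<tau> x w) \<le>
        B * (\<lambda>(c, w). real c powr - (15 / 8) * (1 + real_of_int \<bar>w\<bar>) powr - 2) x"
      using r B by (auto simp: cw_index_def less_imp_le subset_iff simp del: mem_cball)
    ultimately show "\<exists>r>0. \<exists>M. M summable_on cw_index \<and> cball z r \<subseteq> {s. Re s > 15 / 16} \<and>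
       (\<forall>x\<in>cw_index. \<forall>w\<in>cball z r. cmod (nerr \<psi> a \<tau> x w) \<le> M x)"
      using r by blast
  qed
  have 2: "nmain \<psi> a \<tau> c holomorphic_on {s. Re s > 15 / 16}" if c: "c \<ge> 1" for c
    unfolding nmain_def
  proof (rule holomorphic_on_infsum[OF op])
    show "(\<lambda>s. \<psi> c w * of_real (nY a \<tau> c w) powr s) holomorphic_on {s. Re s > 15 / 16}" for w
      by (intro holomorphic_intros hol_powr c)
  next
    fix z assume "z \<in> {s. Re s > 15 / 16}"
    from ball[OF this] obtain r where r: "r > 0" "cball z r \<subseteq> {s. Re s > 15 / 16}" "\<forall>s\<in>cball z r. cmod s \<le> cmod z + r"
      by blast
    define M where "M = (\<lambda>w::int. nA a \<tau> powr (cmod z + r) * real c powr - (27 / 32) * (1 + real_of_int \<bar>w\<bar>) powr - (33 / 32))"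
    have "M summable_on UNIV" unfolding M_def
      by (intro summable_on_cmult_right summable_on_int_powr) auto
    moreover have "cmod (\<psi> c w * of_real (nY a \<tau> c w) powr s) \<le> M w" if "s \<in> cball z r" for s w
    proof -
      have "cmod (\<psi> c w * of_real (nY a \<tau> c w) powr s) \<le> 1 * cmod (of_real (nY a \<tau> c w) powr s)"
        unfolding norm_mult by (intro mult_right_mono norm_le_1) auto
      also have "\<dots> \<le> M w" unfolding M_def mult_1_left
        by (rule norm_main_term_le[OF c]) (use r that in \<open>auto simp: less_imp_le subset_iff simp del: mem_cball\<close>)
      finally show ?thesis .
    qed
    ultimately show "\<exists>r>0. \<exists>M. M summable_on UNIV \<and> cball z r \<subseteq> {s. Re s > 15 / 16} \<and>
       (\<forall>w\<in>UNIV. \<forall>s\<in>cball z r. cmod (\<psi> c w * of_real (nY a \<tau> c w) powr s) \<le> M w)"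
      using r by blast
  qed
  have 3: "(\<lambda>s. \<Sum>\<^sub>\<infinity>c\<in>{1..}. nmain \<psi> a \<tau> c s) holomorphic_on {s. Re s > 15 / 16}"
  proof (rule holomorphic_on_infsum[OF op])
    show "nmain \<psi> a \<tau> c holomorphic_on {s. Re s > 15 / 16}" if "c \<in> {1..}" for c using 2 that by auto
  next
    fix z assume "z \<in> {s. Re s > 15 / 16}"
    from ball[OF this] obtain r where r: "r > 0" "cball z r \<subseteq> {s. Re s > 15 / 16}" "\<forall>s\<in>cball z r. cmod s \<le> cmod z + r"
      by blast
    obtain B where B: "\<And>c s. c \<ge> 1 \<Longrightarrow> 15 / 16 \<le> Re s \<Longrightarrow> cmod s \<le> cmod z + r \<Longrightarrow>
       cmod (nmain \<psi> a \<tau> c s) \<le> B * (\<kappa> c * real c powr - (29 / 16))"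
      using norm_main_le[of "cmod z + r"] by auto
    have "(\<lambda>c. B * (\<kappa> c * real c powr - (29 / 16))) summable_on {1..}"
      by (intro summable_on_cmult_right summable_on_\<kappa>)
    moreover have "\<forall>c\<in>{1..}. \<forall>w\<in>cball z r. cmod (nmain \<psi> a \<tau> c w) \<le> B * (\<kappa> c * real c powr - (29 / 16))"
      using r B by (auto simp: less_imp_le subset_iff simp del: mem_cball)
    ultimately show "\<exists>r>0. \<exists>M. M summable_on {1..} \<and> cball z r \<subseteq> {s. Re s > 15 / 16} \<and>
       (\<forall>c\<in>{1..}. \<forall>w\<in>cball z r. cmod (nmain \<psi> a \<tau> c w) \<le> M c)"
      using r by blast
  qed
  show ?thesis unfolding ncont_def
    by (intro holomorphic_intros 1 3 holomorphic_on_subset[OF bes0_holomorphic]) auto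
qed

lemma summable_on_nerr:
  assumes "Re s \<ge> 15 / 16"
  shows "(\<lambda>x. nerr \<psi> a \<tau> x s) summable_on cw_index"
proof -
  obtain B where B: "\<And>c w. c \<ge> 1 \<Longrightarrow>
     cmod (nerr \<psi> a \<tau> (c, w) s) \<le> B * (real c powr - (15 / 8) * (1 + real_of_int \<bar>w\<bar>) powr - 2)"
    using norm_err_le[of "cmod s"] assms by (metis order.refl)
  have "(\<lambda>x. B * (\<lambda>(c, w). real c powr - (15 / 8) * (1 + real_of_int \<bar>w\<bar>) powr - 2) x) summable_on cw_index"
    by (intro summable_on_cmult_right summable_on_cw_index) auto
  hence "(\<lambda>x. norm (nerr \<psi> a \<tau> x s)) summable_on cw_index"
    by (rule Infinite_Sum.abs_summable_on_comparison_test') (use B in \<open>auto simp: cw_index_def\<close>)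
  thus ?thesis by (rule abs_summable_summable)
qed

lemma summable_on_nmain:
  assumes "Re s \<ge> 15 / 16"
  shows "(\<lambda>c. nmain \<psi> a \<tau> c s) summable_on {1..}"
proof -
  obtain B where B: "\<And>c. c \<ge> 1 \<Longrightarrow> cmod (nmain \<psi> a \<tau> c s) \<le> B * (\<kappa> c * real c powr - (29 / 16))"
    using norm_main_le[of "cmod s"] assms by (metis order.refl)
  have "(\<lambda>c. B * (\<kappa> c * real c powr - (29 / 16))) summable_on {1..}"
    by (intro summable_on_cmult_right summable_on_\<kappa>)
  hence "(\<lambda>c. norm (nmain \<psi> a \<tau> c s)) summable_on {1..}"
    by (rule Infinite_Sum.abs_summable_on_comparison_test') (use B in auto)
  thus ?thesis by (rule abs_summable_summable)
qed

text \<open>For Re s > 1 the main terms are absolutely summable as well, since 2 Re s can be divided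
  equally between c and w; Fubini then identifies the iterated sum in \<open>ncont\<close> with the
  double sum.\<close>

lemma has_sum_ncont:
  assumes s: "Re s > 1"
  shows "(nterm \<psi> a \<tau> s has_sum ncont \<psi> a \<tau> s) cw_index"
proof -
  define M where "M = (\<lambda>(c, w). \<psi> c w * of_real (nY a \<tau> c w) powr s)"
  have "(\<lambda>x. norm (M x)) summable_on cw_index"
  proof (rule Infinite_Sum.abs_summable_on_comparison_test')
    show "(\<lambda>x. nA a \<tau> powr Re s * (\<lambda>(c, w). real c powr - Re s * (1 + real_of_int \<bar>w\<bar>) powr - Re s) x) summable_on cw_index"
      using s by (intro summable_on_cmult_right summable_on_cw_index)
    fix x :: "nat \<times> int" assume "x \<in> cw_index"
    then obtain c w where x: "x = (c, w)" "c \<ge> 1" by (auto simp: cw_index_def)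
    have "cmod (M x) \<le> 1 * cmod (of_real (nY a \<tau> c w) powr s)"
      unfolding M_def x prod.case norm_mult by (intro mult_right_mono norm_le_1) auto
    also have "\<dots> \<le> nA a \<tau> powr Re s * nD c w powr - (2 * Re s)"
      using nY_powr_le[OF \<tau> a_pos x(2), of "Re s" s "Re s" w] s by simp
    also have "\<dots> \<le> nA a \<tau> powr Re s * (real c powr - Re s * (1 + real_of_int \<bar>w\<bar>) powr - Re s)"
      using nD_powr_le[OF x(2), of "Re s" "Re s" w] s by (intro mult_left_mono) auto
    finally show "norm (M x) \<le> nA a \<tau> powr Re s * (\<lambda>(c, w). real c powr - Re s * (1 + real_of_int \<bar>w\<bar>) powr - Re s) x"
      by (simp add: x)
  qed
  hence M: "M summable_on cw_index" by (rule abs_summable_summable)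
  have "(M has_sum (\<Sum>\<^sub>\<infinity>c\<in>{1..}. nmain \<psi> a \<tau> c s)) cw_index"
    unfolding cw_index_def
  proof (rule has_sum_SigmaI[where g = "\<lambda>c. nmain \<psi> a \<tau> c s"])
    show "((\<lambda>c. nmain \<psi> a \<tau> c s) has_sum (\<Sum>\<^sub>\<infinity>c\<in>{1..}. nmain \<psi> a \<tau> c s)) {1..}"
      using s by (intro has_sum_infsum summable_on_nmain) auto
    show "M summable_on {1..} \<times> UNIV" using M by (simp add: cw_index_def)
    show "((\<lambda>w. M (c, w)) has_sum nmain \<psi> a \<tau> c s) UNIV" if "c \<in> {1..}" for c
    proof -
      have "(\<lambda>(c,w). M (c, w)) summable_on {1..} \<times> UNIV" using M by (simp add: cw_index_def)
      hence "(\<lambda>w. M (c, w)) summable_on UNIV" by (rule summable_on_SigmaD1) (use that in auto)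
      thus ?thesis by (simp add: M_def nmain_def)
    qed
  qed
  hence "((\<lambda>x. nerr \<psi> a \<tau> x s + bes0 s * M x) has_sum ncont \<psi> a \<tau> s) cw_index"
    unfolding ncont_def using s by (intro has_sum_add has_sum_cmult_right has_sum_infsum summable_on_nerr) auto
  also have "?this \<longleftrightarrow> ?thesis"
  proof (rule has_sum_cong)
    fix x :: "nat \<times> int" assume "x \<in> cw_index"
    then obtain c w where x: "x = (c, w)" "c \<ge> 1" by (auto simp: cw_index_def)
    have "nterm \<psi> a \<tau> s x = \<psi> c w * ee (Re (nU a \<tau> c w)) * (of_real (nY a \<tau> c w) powr s * bes s (nY a \<tau> c w))"
      unfolding nterm_def x prod.case using s nY_pos[OF \<tau> a_pos x(2), of w]
      by (subst bessel_I_eq_bes) auto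
    thus "nerr \<psi> a \<tau> x s + bes0 s * M x = nterm \<psi> a \<tau> s x"
      by (simp add: nerr_def M_def x algebra_simps)
  qed
  finally show ?thesis .
qed

end
end

section \<open>Fourier expansion at $s = 1$\<close>

lemma qq_add: "qq (x + y) = qq x * qq y"
  by (simp add: qq_def algebra_simps exp_add)

lemma qq_of_int [simp]: "qq (of_int k) = 1"
  by (simp add: qq_def exp_eq_1)

lemma qq_nonzero [simp]: "qq z \<noteq> 0"
  by (simp add: qq_def)

lemma norm_qq: "cmod (qq z) = exp (- 2 * pi * Im z)"
  by (simp add: qq_def)

lemma norm_qq_less_1: "Im z > 0 \<Longrightarrow> cmod (qq z) < 1"
  by (simp add: norm_qq)

lemma qq_eq_iff: "qq z = qq z' \<longleftrightarrow> (\<exists>k. z = z' + of_int k)"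
proof
  assume "qq z = qq z'"
  then obtain k where "2 * of_real pi * \<i> * z = 2 * of_real pi * \<i> * z' + of_int (2 * k) * of_real pi * \<i>"
    by (auto simp: qq_def exp_eq)
  hence "2 * of_real pi * \<i> * z = 2 * of_real pi * \<i> * (z' + of_int k)"
    by (simp add: algebra_simps)
  hence "z = z' + of_int k" by simp
  thus "\<exists>k. z = z' + of_int k" ..
qed (auto simp: qq_add)

lemma qq_Ln:
  assumes "q \<noteq> 0"
  shows "qq (Ln q / (2 * of_real pi * \<i>)) = q" "Im (Ln q / (2 * of_real pi * \<i>)) = - ln (cmod q) / (2 * pi)"
proof -
  show "qq (Ln q / (2 * of_real pi * \<i>)) = q" using assms by (simp add: qq_def)
  have "Ln q / (2 * of_real pi * \<i>) = - \<i> * Ln q / of_real (2 * pi)"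
    by (simp add: field_simps)
  thus "Im (Ln q / (2 * of_real pi * \<i>)) = - ln (cmod q) / (2 * pi)"
    using assms by simp
qed

text \<open>Periodicity lets F descend to a function G on the punctured unit disc, boundedness near
  the cusp removes the singularity at q = 0, and the Taylor series of the extension has no negative
  powers.\<close>

lemma q_expansion:
  assumes hol: "F holomorphic_on {z. Im z > 0}"
    and per: "\<And>z. Im z > 0 \<Longrightarrow> F (z + 1) = F z"
    and bdd: "\<And>z. Im z \<ge> 1 \<Longrightarrow> 0 \<le> Re z \<Longrightarrow> Re z < 1 \<Longrightarrow> cmod (F z) \<le> B"
  obtains \<alpha> where "\<And>z. Im z > 0 \<Longrightarrow> ((\<lambda>l::nat. \<alpha> l * qq z ^ l) has_sum F z) UNIV"
proof -
  have per_nat: "F (z + of_nat k) = F z" if "Im z > 0" for z k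
  proof (induction k)
    case (Suc k)
    have "F (z + of_nat (Suc k)) = F (z + of_nat k + 1)" by (simp add: add_ac)
    thus ?case using per[of "z + of_nat k"] that Suc by simp
  qed simp
  have per_int: "F (z + of_int k) = F z" if "Im z > 0" for z k
  proof (cases k rule: int_cases2)
    case (nonpos m)
    thus ?thesis using per_nat[of "z + of_int k" m] that by simp
  qed (use per_nat that in auto)
  have bdd': "cmod (F z) \<le> B" if "Im z \<ge> 1" for z
  proof -
    have "cmod (F (z + of_int (- \<lfloor>Re z\<rfloor>))) \<le> B"
      by (rule bdd) (use that in \<open>auto, linarith\<close>)
    moreover have "F (z + of_int (- \<lfloor>Re z\<rfloor>)) = F z"
      by (rule per_int) (use that in auto)
    ultimately show ?thesis by (simp only:)
  qed
  define G where "G = (\<lambda>q. F (Ln q / (2 * of_real pi * \<i>)))"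
  define D where "D = ball (0::complex) 1 - {0}"
  have Im_pos: "Im (Ln q / (2 * of_real pi * \<i>)) > 0" if "q \<in> D" for q
    using that by (subst qq_Ln) (auto simp: D_def divide_simps)
  have G: "G (qq z) = F z" if "Im z > 0" for z
  proof -
    obtain k where "Ln (qq z) / (2 * of_real pi * \<i>) = z + of_int k"
      using qq_Ln(1)[of "qq z"] qq_eq_iff by auto
    thus ?thesis using per_int that by (simp add: G_def)
  qed
  have Gq: "G q = F w" if "Im w > 0" "qq w = q" for q w using G that by auto
  have hol1: "G holomorphic_on D - \<real>\<^sub>\<le>\<^sub>0"
  proof -
    have "(F \<circ> (\<lambda>q. Ln q / (2 * of_real pi * \<i>))) holomorphic_on D - \<real>\<^sub>\<le>\<^sub>0"
    proof (rule holomorphic_on_compose_gen[OF _ hol])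
      show "(\<lambda>q. Ln q / (2 * of_real pi * \<i>)) holomorphic_on D - \<real>\<^sub>\<le>\<^sub>0"
        by (intro holomorphic_intros) auto
    qed (use Im_pos in auto)
    thus ?thesis by (simp add: G_def o_def)
  qed
  \<comment> \<open>\<open>Ln\<close> is cut along the negative axis. There Ln (-q), with half a
    period added, is another logarithm of q up to periods, so it yields the same G; the two slit
    discs cover D.\<close>
  have hol2: "G holomorphic_on D - \<real>\<^sub>\<ge>\<^sub>0"
  proof -
    have Im: "Im (Ln (- q) / (2 * of_real pi * \<i>) + 1 / 2) > 0" if "q \<in> D" for q
      using Im_pos[of "- q"] that by (simp add: D_def)
    have "(F \<circ> (\<lambda>q. Ln (- q) / (2 * of_real pi * \<i>) + 1 / 2)) holomorphic_on D - \<real>\<^sub>\<ge>\<^sub>0"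
    proof (rule holomorphic_on_compose_gen[OF _ hol])
      show "(\<lambda>q. Ln (- q) / (2 * of_real pi * \<i>) + 1 / 2) holomorphic_on D - \<real>\<^sub>\<ge>\<^sub>0"
        by (intro holomorphic_intros) (auto simp: complex_nonpos_Reals_iff complex_nonneg_Reals_iff)
    qed (use Im in auto)
    moreover have "G q = F (Ln (- q) / (2 * of_real pi * \<i>) + 1 / 2)" if "q \<in> D" for q
    proof (rule Gq[OF Im[OF that]])
      have "qq (1 / 2) = - 1" by (simp add: qq_def)
      thus "qq (Ln (- q) / (2 * of_real pi * \<i>) + 1 / 2) = q"
        using that by (subst qq_add, subst qq_Ln) (auto simp: D_def)
    qed
    ultimately show ?thesis by (subst holomorphic_cong[OF refl]) (auto simp: o_def)
  qed
  have holD: "G holomorphic_on D"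
  proof -
    have "open D" by (auto simp: D_def)
    hence op: "open (D - \<real>\<^sub>\<le>\<^sub>0)" "open (D - \<real>\<^sub>\<ge>\<^sub>0)"
      by (intro open_Diff closed_nonpos_Reals_complex closed_nonneg_Reals_complex; assumption)+
    have "G holomorphic_on (D - \<real>\<^sub>\<le>\<^sub>0) \<union> (D - \<real>\<^sub>\<ge>\<^sub>0)"
      by (rule holomorphic_on_Un[OF hol1 hol2 op])
    moreover have "(D - \<real>\<^sub>\<le>\<^sub>0) \<union> (D - \<real>\<^sub>\<ge>\<^sub>0) = D"
      by (auto simp: D_def complex_nonpos_Reals_iff complex_nonneg_Reals_iff complex_eq_iff)
    ultimately show ?thesis by simp
  qed
  \<comment> \<open>The disc of radius exp (-2 pi) corresponds to Im z > 1, where F is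
    bounded.\<close>
  have "\<forall>\<^sub>F q in at 0. cmod (G q) \<le> B"
  proof -
    have "\<forall>\<^sub>F q in at (0::complex). q \<in> ball 0 (exp (- 2 * pi)) - {0}"
      by (intro eventually_at_in_open) auto
    thus ?thesis
    proof eventually_elim
      case (elim q)
      hence q: "q \<noteq> 0" "cmod q < exp (- 2 * pi)" by auto
      hence "ln (cmod q) < - 2 * pi" by (metis exp_gt_zero ln_exp ln_less_cancel_iff zero_less_norm_iff)
      hence "Im (Ln q / (2 * of_real pi * \<i>)) \<ge> 1"
        using q by (subst qq_Ln) (auto simp: field_simps)
      thus ?case unfolding G_def by (rule bdd')
    qed
  qed
  hence "\<exists>g. g holomorphic_on ball 0 1 \<and> (\<forall>z\<in>ball 0 1 - {0}. g z = G z)"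
    using holD by (subst holomorphic_on_extend) (auto simp: D_def)
  then obtain g where g: "g holomorphic_on ball 0 1" "\<And>z. z \<in> ball 0 1 - {0} \<Longrightarrow> g z = G z"
    by blast
  define \<alpha> where "\<alpha> = (\<lambda>n. (deriv ^^ n) g 0 / fact n)"
  have sums: "(\<lambda>n. \<alpha> n * w ^ n) sums g w" if "cmod w < 1" for w
    using holomorphic_power_series[OF g(1), of w] that by (simp add: \<alpha>_def)
  have "((\<lambda>l. \<alpha> l * qq z ^ l) has_sum F z) UNIV" if z: "Im z > 0" for z
  proof -
    have q: "cmod (qq z) < 1" using norm_qq_less_1[OF z] .
    \<comment> \<open>A radius strictly between |q| and 1 makes the power series converge absolutely
      at q, as \<open>has_sum\<close> demands.\<close>
    then obtain r where r: "cmod (qq z) < r" "r < 1" using dense by blast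
    have "cmod (complex_of_real r) < 1" using r order.strict_trans1[OF norm_ge_zero r(1)] by simp
    hence "summable (\<lambda>n. \<alpha> n * of_real r ^ n)" using sums sums_summable by blast
    hence "summable (\<lambda>n. norm (\<alpha> n * qq z ^ n))"
      by (rule powser_insidea) (use r in auto)
    moreover have "(\<lambda>n. \<alpha> n * qq z ^ n) sums F z"
      using sums[OF q] g(2)[of "qq z"] q G[OF z] by simp
    ultimately show ?thesis by (rule norm_summable_imp_has_sum)
  qed
  thus ?thesis by (rule that)
qed

section \<open>The Poisson kernel\<close>

lemma Digamma_reflection:
  fixes z :: complex
  assumes "z \<notin> \<int>"
  shows "Digamma (1 - z) - Digamma z = of_real pi * cot (of_real pi * z)"
proof -
  have np: "z \<notin> \<int>\<^sub>\<le>\<^sub>0" "1 - z \<notin> \<int>\<^sub>\<le>\<^sub>0" using assms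
    by (auto elim!: nonpos_Ints_cases) (metis Ints_1 Ints_diff Ints_of_int diff_diff_eq2 add_diff_cancel_left' add.commute)
  \<comment> \<open>Both sides of the reflection formula rGamma z * rGamma (1 - z) = sin (pi z) / pi
    are differentiated; with the reciprocal Gamma function no poles interfere.\<close>
  have "((\<lambda>z. rGamma z * rGamma (1 - z)) has_field_derivative
      (- rGamma z * Digamma z * rGamma (1 - z) + (- rGamma (1 - z) * Digamma (1 - z) * (- 1)) * rGamma z)) (at z)"
    using np by (auto intro!: derivative_eq_intros)
  moreover have "((\<lambda>z. rGamma z * rGamma (1 - z)) has_field_derivative cos (of_real pi * z)) (at z)"
    unfolding rGamma_reflection_complex by (auto intro!: derivative_eq_intros)
  ultimately have "- rGamma z * Digamma z * rGamma (1 - z) + (- rGamma (1 - z) * Digamma (1 - z) * (- 1)) * rGamma z =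
       cos (of_real pi * z)"
    by (rule DERIV_unique)
  hence "(rGamma z * rGamma (1 - z)) * (Digamma (1 - z) - Digamma z) = cos (of_real pi * z)"
    by (simp add: algebra_simps)
  moreover have "rGamma z * rGamma (1 - z) \<noteq> 0" using np by (simp add: rGamma_eq_zero_iff)
  ultimately show ?thesis unfolding rGamma_reflection_complex
    by (simp add: cot_def field_simps)
qed

text \<open>The harmonic monomials q^l and (cnj q)^|l| under one integer index. As functions of Re
  \<tau> they are multiples of e(l Re \<tau>), so a series in \<open>qe\<close> is a Fourier series
  on each horizontal line.\<close>

definition qe :: "complex \<Rightarrow> int \<Rightarrow> complex" where
  "qe \<tau> l = (if l \<ge> 0 then qq \<tau> ^ nat l else cnj (qq \<tau>) ^ nat (- l))"

lemma has_sum_int_split: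
  fixes f :: "int \<Rightarrow> 'a :: {topological_comm_monoid_add, t2_space}"
  assumes "((\<lambda>n. f (int n)) has_sum S1) UNIV" "((\<lambda>n. f (- int n)) has_sum S2) {1..}"
  shows "(f has_sum (S1 + S2)) UNIV"
proof -
  have "(f has_sum S1) (range int)"
    using assms(1) by (subst has_sum_reindex) (auto simp: o_def)
  moreover have "(f has_sum S2) ((\<lambda>n. - int n) ` {1..})"
    using assms(2) by (subst has_sum_reindex) (auto simp: o_def inj_on_def)
  ultimately have "(f has_sum (S1 + S2)) (range int \<union> (\<lambda>n. - int n) ` {1..})"
    by (rule has_sum_Un_disjoint) auto
  moreover have "x \<in> range int \<union> (\<lambda>n. - int n) ` {1..}" for x
    by (cases x rule: int_cases3) auto
  hence "range int \<union> (\<lambda>n. - int n) ` {1..} = UNIV" by blast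
  ultimately show ?thesis by simp
qed

text \<open>Two geometric series, one in q and one in its conjugate. Their sum is the Poisson kernel
  of the disc, which \<open>poisson_kernel\<close> produces from the lattice side.\<close>

lemma has_sum_qe:
  assumes "Im \<tau> > 0"
  shows "(qe \<tau> has_sum of_real (Re ((1 + qq \<tau>) / (1 - qq \<tau>)))) UNIV"
    and "(\<lambda>l. cmod (qe \<tau> l)) summable_on UNIV"
proof -
  define q where "q = qq \<tau>"
  have q: "cmod q < 1" using norm_qq_less_1[OF assms] by (simp add: q_def)
  have q1: "q \<noteq> 1" using q by auto
  have geo: "((\<lambda>n. z ^ n) has_sum 1 / (1 - z)) UNIV" if "cmod z < 1" for z :: complex
    by (rule norm_summable_imp_has_sum) (use that in \<open>auto simp: norm_power intro!: summable_geometric geometric_sums\<close>)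
  have geo1: "((\<lambda>n. z ^ n) has_sum z / (1 - z)) {1..}" if "cmod z < 1" for z :: complex
    using has_sum_geometric_from_1[OF that] by simp
  have "((\<lambda>n. qe \<tau> (int n)) has_sum 1 / (1 - q)) UNIV"
    using geo[OF q] by (simp add: qe_def q_def)
  moreover have "((\<lambda>n. qe \<tau> (- int n)) has_sum cnj q / (1 - cnj q)) {1..}"
  proof -
    have "((\<lambda>n. cnj q ^ n) has_sum cnj q / (1 - cnj q)) {1..}" using geo1[of "cnj q"] q by simp
    thus ?thesis by (subst has_sum_cong[where g = "\<lambda>n. cnj q ^ n"]) (auto simp: qe_def q_def)
  qed
  ultimately have "(qe \<tau> has_sum (1 / (1 - q) + cnj q / (1 - cnj q))) UNIV"
    by (rule has_sum_int_split)
  also have "1 / (1 - q) + cnj q / (1 - cnj q) = of_real (Re ((1 + q) / (1 - q)))"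
  proof -
    have A: "of_real (Re ((1 + q) / (1 - q))) = ((1 + q) / (1 - q) + cnj ((1 + q) / (1 - q))) / 2"
      by (subst complex_add_cnj) simp
    have "cnj q \<noteq> 1" using q by (metis complex_mod_cnj norm_one less_irrefl)
    hence "1 - q \<noteq> 0" "1 - cnj q \<noteq> 0" using q1 by auto
    hence B: "1 / (1 - q) + cnj q / (1 - cnj q) = ((1 + q) / (1 - q) + (1 + cnj q) / (1 - cnj q)) / 2"
      by (simp add: divide_simps) (simp add: algebra_simps)
    show ?thesis unfolding A B by simp
  qed
  finally show "(qe \<tau> has_sum of_real (Re ((1 + qq \<tau>) / (1 - qq \<tau>)))) UNIV" by (simp add: q_def)
  thus "(\<lambda>l. cmod (qe \<tau> l)) summable_on UNIV"
    using has_sum_imp_summable summable_on_iff_abs_summable_on_complex by blast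
qed

text \<open>Partial fractions of the cotangent: the Digamma series at 1 - z and at z differ by a
  symmetric sum of 1 / (z + m), which converges only conditionally. Its imaginary part is absolutely
  summable, so after taking -Im the limit is an unordered sum over the integers.\<close>

lemma poisson_kernel:
  assumes z: "Im z > 0"
  shows "((\<lambda>m::int. Im z / (cmod (z + of_int m))\<^sup>2) has_sum pi * Re ((1 + qq z) / (1 - qq z))) UNIV"
proof -
  define f where "f = (\<lambda>m::int. Im z / (cmod (z + of_int m))\<^sup>2)"
  have zZ: "z \<notin> \<int>" using z by (auto elim!: Ints_cases)
  have f_im: "f m = - Im (inverse (z + of_int m))" for m
    by (simp add: f_def inverse_eq_divide Im_divide cmod_power2)
  have "(\<lambda>m. (of_real (ln (real m)) - (\<Sum>n<m. inverse (1 - z + of_nat n))) -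
             (of_real (ln (real m)) - (\<Sum>n<m. inverse (z + of_nat n)))) \<longlonglongrightarrow> Digamma (1 - z) - Digamma z"
    by (intro tendsto_diff Digamma_LIMSEQ) (use zZ in auto)
  also have "Digamma (1 - z) - Digamma z = of_real pi * cot (of_real pi * z)"
    by (rule Digamma_reflection[OF zZ])
  also have "(\<lambda>m. (of_real (ln (real m)) - (\<Sum>n<m. inverse (1 - z + of_nat n))) -
             (of_real (ln (real m)) - (\<Sum>n<m. inverse (z + of_nat n)))) =
      (\<lambda>m. \<Sum>n<m. inverse (z + of_int (int n)) + inverse (z + of_int (- int n - 1)))"
  proof
    fix m
    have "inverse (z + of_int (- int n - 1)) = - inverse (1 - z + of_nat n)" for n
      by (simp add: algebra_simps flip: inverse_minus_eq)
    thus "(of_real (ln (real m)) - (\<Sum>n<m. inverse (1 - z + of_nat n))) -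
             (of_real (ln (real m)) - (\<Sum>n<m. inverse (z + of_nat n))) =
       (\<Sum>n<m. inverse (z + of_int (int n)) + inverse (z + of_int (- int n - 1)))"
      by (simp add: sum.distrib sum_negf sum_subtractf)
  qed
  finally have "(\<lambda>m. - Im (\<Sum>n<m. inverse (z + of_int (int n)) + inverse (z + of_int (- int n - 1)))) \<longlonglongrightarrow>
      - Im (of_real pi * cot (of_real pi * z))"
    by (intro tendsto_minus tendsto_Im)
  hence sums: "(\<lambda>n. f (int n) + f (- int n - 1)) sums (- Im (of_real pi * cot (of_real pi * z)))"
    unfolding sums_def f_im by (simp add: sum_negf sum.distrib add.commute)
  have summ: "f summable_on UNIV"
  proof -
    define K where "K = Im z / (lattice_const z)\<^sup>2"
    have K: "K \<ge> 0" using z by (auto simp: K_def)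
    have "(\<lambda>m. K * (1 + real_of_int \<bar>m\<bar>) powr - 2) summable_on UNIV"
      by (intro summable_on_cmult_right summable_on_int_powr) auto
    hence "(\<lambda>m. norm (f m)) summable_on UNIV"
    proof (rule Infinite_Sum.abs_summable_on_comparison_test')
      fix m :: int
      have "lattice_const z * (1 + real_of_int \<bar>m\<bar>) \<le> cmod (z + of_int m)"
        using lattice_bound[OF z, of 1 "real_of_int m"] by simp
      moreover have "lattice_const z * (1 + real_of_int \<bar>m\<bar>) > 0"
        using lattice_const_pos[OF z] by (intro mult_pos_pos) auto
      moreover from calculation have "cmod (z + of_int m) > 0" by linarith
      ultimately have "f m \<le> Im z / (lattice_const z * (1 + real_of_int \<bar>m\<bar>))\<^sup>2"
        unfolding f_def using z lattice_const_pos[OF z]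
        by (intro divide_left_mono power_mono mult_pos_pos zero_less_power) simp_all
      also have "\<dots> = K * (1 + real_of_int \<bar>m\<bar>) powr - 2"
        by (subst power_mult_distrib) (simp add: K_def powr_minus divide_inverse)
      finally show "norm (f m) \<le> K * (1 + real_of_int \<bar>m\<bar>) powr - 2"
        using z by (simp add: f_def)
    qed
    thus ?thesis by (rule abs_summable_summable)
  qed
  have "(\<lambda>n. f (int n)) summable_on UNIV"
    using summable_on_reindex[of int UNIV f] summable_on_subset_banach[OF summ] by (auto simp: o_def)
  hence s1: "((\<lambda>n. f (int n)) has_sum (\<Sum>\<^sub>\<infinity>n. f (int n))) UNIV" by simp
  have "inj (\<lambda>n. - int n - 1)" by (auto simp: inj_def)
  hence "(\<lambda>n. f (- int n - 1)) summable_on UNIV"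
    using summable_on_reindex[of "\<lambda>n. - int n - 1" UNIV f] summable_on_subset_banach[OF summ] by (auto simp: o_def)
  hence s2: "((\<lambda>n. f (- int n - 1)) has_sum (\<Sum>\<^sub>\<infinity>n. f (- int n - 1))) UNIV" by simp
  have s2': "((\<lambda>n. f (- int n)) has_sum (\<Sum>\<^sub>\<infinity>n. f (- int n - 1))) {1..}"
    using s2 by (subst has_sum_reindex_bij_witness[of "{1..}" Suc "\<lambda>n. n - 1" UNIV "\<lambda>n. f (- int n - 1)" _ _ "\<Sum>\<^sub>\<infinity>n. f (- int n - 1)"])
      (auto simp: of_nat_diff)
  have "(f has_sum ((\<Sum>\<^sub>\<infinity>n. f (int n)) + (\<Sum>\<^sub>\<infinity>n. f (- int n - 1)))) UNIV"
    by (rule has_sum_int_split[OF s1 s2'])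
  also have "(\<Sum>\<^sub>\<infinity>n. f (int n)) + (\<Sum>\<^sub>\<infinity>n. f (- int n - 1)) = - Im (of_real pi * cot (of_real pi * z))"
    using has_sum_imp_sums[OF has_sum_add[OF s1 s2]] sums sums_unique2 by blast
  also have "\<dots> = pi * Re ((1 + qq z) / (1 - qq z))"
  proof -
    define E where "E = exp (\<i> * of_real pi * z)"
    have E: "E \<noteq> 0" "qq z = E * E" by (simp_all add: E_def qq_def mult_ac flip: exp_add)
    have q1: "E * E \<noteq> 1" using norm_qq_less_1[OF z] E by auto
    define r where "r = (1 + qq z) / (1 - qq z)"
    have "cot (of_real pi * z) = - \<i> * r"
    proof -
      have "exp (- (\<i> * (of_real pi * z))) = inverse E" "exp (\<i> * (of_real pi * z)) = E"
        by (simp_all add: E_def exp_minus mult.assoc)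
      hence "cos (of_real pi * z) = (E + inverse E) / 2" "sin (of_real pi * z) = (E - inverse E) / (2 * \<i>)"
        by (simp_all add: cos_exp_eq sin_exp_eq mult_ac)
      hence "cot (of_real pi * z) = ((E + inverse E) / 2) / ((E - inverse E) / (2 * \<i>))"
        by (simp only: cot_def)
      also have "\<dots> = \<i> * (E * E + 1) / (E * E - 1)"
        using E(1) q1 by (simp add: divide_simps)
      also have "\<dots> = - \<i> * ((1 + E * E) / (1 - E * E))"
        using q1 by (simp add: divide_simps) (simp add: algebra_simps)
      finally show ?thesis by (simp only: E(2) r_def)
    qed
    thus ?thesis by (simp flip: r_def)
  qed
  finally show ?thesis by (simp add: f_def)
qed

text \<open>The exponential without its constant and linear Taylor terms. The constants cancel
  between U and its conjugate, the linear terms match the subtraction of \<open>bes0\<close> in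
  \<open>nerr\<close>, and the quadratic remainder is absolutely summable over (c, w).\<close>

definition neps :: "complex \<Rightarrow> complex" where
  "neps u = exp (2 * of_real pi * \<i> * u) - 1 - 2 * of_real pi * \<i> * u"

text \<open>This presents the antiholomorphic half as the conjugate of a holomorphic series of the
  same kind, with -a in place of a.\<close>

lemma neps_cnj: "cnj (neps (- u)) = neps (cnj u)"
  by (simp add: neps_def exp_cnj)

lemma norm_neps_le:
  assumes "cmod u \<le> r"
  shows "cmod (neps u) \<le> exp (2 * pi * r) * (2 * pi * cmod u)\<^sup>2"
proof -
  define z where "z = 2 * of_real pi * \<i> * u"
  have z: "cmod z = 2 * pi * cmod u" by (simp add: z_def norm_mult)
  have "cmod (exp z - (\<Sum>k\<le>1. z ^ k / fact k)) \<le> exp \<bar>Re z\<bar> * cmod z ^ Suc 1 / fact 1"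
    by (rule Taylor_exp)
  hence "cmod (exp z - 1 - z) \<le> exp \<bar>Re z\<bar> * (cmod z)\<^sup>2"
    by (simp add: power2_eq_square algebra_simps)
  also have "\<dots> \<le> exp (2 * pi * r) * (cmod z)\<^sup>2"
  proof -
    have "\<bar>Re z\<bar> \<le> 2 * pi * cmod u" using abs_Re_le_cmod[of z] z by simp
    also have "\<dots> \<le> 2 * pi * r" using assms by simp
    finally show ?thesis by (intro mult_right_mono) auto
  qed
  finally show ?thesis unfolding z by (simp add: neps_def z_def)
qed

lemma norm_neps_nU_le:
  assumes "Im \<tau> > 0" "b \<noteq> 0" "1 / lattice_const \<tau> \<le> L" "c \<ge> 1"
  shows "cmod (neps (nU b \<tau> c w)) \<le>
    exp (2 * pi * (\<bar>b\<bar> * L)) * (2 * pi * (\<bar>b\<bar> * L))\<^sup>2 * (real c powr - 2 * (1 + real_of_int \<bar>w\<bar>) powr - 2)"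
proof -
  have D: "nD c w \<ge> 1" "nD c w \<ge> 1 + real_of_int \<bar>w\<bar>" using nD_ge[OF assms(4)] by auto
  have L: "L > 0" using lattice_const_pos[OF assms(1)] assms(3) by (meson divide_pos_pos less_le_trans zero_less_one)
  have "cmod (nU b \<tau> c w) = cmod (nU \<bar>b\<bar> \<tau> c w)"
    by (simp add: nU_def norm_divide)
  also have "\<dots> \<le> \<bar>b\<bar> / lattice_const \<tau> / (real c * nD c w)"
    by (rule norm_nU_le) (use assms in auto)
  also have "\<dots> \<le> \<bar>b\<bar> * L / (real c * nD c w)"
    using assms D mult_left_mono[OF assms(3), of "\<bar>b\<bar>"] by (intro divide_right_mono) auto
  finally have 1: "cmod (nU b \<tau> c w) \<le> \<bar>b\<bar> * L / (real c * nD c w)" .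
  also have "\<dots> \<le> \<bar>b\<bar> * L / 1"
  proof (intro divide_left_mono)
    have "1 * 1 \<le> real c * nD c w" using assms D by (intro mult_mono) auto
    thus "1 \<le> real c * nD c w" by simp
  qed (use L D assms in auto)
  finally have 2: "cmod (nU b \<tau> c w) \<le> \<bar>b\<bar> * L" by simp
  have "cmod (neps (nU b \<tau> c w)) \<le> exp (2 * pi * (\<bar>b\<bar> * L)) * (2 * pi * cmod (nU b \<tau> c w))\<^sup>2"
    by (rule norm_neps_le[OF 2])
  also have "\<dots> \<le> exp (2 * pi * (\<bar>b\<bar> * L)) * (2 * pi * (\<bar>b\<bar> * L / (real c * nD c w)))\<^sup>2"
    using 1 by (intro mult_left_mono power_mono) auto
  also have "\<dots> = exp (2 * pi * (\<bar>b\<bar> * L)) * (2 * pi * (\<bar>b\<bar> * L))\<^sup>2 * (real c powr - 2 * nD c w powr - 2)"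
    using D assms(4) by (simp add: powr_minus power_mult_distrib power_divide field_simps)
  also have "\<dots> \<le> exp (2 * pi * (\<bar>b\<bar> * L)) * (2 * pi * (\<bar>b\<bar> * L))\<^sup>2 * (real c powr - 2 * (1 + real_of_int \<bar>w\<bar>) powr - 2)"
    using D by (intro mult_left_mono powr_mono2') auto
  finally show ?thesis .
qed

lemma has_sum_cw_shift:
  "((\<lambda>(c, w). f c (w + int c)) has_sum S) cw_index \<longleftrightarrow> ((\<lambda>(c, w). f c w) has_sum S) cw_index"
  by (rule has_sum_reindex_bij_witness[of _ "\<lambda>(c, w). (c, w - int c)" "\<lambda>(c, w). (c, w + int c)"])
     (auto simp: cw_index_def)

text \<open>Replacing \<tau> by \<tau> + 1 turns the row (c, w) into (c, w + c), so a weight of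
  period c gives a function of period 1, and \<open>q_expansion\<close> applies. The sign of b is
  left open because both a and -a are used.\<close>

lemma neps_series_expansion:
  assumes "b \<noteq> 0" and le1: "\<And>c w. cmod (\<phi> c w) \<le> 1"
    and per: "\<And>c w. c \<ge> 1 \<Longrightarrow> \<phi> c (w + int c) = \<phi> c w"
  shows "\<exists>\<alpha>. \<forall>\<tau>. Im \<tau> > 0 \<longrightarrow>
    ((\<lambda>l::nat. \<alpha> l * qq \<tau> ^ l) has_sum (\<Sum>\<^sub>\<infinity>(c, w)\<in>cw_index. \<phi> c w * neps (nU b \<tau> c w))) UNIV \<and>
    (\<lambda>(c, w). \<phi> c w * neps (nU b \<tau> c w)) summable_on cw_index"
proof -
  define F where "F = (\<lambda>\<tau>. \<Sum>\<^sub>\<infinity>(c, w)\<in>cw_index. \<phi> c w * neps (nU b \<tau> c w))"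
  define K where "K = (\<lambda>L. exp (2 * pi * (\<bar>b\<bar> * L)) * (2 * pi * (\<bar>b\<bar> * L))\<^sup>2)"
  define M where "M = (\<lambda>L x. K L * (\<lambda>(c, w). real c powr - 2 * (1 + real_of_int \<bar>w\<bar>) powr - 2) x)"
  have M: "M L summable_on cw_index" for L
    unfolding M_def by (intro summable_on_cmult_right summable_on_cw_index) auto
  have le: "cmod ((\<lambda>(c, w). \<phi> c w * neps (nU b \<tau> c w)) x) \<le> M L x"
    if t: "Im \<tau> > 0" "1 / lattice_const \<tau> \<le> L" "x \<in> cw_index" for \<tau> L x
  proof -
    obtain c w where x: "x = (c, w)" "c \<ge> 1" using t(3) by (auto simp: cw_index_def)
    have "cmod (\<phi> c w) * cmod (neps (nU b \<tau> c w)) \<le> 1 * cmod (neps (nU b \<tau> c w))"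
      by (intro mult_right_mono le1) auto
    thus ?thesis using norm_neps_nU_le[OF t(1) assms(1) t(2) x(2), of w]
      by (simp add: x M_def K_def norm_mult)
  qed
  have summ: "(\<lambda>(c, w). \<phi> c w * neps (nU b \<tau> c w)) summable_on cw_index" if "Im \<tau> > 0" for \<tau>
    by (rule abs_summable_summable, rule Infinite_Sum.abs_summable_on_comparison_test'[OF M le[OF that order.refl]])
  have hol: "F holomorphic_on {z. Im z > 0}"
    unfolding F_def
  proof (rule holomorphic_on_infsum)
    show "open {z. Im z > 0}" by (rule open_halfspace_Im_gt)
    fix x :: "nat \<times> int" assume "x \<in> cw_index"
    then obtain c w where x: "x = (c, w)" "c \<ge> 1" by (auto simp: cw_index_def)
    have nz: "of_nat c * z + of_int w \<noteq> 0" if "Im z > 0" for z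
      using lattice_bound'(2)[OF that, of 1 c w] x(2) by auto
    show "(\<lambda>\<tau>. case x of (c, w) \<Rightarrow> \<phi> c w * neps (nU b \<tau> c w)) holomorphic_on {z. Im z > 0}"
      unfolding x prod.case neps_def nU_def
      by (intro holomorphic_intros) (use nz x in auto)
  next
    fix z :: complex assume "z \<in> {z. Im z > 0}"
    then obtain r where r: "r > 0" "cball z r \<subseteq> {z. Im z > 0}"
      using open_contains_cball[THEN iffD1, OF open_halfspace_Im_gt[of 0]] by blast
    have "continuous_on (cball z r) (\<lambda>\<tau>. 1 / Im \<tau> + 1 + cmod \<tau> / Im \<tau>)"
      using r(2) by (intro continuous_intros) auto
    then obtain L where L: "\<And>\<tau>. \<tau> \<in> cball z r \<Longrightarrow> norm (1 / Im \<tau> + 1 + cmod \<tau> / Im \<tau>) \<le> L"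
      using continuous_on_compact_norm_bound[OF _ compact_cball] by blast
    have "1 / lattice_const \<tau> \<le> L" if "\<tau> \<in> cball z r" for \<tau>
      using L[OF that] by (simp add: lattice_const_def)
    hence "\<forall>x\<in>cw_index. \<forall>\<tau>\<in>cball z r. cmod (case x of (c, w) \<Rightarrow> \<phi> c w * neps (nU b \<tau> c w)) \<le> M L x"
      using le r(2) by (auto simp: subset_iff simp del: mem_cball)
    thus "\<exists>r>0. \<exists>M. M summable_on cw_index \<and> cball z r \<subseteq> {z. Im z > 0} \<and>
       (\<forall>x\<in>cw_index. \<forall>\<tau>\<in>cball z r. cmod (case x of (c, w) \<Rightarrow> \<phi> c w * neps (nU b \<tau> c w)) \<le> M x)"
      using r M by blast
  qed
  have perF: "F (z + 1) = F z" if "Im z > 0" for z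
  proof -
    have "((\<lambda>(c, w). \<phi> c w * neps (nU b z c w)) has_sum F z) cw_index"
      unfolding F_def using summ[OF that] by simp
    hence "((\<lambda>(c, w). \<phi> c (w + int c) * neps (nU b z c (w + int c))) has_sum F z) cw_index"
      by (subst has_sum_cw_shift[where f = "\<lambda>c w. \<phi> c w * neps (nU b z c w)"])
    also have "?this \<longleftrightarrow> ((\<lambda>(c, w). \<phi> c w * neps (nU b (z + 1) c w)) has_sum F z) cw_index"
      by (rule has_sum_cong) (auto simp: cw_index_def per nU_def algebra_simps)
    finally show ?thesis unfolding F_def by (rule infsumI)
  qed
  \<comment> \<open>In the strip |z| is at most 1 + Im z, so the reciprocal of
    \<open>lattice_const z\<close> is at most 1 + 1 + 2 = 4.\<close>
  have bdd: "cmod (F z) \<le> infsum (M 4) cw_index" if z: "Im z \<ge> 1" "0 \<le> Re z" "Re z < 1" for z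
  proof -
    have "cmod z \<le> \<bar>Re z\<bar> + \<bar>Im z\<bar>" by (rule cmod_le)
    hence "cmod z \<le> 1 + Im z" using z by simp
    hence "cmod z / Im z \<le> 2" using z by (simp add: field_simps)
    moreover have "1 / Im z \<le> 1" using z by (simp add: field_simps)
    ultimately have "1 / lattice_const z \<le> 4" by (simp add: lattice_const_def)
    moreover have "Im z > 0" using z by simp
    ultimately show ?thesis
      unfolding F_def by (intro norm_infsum_le[OF has_sum_infsum has_sum_infsum] summ M le) auto
  qed
  obtain \<alpha> where "\<And>z. Im z > 0 \<Longrightarrow> ((\<lambda>l::nat. \<alpha> l * qq z ^ l) has_sum F z) UNIV"
    using q_expansion[OF hol perF bdd] by blast
  thus ?thesis using summ unfolding F_def by blast
qed

lemma qe_shift: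
  assumes "c > 0"
  shows "qe (\<tau> + of_int v / of_nat c) l = qe \<tau> l * ec c (l * v)"
proof -
  have q: "qq (\<tau> + of_int v / of_nat c) = qq \<tau> * ec c v"
    by (simp add: qq_add) (simp add: qq_def ec_def ee_def)
  show ?thesis
  proof (cases "l \<ge> 0")
    case True
    thus ?thesis by (simp add: qe_def q power_mult_distrib ec_power mult.commute)
  next
    case False
    thus ?thesis by (simp add: qe_def q power_mult_distrib cnj_ec ec_power mult.commute)
  qed
qed

section \<open>Expansion of the weighted series\<close>

context niebur_weight
begin

text \<open>The complete sums bounded by \<open>cancel\<close>; for the Atkin-Lehner weights they
  are Kloosterman sums or 0.\<close>

definition fourier_weight :: "nat \<Rightarrow> int \<Rightarrow> complex" where
  "fourier_weight c l = (\<Sum>v\<in>{0..<int c}. \<psi> c v * ec c (l * v))"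

lemma periodic_int:
  assumes "c \<ge> 1"
  shows "\<psi> c (w + int c * m) = \<psi> c w"
proof -
  have nat: "\<psi> c (w + int c * int k) = \<psi> c w" for w k
  proof (induction k)
    case (Suc k)
    have "\<psi> c (w + int c * int (Suc k)) = \<psi> c (w + int c * int k + int c)" by (simp add: algebra_simps)
    thus ?case using periodic[OF assms] Suc by simp
  qed simp
  show ?thesis
  proof (cases m rule: int_cases2)
    case (nonpos k)
    thus ?thesis using nat[of "w + int c * m" k] by simp
  qed (use nat in auto)
qed

text \<open>Put w = v + c m with v a residue modulo c. The sum over m is a Poisson kernel at \<tau>
  + v / c, and in its expansion the shift by v / c contributes the character e(l v / c), which the
  sum over v turns into \<open>fourier_weight c l\<close>.\<close>

lemma nmain_1:
  assumes \<tau>: "Im \<tau> > 0" and c: "c \<ge> 1"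
  shows "((\<lambda>l. of_real (pi * a / (real c)\<^sup>2) * fourier_weight c l * qe \<tau> l) has_sum nmain \<psi> a \<tau> c 1) UNIV"
proof -
  define f where "f = (\<lambda>w. \<psi> c w * of_real (nY a \<tau> c w))"
  define Z where "Z = (\<lambda>v::int. \<tau> + of_int v / of_nat c)"
  define K where "K = pi * a / (real c)\<^sup>2"
  define R where "R = (\<lambda>v. Re ((1 + qq (Z v)) / (1 - qq (Z v))))"
  have c0: "real c > 0" using c by simp
  have ImZ: "Im (Z v) = Im \<tau>" for v by (simp add: Z_def)
  have "f summable_on UNIV"
  proof (rule abs_summable_summable, rule Infinite_Sum.abs_summable_on_comparison_test')
    show "(\<lambda>w::int. nA a \<tau> powr 1 * real c powr - (27 / 32) * (1 + real_of_int \<bar>w\<bar>) powr - (33 / 32)) summable_on UNIV"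
      by (intro summable_on_cmult_right summable_on_int_powr) auto
    fix w :: int
    have "cmod (f w) \<le> 1 * cmod (of_real (nY a \<tau> c w))"
      unfolding f_def norm_mult by (intro mult_right_mono norm_le_1) auto
    also have "\<dots> \<le> nA a \<tau> powr 1 * real c powr - (27 / 32) * (1 + real_of_int \<bar>w\<bar>) powr - (33 / 32)"
      using norm_main_term_le[OF \<tau> c, of 1 1 w] nY_pos[OF \<tau> a_pos c, of w] by simp
    finally show "cmod (f w) \<le> nA a \<tau> powr 1 * real c powr - (27 / 32) * (1 + real_of_int \<bar>w\<bar>) powr - (33 / 32)" .
  qed
  moreover have nm: "nmain \<psi> a \<tau> c 1 = infsum f UNIV"
    unfolding nmain_def f_def using nY_pos[OF \<tau> a_pos c] by (intro infsum_cong) simp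
  ultimately have "(f has_sum nmain \<psi> a \<tau> c 1) UNIV" by simp
  also have "?this \<longleftrightarrow> ((\<lambda>(v, m). f (v + int c * m)) has_sum nmain \<psi> a \<tau> c 1) ({0..<int c} \<times> UNIV)"
    using c by (intro has_sum_reindex_bij_witness[of _ "\<lambda>(v, m). v + int c * m" "\<lambda>w. (w mod int c, w div int c)"]) auto
  finally have 1: "((\<lambda>(v, m). f (v + int c * m)) has_sum nmain \<psi> a \<tau> c 1) ({0..<int c} \<times> UNIV)" .
  have 2: "((\<lambda>m. f (v + int c * m)) has_sum (\<psi> c v * of_real (K * R v))) UNIV" for v
  proof -
    have "((\<lambda>m. \<psi> c v * of_real (a / (real c)\<^sup>2 * (Im (Z v) / (cmod (Z v + of_int m))\<^sup>2))) has_sum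
        (\<psi> c v * of_real (a / (real c)\<^sup>2 * (pi * R v)))) UNIV"
      unfolding R_def by (intro has_sum_cmult_right has_sum_of_real poisson_kernel) (use \<tau> ImZ in auto)
    also have "(\<lambda>m. \<psi> c v * of_real (a / (real c)\<^sup>2 * (Im (Z v) / (cmod (Z v + of_int m))\<^sup>2))) = (\<lambda>m. f (v + int c * m))"
    proof
      fix m
      have "of_nat c * \<tau> + of_int (v + int c * m) = of_nat c * (Z v + of_int m)"
        using c by (simp add: Z_def field_simps)
      hence "cmod (of_nat c * \<tau> + of_int (v + int c * m)) = real c * cmod (Z v + of_int m)"
        by (simp add: norm_mult)
      thus "\<psi> c v * of_real (a / (real c)\<^sup>2 * (Im (Z v) / (cmod (Z v + of_int m))\<^sup>2)) = f (v + int c * m)"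
        by (simp add: f_def nY_def periodic_int[OF c] ImZ power_mult_distrib)
    qed
    finally show ?thesis by (simp add: K_def mult_ac)
  qed
  have "((\<lambda>v. \<psi> c v * of_real (K * R v)) has_sum nmain \<psi> a \<tau> c 1) {0..<int c}"
    by (rule has_sum_SigmaD[OF 1]) (use 2 in auto)
  hence 3: "nmain \<psi> a \<tau> c 1 = (\<Sum>v\<in>{0..<int c}. \<psi> c v * of_real (K * R v))"
    by (metis finite_atLeastLessThan_int has_sum_finite has_sum_unique)
  have "((\<lambda>l. \<Sum>v\<in>{0..<int c}. \<psi> c v * of_real K * qe (Z v) l) has_sum
      (\<Sum>v\<in>{0..<int c}. \<psi> c v * of_real K * of_real (R v))) UNIV"
    unfolding R_def by (intro has_sum_finite_sum has_sum_cmult_right has_sum_qe) (use \<tau> ImZ in auto)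
  also have "(\<Sum>v\<in>{0..<int c}. \<psi> c v * of_real K * of_real (R v)) = nmain \<psi> a \<tau> c 1"
    by (simp add: 3 mult.assoc)
  also have "(\<lambda>l. \<Sum>v\<in>{0..<int c}. \<psi> c v * of_real K * qe (Z v) l) =
      (\<lambda>l. of_real K * fourier_weight c l * qe \<tau> l)"
    using c by (auto simp: fun_eq_iff Z_def qe_shift fourier_weight_def sum_distrib_left sum_distrib_right mult_ac)
  finally show ?thesis by (simp add: K_def)
qed

text \<open>Once expanded, the cancellation sits inside \<open>fourier_weight\<close>, whose bound
  does not depend on l. The double series over (c, l) therefore converges absolutely, and the sums
  may be exchanged.\<close>

lemma sum_nmain_1:
  assumes \<tau>: "Im \<tau> > 0"
  shows "((\<lambda>l. (\<Sum>\<^sub>\<infinity>c\<in>{1..}. of_real (pi * a / (real c)\<^sup>2) * fourier_weight c l) * qe \<tau> l) has_sum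
    (\<Sum>\<^sub>\<infinity>c\<in>{1..}. nmain \<psi> a \<tau> c 1)) UNIV"
proof -
  define T where "T = (\<lambda>(c::nat, l). of_real (pi * a / (real c)\<^sup>2) * fourier_weight c l * qe \<tau> l)"
  have bd: "cmod (of_real (pi * a / (real c)\<^sup>2) * fourier_weight c l) \<le> pi * a * (\<kappa> c * real c powr - (29 / 16))"
    if c: "c \<ge> 1" for c l
  proof -
    have "cmod (of_real (pi * a / (real c)\<^sup>2) * fourier_weight c l) = pi * a / (real c)\<^sup>2 * cmod (fourier_weight c l)"
      using a_pos by (simp add: norm_mult del: of_real_divide)
    also have "\<dots> \<le> pi * a / (real c)\<^sup>2 * \<kappa> c"
      unfolding fourier_weight_def using a_pos by (intro mult_left_mono cancel c) auto
    also have "\<dots> = pi * a * (\<kappa> c * real c powr - 2)"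
      using c by (simp add: powr_minus field_simps)
    also have "\<dots> \<le> pi * a * (\<kappa> c * real c powr - (29 / 16))"
      using a_pos c by (intro mult_left_mono powr_mono \<kappa>_nonneg) auto
    finally show ?thesis .
  qed
  have "(\<lambda>(c, l). pi * a * (\<kappa> c * real c powr - (29 / 16)) * cmod (qe \<tau> l)) summable_on {1..} \<times> UNIV"
  proof (rule summable_on_real_times)
    show "(\<lambda>c. pi * a * (\<kappa> c * real c powr - (29 / 16))) summable_on {1..}"
      by (intro summable_on_cmult_right summable_on_\<kappa>)
  qed (use has_sum_qe(2)[OF \<tau>] a_pos \<kappa>_nonneg in auto)
  hence "(\<lambda>x. norm (T x)) summable_on {1..} \<times> UNIV"
  proof (rule Infinite_Sum.abs_summable_on_comparison_test')
    fix x :: "nat \<times> int" assume "x \<in> {1..} \<times> UNIV"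
    then obtain c l where x: "x = (c, l)" "c \<ge> 1" by auto
    show "cmod (T x) \<le> (case x of (c, l) \<Rightarrow> pi * a * (\<kappa> c * real c powr - (29 / 16)) * cmod (qe \<tau> l))"
      unfolding T_def x prod.case norm_mult[of _ "qe \<tau> l"] by (intro mult_right_mono bd x) auto
  qed
  hence T: "T summable_on {1..} \<times> UNIV" by (rule abs_summable_summable)
  have "(T has_sum (\<Sum>\<^sub>\<infinity>c\<in>{1..}. nmain \<psi> a \<tau> c 1)) ({1..} \<times> UNIV)"
  proof (rule has_sum_SigmaI[OF _ _ T])
    show "((\<lambda>l. T (c, l)) has_sum nmain \<psi> a \<tau> c 1) UNIV" if "c \<in> {1..}" for c
      using nmain_1[OF \<tau>, of c] that by (simp add: T_def)
    show "((\<lambda>c. nmain \<psi> a \<tau> c 1) has_sum (\<Sum>\<^sub>\<infinity>c\<in>{1..}. nmain \<psi> a \<tau> c 1)) {1..}"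
      by (intro has_sum_infsum summable_on_nmain \<tau>) auto
  qed
  hence S: "((\<lambda>(l, c). T (c, l)) has_sum (\<Sum>\<^sub>\<infinity>c\<in>{1..}. nmain \<psi> a \<tau> c 1)) (UNIV \<times> {1..})"
    by (subst has_sum_reindex_bij_witness[of "UNIV \<times> {1..}" prod.swap prod.swap "{1..} \<times> UNIV" T _ _ "\<Sum>\<^sub>\<infinity>c\<in>{1..}. nmain \<psi> a \<tau> c 1"]) auto
  show ?thesis
  proof (rule has_sum_SigmaD[OF S])
    fix l :: int
    have "(\<lambda>c. of_real (pi * a / (real c)\<^sup>2) * fourier_weight c l) summable_on {1..}"
      by (rule abs_summable_summable, rule Infinite_Sum.abs_summable_on_comparison_test'[OF summable_on_cmult_right[OF summable_on_\<kappa>] bd]) auto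
    thus "((\<lambda>c. (\<lambda>(l, c). T (c, l)) (l, c)) has_sum
      ((\<Sum>\<^sub>\<infinity>c\<in>{1..}. of_real (pi * a / (real c)\<^sup>2) * fourier_weight c l) * qe \<tau> l)) {1..}"
      unfolding T_def prod.case by (intro has_sum_cmult_left has_sum_infsum)
  qed
qed

text \<open>Since Im U = -Y, the product of e(Re U) with the two exponentials of sinh (2 pi Y) is
  e(U) and e(cnj U), one holomorphic and one antiholomorphic in \<tau>; the value
  \<open>bes0 1\<close> = 2 supplies exactly the linear terms.\<close>

lemma nerr_1:
  assumes "Im \<tau> > 0" "c \<ge> 1"
  shows "2 * of_real pi * nerr \<psi> a \<tau> (c, w) 1 =
     \<psi> c w * neps (nU a \<tau> c w) - cnj (cnj (\<psi> c w) * neps (nU (- a) \<tau> c w))"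
proof -
  define U where "U = nU a \<tau> c w"
  define Y where "Y = nY a \<tau> c w"
  have Y: "Y > 0" "Im U = - Y" using nY_pos[OF assms(1) a_pos assms(2)] Im_nU[OF assms(1) a_pos assms(2)]
    by (auto simp: Y_def U_def)
  have U': "nU (- a) \<tau> c w = - U" by (simp add: U_def nU_def)
  have e1: "exp (2 * of_real pi * \<i> * U) = ee (Re U) * of_real (exp (2 * pi * Y))"
   and e2: "exp (2 * of_real pi * \<i> * cnj U) = ee (Re U) * of_real (exp (- (2 * pi * Y)))"
  proof -
    have "2 * of_real pi * \<i> * U = 2 * of_real pi * \<i> * of_real (Re U) + of_real (2 * pi * Y)"
      "2 * of_real pi * \<i> * cnj U = 2 * of_real pi * \<i> * of_real (Re U) + of_real (- (2 * pi * Y))"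
      by (simp_all add: complex_eq_iff Y)
    thus "exp (2 * of_real pi * \<i> * U) = ee (Re U) * of_real (exp (2 * pi * Y))"
      "exp (2 * of_real pi * \<i> * cnj U) = ee (Re U) * of_real (exp (- (2 * pi * Y)))"
      by (simp_all only: exp_add ee_def exp_of_real)
  qed
  have d: "2 * of_real pi * \<i> * U - 2 * of_real pi * \<i> * cnj U = of_real (4 * pi * Y)"
    by (simp add: complex_eq_iff Y)
  have "neps U - neps (cnj U) = exp (2 * of_real pi * \<i> * U) - exp (2 * of_real pi * \<i> * cnj U)
      - (2 * of_real pi * \<i> * U - 2 * of_real pi * \<i> * cnj U)"
    by (simp add: neps_def)
  also have "\<dots> = ee (Re U) * of_real (2 * sinh (2 * pi * Y)) - of_real (4 * pi * Y)"
    unfolding e1 e2 d by (simp add: sinh_def algebra_simps)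
  also have "of_real (2 * sinh (2 * pi * Y)) = 2 * of_real pi * (complex_of_real Y * bes 1 Y)"
    unfolding bes_1[OF Y(1)] by simp
  finally have E: "neps U - neps (cnj U) = 2 * of_real pi * ((ee (Re U) * bes 1 Y - bes0 1) * of_real Y)"
    by (simp add: bes0_1 algebra_simps)
  have C: "cnj (cnj (\<psi> c w) * neps (- U)) = \<psi> c w * neps (cnj U)"
    by (simp only: complex_cnj_mult complex_cnj_cnj neps_cnj)
  have "2 * of_real pi * nerr \<psi> a \<tau> (c, w) 1 =
     \<psi> c w * (2 * of_real pi * ((ee (Re U) * bes 1 Y - bes0 1) * of_real Y))"
    using Y(1) by (simp add: nerr_def flip: U_def Y_def)
  also have "\<dots> = \<psi> c w * neps U - cnj (cnj (\<psi> c w) * neps (nU (- a) \<tau> c w))"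
    by (simp only: E [symmetric] C U' right_diff_distrib)
  finally show ?thesis by (simp add: U_def)
qed

text \<open>At \<open>s = 1\<close> the error terms are \<open>neps U - neps (cnj U)\<close>, and the main terms are Poisson kernels in
  \<open>\<tau> + w / c\<close>.\<close>

lemma ncont_1_expansion:
  obtains k :: "int \<Rightarrow> complex" where
    "\<And>\<tau>. Im \<tau> > 0 \<Longrightarrow> ((\<lambda>l. k l * qe \<tau> l) has_sum (2 * of_real pi * ncont \<psi> a \<tau> 1)) UNIV"
proof -
  have a0: "a \<noteq> 0" "- a \<noteq> 0" using a_pos by auto
  obtain \<alpha> where \<alpha>: "\<And>\<tau>. Im \<tau> > 0 \<Longrightarrow> ((\<lambda>l::nat. \<alpha> l * qq \<tau> ^ l) has_sum
    (\<Sum>\<^sub>\<infinity>(c, w)\<in>cw_index. \<psi> c w * neps (nU a \<tau> c w))) UNIV"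
    and s\<alpha>: "\<And>\<tau>. Im \<tau> > 0 \<Longrightarrow> (\<lambda>(c, w). \<psi> c w * neps (nU a \<tau> c w)) summable_on cw_index"
    using neps_series_expansion[of a \<psi>, OF a0(1) norm_le_1 periodic] by auto
  have "\<exists>\<beta>. \<forall>\<tau>. Im \<tau> > 0 \<longrightarrow>
    ((\<lambda>l::nat. \<beta> l * qq \<tau> ^ l) has_sum (\<Sum>\<^sub>\<infinity>(c, w)\<in>cw_index. cnj (\<psi> c w) * neps (nU (- a) \<tau> c w))) UNIV \<and>
    (\<lambda>(c, w). cnj (\<psi> c w) * neps (nU (- a) \<tau> c w)) summable_on cw_index"
    by (rule neps_series_expansion) (use a0 norm_le_1 periodic in auto)
  then obtain \<beta> where \<beta>: "\<And>\<tau>. Im \<tau> > 0 \<Longrightarrow> ((\<lambda>l::nat. \<beta> l * qq \<tau> ^ l) has_sum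
    (\<Sum>\<^sub>\<infinity>(c, w)\<in>cw_index. cnj (\<psi> c w) * neps (nU (- a) \<tau> c w))) UNIV"
    and s\<beta>: "\<And>\<tau>. Im \<tau> > 0 \<Longrightarrow> (\<lambda>(c, w). cnj (\<psi> c w) * neps (nU (- a) \<tau> c w)) summable_on cw_index"
    by blast
  \<comment> \<open>Both power series have a constant term, so l = 0 receives a contribution from
    each of them.\<close>
  define k where "k = (\<lambda>l::int. (if l \<ge> 0 then \<alpha> (nat l) else 0) - (if l \<le> 0 then cnj (\<beta> (nat (- l))) else 0)
     + 4 * of_real pi * (\<Sum>\<^sub>\<infinity>c\<in>{1..}. of_real (pi * a / (real c)\<^sup>2) * fourier_weight c l))"
  have "((\<lambda>l. k l * qe \<tau> l) has_sum (2 * of_real pi * ncont \<psi> a \<tau> 1)) UNIV" if \<tau>: "Im \<tau> > 0" for \<tau>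
  proof -
    define P where "P = (\<Sum>\<^sub>\<infinity>(c, w)\<in>cw_index. \<psi> c w * neps (nU a \<tau> c w))"
    define Q where "Q = (\<Sum>\<^sub>\<infinity>(c, w)\<in>cw_index. cnj (\<psi> c w) * neps (nU (- a) \<tau> c w))"
    define S where "S = (\<Sum>\<^sub>\<infinity>c\<in>{1..}. nmain \<psi> a \<tau> c 1)"
    have "((\<lambda>x. (case x of (c, w) \<Rightarrow> \<psi> c w * neps (nU a \<tau> c w)) -
        cnj (case x of (c, w) \<Rightarrow> cnj (\<psi> c w) * neps (nU (- a) \<tau> c w))) has_sum (P - cnj Q)) cw_index"
      unfolding P_def Q_def by (intro has_sum_diff has_sum_infsum s\<alpha> s\<beta> \<tau> has_sum_cnj_iff[THEN iffD2])
    also have "?this \<longleftrightarrow> ((\<lambda>x. 2 * of_real pi * nerr \<psi> a \<tau> x 1) has_sum (P - cnj Q)) cw_index"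
      by (rule has_sum_cong) (auto simp: cw_index_def nerr_1[OF \<tau>])
    finally have "((\<lambda>x. 2 * of_real pi * nerr \<psi> a \<tau> x 1) has_sum (P - cnj Q)) cw_index" .
    moreover have "((\<lambda>x. 2 * of_real pi * nerr \<psi> a \<tau> x 1) has_sum (2 * of_real pi * (\<Sum>\<^sub>\<infinity>x\<in>cw_index. nerr \<psi> a \<tau> x 1))) cw_index"
      by (intro has_sum_cmult_right has_sum_infsum summable_on_nerr \<tau>) auto
    ultimately have "2 * of_real pi * (\<Sum>\<^sub>\<infinity>x\<in>cw_index. nerr \<psi> a \<tau> x 1) = P - cnj Q"
      using has_sum_unique by blast
    hence nc: "2 * of_real pi * ncont \<psi> a \<tau> 1 = P - cnj Q + 4 * of_real pi * S"
      by (simp add: ncont_def bes0_1 S_def algebra_simps)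
    have "((\<lambda>l. (if l \<ge> 0 then \<alpha> (nat l) else 0) * qe \<tau> l) has_sum (P + 0)) UNIV"
    proof (rule has_sum_int_split)
      show "((\<lambda>n. (if int n \<ge> 0 then \<alpha> (nat (int n)) else 0) * qe \<tau> (int n)) has_sum P) UNIV"
        using \<alpha>[OF \<tau>] by (simp add: P_def qe_def)
      show "((\<lambda>n. (if - int n \<ge> 0 then \<alpha> (nat (- int n)) else 0) * qe \<tau> (- int n)) has_sum 0) {1..}"
        by (rule has_sum_0) auto
    qed
    hence 1: "((\<lambda>l. (if l \<ge> 0 then \<alpha> (nat l) else 0) * qe \<tau> l) has_sum P) UNIV" by simp
    have "((\<lambda>l. (if l \<ge> 0 then \<beta> (nat l) else 0) * qe \<tau> l) has_sum (Q + 0)) UNIV"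
    proof (rule has_sum_int_split)
      show "((\<lambda>n. (if int n \<ge> 0 then \<beta> (nat (int n)) else 0) * qe \<tau> (int n)) has_sum Q) UNIV"
        using \<beta>[OF \<tau>] by (simp add: Q_def qe_def)
      show "((\<lambda>n. (if - int n \<ge> 0 then \<beta> (nat (- int n)) else 0) * qe \<tau> (- int n)) has_sum 0) {1..}"
        by (rule has_sum_0) auto
    qed
    hence "((\<lambda>l. cnj ((if l \<ge> 0 then \<beta> (nat l) else 0) * qe \<tau> l)) has_sum cnj Q) UNIV"
      unfolding add_0_right by (rule has_sum_cnj_iff[THEN iffD2])
    also have "?this \<longleftrightarrow> ((\<lambda>l. (if l \<le> 0 then cnj (\<beta> (nat (- l))) else 0) * qe \<tau> l) has_sum cnj Q) UNIV"
      by (rule has_sum_reindex_bij_witness[of _ uminus uminus]) (auto simp: qe_def)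
    finally have 2: "((\<lambda>l. (if l \<le> 0 then cnj (\<beta> (nat (- l))) else 0) * qe \<tau> l) has_sum cnj Q) UNIV" .
    have "((\<lambda>l. ((if l \<ge> 0 then \<alpha> (nat l) else 0) * qe \<tau> l - (if l \<le> 0 then cnj (\<beta> (nat (- l))) else 0) * qe \<tau> l)
       + 4 * of_real pi * ((\<Sum>\<^sub>\<infinity>c\<in>{1..}. of_real (pi * a / (real c)\<^sup>2) * fourier_weight c l) * qe \<tau> l)) has_sum
        (P - cnj Q + 4 * of_real pi * S)) UNIV"
      unfolding S_def by (intro has_sum_add has_sum_diff 1 2 has_sum_cmult_right sum_nmain_1 \<tau>)
    thus ?thesis unfolding nc k_def by (simp only: ring_distribs mult.assoc)
  qed
  thus ?thesis by (rule that)
qed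

end

section \<open>Atkin--Lehner cosets\<close>

text \<open>The matrix \<open>(Q x, y; N z, Q w)\<close> is recorded as \<open>(x, y, c, w)\<close> with \<open>c = (N / Q) z\<close>. A coset of
  \<open>\<Gamma>\<^sub>\<infinity>\<close> is determined by \<open>(c, w)\<close> up to sign, and \<open>al_lift\<close> completes such a pair to a matrix; the
  parameter \<open>M\<close> stands for \<open>N / Q\<close>.\<close>

definition al_index :: "nat \<Rightarrow> nat \<Rightarrow> (int \<times> int) set" where
  "al_index Q M = {(c, w). (c > 0 \<or> c = 0 \<and> w > 0) \<and> int M dvd c \<and> coprime (int Q * w) c}"

definition al_point :: "nat \<Rightarrow> int \<times> int \<times> int \<times> int \<Rightarrow> complex \<Rightarrow> complex" where
  "al_point Q = (\<lambda>(x, y, c, d) \<tau>. (of_nat Q * of_int x * \<tau> + of_int y) / (of_nat Q * (of_int c * \<tau> + of_int d)))"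

definition al_lift :: "nat \<Rightarrow> int \<times> int \<Rightarrow> int \<times> int \<times> int \<times> int" where
  "al_lift Q = (\<lambda>(c, w). SOME (x, y, c', w'). c' = c \<and> w' = w \<and> int Q * x * w - y * c = 1)"

definition al_sum :: "nat \<Rightarrow> nat \<Rightarrow> (complex \<Rightarrow> complex) \<Rightarrow> complex \<Rightarrow> complex" where
  "al_sum Q M f \<tau> = (\<Sum>\<^sub>\<infinity>x\<in>al_index Q M. f (al_point Q (al_lift Q x) \<tau>))"

lemma al_liftE:
  assumes "coprime (int Q * w) c"
  obtains x y where "al_lift Q (c, w) = (x, y, c, w)" "int Q * x * w - y * c = 1"
proof -
  obtain x y where "x * (int Q * w) + y * c = 1"
    using assms bezout_int[of "int Q * w" c] by (auto simp: coprime_iff_gcd_eq_1)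
  hence "int Q * x * w - (- y) * c = 1" by (simp add: algebra_simps)
  hence "\<exists>t. case t of (x, y, c', w') \<Rightarrow> c' = c \<and> w' = w \<and> int Q * x * w - y * c = 1"
    by (intro exI[of _ "(x, - y, c, w)"]) simp
  from someI_ex[OF this] show ?thesis
    using that unfolding al_lift_def by (auto split: prod.splits)
qed

text \<open>The determinant relation gives Q w x = 1 modulo c, so the modular inverse stands for the
  entry x and the weight is e(-n x / c). It is 0 if (c, w) is not the lower row of a matrix in the
  coset.\<close>

definition al_weight :: "nat \<Rightarrow> nat \<Rightarrow> nat \<Rightarrow> nat \<Rightarrow> int \<Rightarrow> complex" where
  "al_weight Q M n c w = (if int M dvd int c \<and> coprime (int Q * w) (int c)
     then ec c (- (int n * modular_inverse (int c) (int Q * w))) else 0)"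

text \<open>If Q is prime to c, the complete sums are K(m, -n / Q), with -1 / Q as the unit q of
  \<open>kloosterman_bound\<close>; otherwise the weight vanishes. The series over c converges
  because 29/16 - 3/4 = 17/16 exceeds 1.\<close>

lemma al_weight_niebur_weight:
  assumes "Q \<ge> 1" "n \<ge> 1"
  shows "niebur_weight (al_weight Q M n) (\<lambda>c. 4 * real n * real c powr (3 / 4) * real (ndiv c)) (real n / real Q)"
proof
  show "real n / real Q > 0" using assms by simp
next
  fix c w assume c: "c \<ge> (1::nat)"
  have "[int Q * (w + int c) = int Q * w] (mod int c)" by (simp add: cong_iff_dvd_diff algebra_simps)
  hence 1: "coprime (int Q * (w + int c)) (int c) \<longleftrightarrow> coprime (int Q * w) (int c)"
    by (meson cong_imp_coprime cong_sym)
  have "modular_inverse (int c) (int Q * (w + int c)) = modular_inverse (int c) (int Q * w)"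
    if cop: "coprime (int Q * w) (int c)"
  proof (rule modular_inverse_int_eqI)
    show "modular_inverse (int c) (int Q * w) \<in> {0..<int c}"
      using c by (simp add: modular_inverse_int_nonneg modular_inverse_int_less)
    have "[int Q * (w + int c) * modular_inverse (int c) (int Q * w) = int Q * w * modular_inverse (int c) (int Q * w)] (mod int c)"
      by (rule cong_mult[OF \<open>[int Q * (w + int c) = int Q * w] (mod int c)\<close> cong_refl])
    also have "[int Q * w * modular_inverse (int c) (int Q * w) = 1] (mod int c)"
      by (rule cong_modular_inverse1[OF cop])
    finally show "[int Q * (w + int c) * modular_inverse (int c) (int Q * w) = 1] (mod int c)" .
  qed
  thus "al_weight Q M n c (w + int c) = al_weight Q M n c w"
    unfolding al_weight_def 1 by auto
next
  show "cmod (al_weight Q M n c w) \<le> 1" for c w by (simp add: al_weight_def)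
next
  fix c m assume c: "c \<ge> (1::nat)"
  show "cmod (\<Sum>v\<in>{0..<int c}. al_weight Q M n c v * ec c (m * v)) \<le> 4 * real n * real c powr (3 / 4) * real (ndiv c)"
  proof (cases "int M dvd int c \<and> coprime (int Q) (int c)")
    case False
    hence "al_weight Q M n c v = 0" for v by (auto simp: al_weight_def)
    thus ?thesis by simp
  next
    case True
    define q where "q = - modular_inverse (int c) (int Q)"
    have "(\<Sum>v\<in>{0..<int c}. al_weight Q M n c v * ec c (m * v)) = kloosterman c m (int n * q)"
      unfolding kloosterman_def
    proof (rule sum.mono_neutral_cong_right)
      show "runits c \<subseteq> {0..<int c}" by (auto simp: runits_def)
      show "\<forall>i\<in>{0..<int c} - runits c. al_weight Q M n c i * ec c (m * i) = 0"
        by (auto simp: al_weight_def runits_def)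
      fix v assume "v \<in> runits c"
      hence v: "coprime v (int c)" by (simp add: runits_def)
      have "modular_inverse (int c) (int Q * v) = (modular_inverse (int c) v * modular_inverse (int c) (int Q)) mod int c"
        using True v c by (intro modular_inverse_int_mult) auto
      hence "[modular_inverse (int c) (int Q * v) = - q * modular_inverse (int c) v] (mod int c)"
        by (simp add: q_def cong_def mult.commute)
      from cong_mult[OF cong_refl[of "- int n"] this]
      have "[- (int n * modular_inverse (int c) (int Q * v)) = int n * q * modular_inverse (int c) v] (mod int c)"
        by (simp add: mult.assoc)
      hence "ec c (- (int n * modular_inverse (int c) (int Q * v))) = ec c (int n * q * modular_inverse (int c) v)"
        using c by (intro ec_cong) auto
      thus "al_weight Q M n c v * ec c (m * v) = ec c (m * v + int n * q * modular_inverse (int c) v)"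
        using True v by (simp add: al_weight_def ec_add)
    qed auto
    also have "cmod \<dots> \<le> 4 * real n * real c powr (3 / 4) * real (ndiv c)"
      using c True assms by (intro kloosterman_bound) (auto simp: q_def)
    finally show ?thesis .
  qed
next
  have "summable (\<lambda>c. 4 * real n * (real (ndiv c) * real c powr - (17 / 16)))"
    by (intro summable_mult ndiv_powr_summable) auto
  also have "(\<lambda>c. 4 * real n * (real (ndiv c) * real c powr - (17 / 16))) =
    (\<lambda>c. 4 * real n * real c powr (3 / 4) * real (ndiv c) * real c powr - (29 / 16))"
  proof
    fix c :: nat
    have "real c powr - (17 / 16) = real c powr (3 / 4) * real c powr - (29 / 16)"
      by (subst powr_add [symmetric]) simp
    thus "4 * real n * (real (ndiv c) * real c powr - (17 / 16)) =
      4 * real n * real c powr (3 / 4) * real (ndiv c) * real c powr - (29 / 16)" by simp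
  qed
  finally show "summable (\<lambda>c. 4 * real n * real c powr (3 / 4) * real (ndiv c) * real c powr - (29 / 16))" .
qed

lemma niebur_f_shift: "niebur_f n s (z + of_int k) = niebur_f n s z"
proof -
  have "ee (- real n * Re (z + of_int k)) = ee (- real n * Re z) * ee (of_int (- int n * k))"
    by (subst ee_add [symmetric]) (simp add: algebra_simps)
  hence "ee (- real n * Re (z + of_int k)) = ee (- real n * Re z)"
    by (simp only: ee_of_int mult_1_right)
  thus ?thesis by (simp add: niebur_f_def)
qed

lemma niebur_f_al_point:
  assumes Q: "Q \<ge> 1" and c: "c \<ge> 1" and \<tau>: "Im \<tau> > 0" and M: "int M dvd int c"
    and cop: "coprime (int Q * w) (int c)"
  shows "niebur_f n s (al_point Q (al_lift Q (int c, w)) \<tau>) = nterm (al_weight Q M n) (real n / real Q) \<tau> s (c, w)"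
proof -
  obtain x y where xy: "al_lift Q (int c, w) = (x, y, int c, w)" "int Q * x * w - y * int c = 1"
    by (rule al_liftE[OF cop])
  define z where "z = al_point Q (x, y, int c, w) \<tau>"
  define U where "U = nU (real n / real Q) \<tau> c w"
  have nz: "of_nat c * \<tau> + of_int w \<noteq> 0" using lattice_bound'(2)[OF \<tau>, of 1 c w] c by auto
  have nz': "complex_of_nat c \<noteq> 0" "complex_of_nat Q \<noteq> 0" using c Q by auto
  have det: "of_nat Q * of_int x * of_int w - of_int y * of_nat c = (1 :: complex)"
    using arg_cong[OF xy(2), of "complex_of_int"] by simp
  have "z = of_int x / of_nat c - 1 / (of_nat Q * of_nat c * (of_nat c * \<tau> + of_int w))"
  proof -
    have "of_nat c * (of_nat Q * of_int x * \<tau> + of_int y) =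
      of_nat Q * of_int x * (of_nat c * \<tau> + of_int w) - (of_nat Q * of_int x * of_int w - of_int y * of_nat c)"
      by (simp add: algebra_simps)
    hence *: "of_nat c * (of_nat Q * of_int x * \<tau> + of_int y) = of_nat Q * of_int x * (of_nat c * \<tau> + of_int w) - 1"
      unfolding det .
    have "z = of_nat c * (of_nat Q * of_int x * \<tau> + of_int y) / (of_nat Q * of_nat c * (of_nat c * \<tau> + of_int w))"
      using nz' by (simp add: z_def al_point_def)
    also have "\<dots> = of_int x / of_nat c - 1 / (of_nat Q * of_nat c * (of_nat c * \<tau> + of_int w))"
      unfolding * diff_divide_distrib using nz nz' by simp
    finally show ?thesis .
  qed
  hence "of_nat n * z = of_nat n * (of_int x / of_nat c - 1 / (of_nat Q * of_nat c * (of_nat c * \<tau> + of_int w)))"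
    by simp
  also have "\<dots> = of_real (real n * of_int x / real c) - U"
    by (simp add: U_def nU_def right_diff_distrib mult_ac)
  finally have nz_eq: "of_nat n * z = of_real (real n * of_int x / real c) - U" .
  have Re: "real n * Re z = real n * of_int x / real c - Re U"
    using arg_cong[OF nz_eq, of Re] by simp
  have Im: "real n * Im z = nY (real n / real Q) \<tau> c w"
  proof (cases "n = 0")
    case False
    have "real n * Im z = - Im U" using arg_cong[OF nz_eq, of Im] by simp
    also have "Im U = - nY (real n / real Q) \<tau> c w"
      unfolding U_def using False Q c \<tau> by (intro Im_nU) auto
    finally show ?thesis by simp
  qed (simp add: nY_def)
  have "ee (- real n * Re z) = ee (of_int (- (int n * x)) / real c) * ee (Re U)"
  proof -
    have "- real n * Re z = of_int (- (int n * x)) / real c + Re U" using Re by simp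
    thus ?thesis by (simp only: ee_add)
  qed
  also have "ee (of_int (- (int n * x)) / real c) = al_weight Q M n c w"
  proof -
    have "[(int Q * w) * x = 1] (mod int c)"
      using xy(2) by (simp add: cong_iff_dvd_diff) (metis add_diff_cancel_left' diff_add_cancel dvd_triv_right mult.assoc mult.commute)
    moreover have "[(int Q * w) * modular_inverse (int c) (int Q * w) = 1] (mod int c)"
      by (rule cong_modular_inverse1[OF cop])
    ultimately have "[(int Q * w) * x = (int Q * w) * modular_inverse (int c) (int Q * w)] (mod int c)"
      using cong_sym cong_trans by blast
    hence "[x = modular_inverse (int c) (int Q * w)] (mod int c)"
      using cop by (simp add: cong_mult_lcancel)
    from cong_mult[OF cong_refl[of "- int n"] this]
    have "[- (int n * x) = - (int n * modular_inverse (int c) (int Q * w))] (mod int c)" by simp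
    hence "ec c (- (int n * x)) = ec c (- (int n * modular_inverse (int c) (int Q * w)))"
      using c by (intro ec_cong) auto
    thus ?thesis using cop M by (simp add: al_weight_def ec_def)
  qed
  finally have "ee (- real n * Re z) = al_weight Q M n c w * ee (Re U)" .
  thus ?thesis
    unfolding niebur_f_def nterm_def xy(1) z_def[symmetric] prod.case U_def[symmetric]
    by (simp add: Im mult.assoc)
qed

text \<open>A row with c = 0 forces Q w to be a unit, so it exists only for Q = 1, as (0, 1). It is
  the identity coset and contributes the term f_n(\<tau>).\<close>

lemma has_sum_al:
  assumes Q: "Q \<ge> 1" and n: "n \<ge> 1" and \<tau>: "Im \<tau> > 0" and s: "Re s > 1"
  shows "((\<lambda>x. niebur_f n s (al_point Q (al_lift Q x) \<tau>)) has_sum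
    ((if Q = 1 then niebur_f n s \<tau> else 0) + ncont (al_weight Q M n) (real n / real Q) \<tau> s)) (al_index Q M)"
proof -
  interpret niebur_weight "al_weight Q M n" "\<lambda>c. 4 * real n * real c powr (3 / 4) * real (ndiv c)" "real n / real Q"
    by (rule al_weight_niebur_weight[OF Q n])
  define F where "F = (\<lambda>x. niebur_f n s (al_point Q (al_lift Q x) \<tau>))"
  define I0 where "I0 = (if Q = 1 then {(0, 1)} else ({} :: (int \<times> int) set))"
  define I1 where "I1 = {(c, w). c > 0 \<and> int M dvd c \<and> coprime (int Q * w) c}"
  have I: "al_index Q M = I0 \<union> I1" "I0 \<inter> I1 = {}"
    by (auto simp: al_index_def I0_def I1_def zmult_eq_1_iff split: if_splits)
  have "(F has_sum (if Q = 1 then niebur_f n s \<tau> else 0)) I0"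
  proof (cases "Q = 1")
    case True
    have "coprime (int Q * 1) 0" using True by simp
    then obtain x y where xy: "al_lift Q (0, 1) = (x, y, 0, 1)" "int Q * x * 1 - y * 0 = 1"
      by (rule al_liftE)
    have "F (0, 1) = niebur_f n s (\<tau> + of_int y)"
      using xy True by (simp add: F_def al_point_def)
    thus ?thesis using True by (simp add: I0_def niebur_f_shift has_sum_finiteI)
  qed (simp add: I0_def)
  moreover have "(F has_sum ncont (al_weight Q M n) (real n / real Q) \<tau> s) I1"
  proof -
    define J where "J = {(c, w). c \<ge> 1 \<and> int M dvd int c \<and> coprime (int Q * w) (int c)}"
    have "(nterm (al_weight Q M n) (real n / real Q) \<tau> s has_sum ncont (al_weight Q M n) (real n / real Q) \<tau> s) cw_index"
      by (rule has_sum_ncont[OF \<tau> s])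
    also have "?this \<longleftrightarrow> (nterm (al_weight Q M n) (real n / real Q) \<tau> s has_sum ncont (al_weight Q M n) (real n / real Q) \<tau> s) J"
      by (rule has_sum_cong_neutral) (auto simp: cw_index_def J_def nterm_def al_weight_def split: if_splits)
    also have "\<dots> \<longleftrightarrow> (F has_sum ncont (al_weight Q M n) (real n / real Q) \<tau> s) I1"
      by (rule has_sum_reindex_bij_witness[of _ "\<lambda>(c, w). (nat c, w)" "\<lambda>(c, w). (int c, w)"])
         (auto simp: J_def I1_def F_def niebur_f_al_point[OF Q _ \<tau>] simp del: int_dvd_int_iff coprime_int_iff)
    finally show ?thesis .
  qed
  ultimately show ?thesis unfolding I(1) F_def[symmetric] by (rule has_sum_Un_disjoint[OF _ _ I(2)])
qed

section \<open>Atkin-Lehner matrices in SL2(R)\<close>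

lemma mat2_nth [simp]:
  "(mat2 a b c d :: real ^ 2 ^ 2) $ 1 $ 1 = a" "(mat2 a b c d :: real ^ 2 ^ 2) $ 1 $ 2 = b"
  "(mat2 a b c d :: real ^ 2 ^ 2) $ 2 $ 1 = c" "(mat2 a b c d :: real ^ 2 ^ 2) $ 2 $ 2 = d"
  by (simp_all add: mat2_def)

lemma mat2_eqI:
  fixes A B :: "real ^ 2 ^ 2"
  assumes "A $ 1 $ 1 = B $ 1 $ 1" "A $ 1 $ 2 = B $ 1 $ 2" "A $ 2 $ 1 = B $ 2 $ 1" "A $ 2 $ 2 = B $ 2 $ 2"
  shows "A = B"
  using assms by (simp add: vec_eq_iff forall_2)

lemma mat2_eq_iff [simp]: "mat2 a b c d = mat2 a' b' c' d' \<longleftrightarrow> a = a' \<and> b = b' \<and> c = c' \<and> d = d'"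
  by (metis mat2_nth)

lemma mat2_eta: "(A :: real ^ 2 ^ 2) = mat2 (A $ 1 $ 1) (A $ 1 $ 2) (A $ 2 $ 1) (A $ 2 $ 2)"
  by (rule mat2_eqI) simp_all

lemma mat2_mult: "mat2 a b c d ** mat2 a' b' c' d' =
    mat2 (a * a' + b * c') (a * b' + b * d') (c * a' + d * c') (c * b' + d * d')"
  by (rule mat2_eqI) (simp_all add: matrix_matrix_mult_def sum_2)

lemma scaleR_mat2: "r *\<^sub>R mat2 a b c d = mat2 (r * a) (r * b) (r * c) (r * d)"
  by (rule mat2_eqI) simp_all

lemma det_mat2: "det (mat2 a b c d) = a * d - b * c"
  by (simp add: det_2)

lemma mat_1_mat2: "mat 1 = mat2 1 0 0 1"
  by (rule mat2_eqI) (simp_all add: mat_def)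

lemma SL2R_simps [simp]:
  "carrier SL2R = {A. det A = 1}" "mult SL2R = (**)" "one SL2R = mat2 1 0 0 1"
  by (simp_all add: SL2R_def mat_1_mat2)

lemma group_SL2R: "group SL2R"
proof (rule groupI)
  fix A :: "real ^ 2 ^ 2" assume A: "A \<in> carrier SL2R"
  obtain a b c d where A': "A = mat2 a b c d" using mat2_eta by blast
  define B where "B = mat2 d (- b) (- c) a"
  have "B ** A = mat2 1 0 0 1"
    using A by (simp add: A' B_def mat2_mult det_mat2 algebra_simps)
  moreover have "det B = 1" using A by (simp add: A' B_def det_mat2 algebra_simps)
  ultimately show "\<exists>y\<in>carrier SL2R. y \<otimes>\<^bsub>SL2R\<^esub> A = \<one>\<^bsub>SL2R\<^esub>"
    by (intro bexI[of _ B]) auto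
qed (auto simp: det_mul matrix_mul_assoc det_mat2 simp flip: mat_1_mat2)

lemma inv_SL2R:
  assumes "a * d - b * c = 1"
  shows "inv\<^bsub>SL2R\<^esub> (mat2 a b c d) = mat2 d (- b) (- c) a"
  by (rule group.inv_equality[OF group_SL2R])
     (use assms in \<open>auto simp: mat2_mult det_mat2 algebra_simps\<close>)

text \<open>The matrix (Q x, y; Q c, Q d) divided by sqrt Q.\<close>

definition al_mat :: "nat \<Rightarrow> int \<times> int \<times> int \<times> int \<Rightarrow> real ^ 2 ^ 2" where
  "al_mat Q = (\<lambda>(x, y, c, d). mat2 (sqrt Q * of_int x) (of_int y / sqrt Q) (sqrt Q * of_int c) (sqrt Q * of_int d))"

lemma atkin_lehner_eq:
  assumes "N \<ge> 1" "Q dvd N"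
  shows "atkin_lehner Q N = {al_mat Q (x, y, c, d) | x y c d. int Q * x * d - y * c = 1 \<and> int (N div Q) dvd c}"
proof -
  obtain M where M: "N = Q * M" using assms by auto
  have Q: "Q > 0" using M assms by (auto intro: gr0I)
  have M': "N div Q = M" using M Q by simp
  have eq: "(1 / sqrt (real Q)) *\<^sub>R mat2 (of_int (int Q * x)) (of_int y) (of_int (int N * z)) (of_int (int Q * w)) =
     al_mat Q (x, y, int M * z, w)" for x y z w
    using Q by (simp add: al_mat_def scaleR_mat2 M field_simps)
  have iff: "int Q * x * (int Q * w) - y * (int N * z) = int Q \<longleftrightarrow> int Q * x * w - y * (int M * z) = 1" for x y z w
  proof -
    have "int Q * x * (int Q * w) - y * (int N * z) = int Q * (int Q * x * w - y * (int M * z))"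
      by (simp add: M algebra_simps)
    thus ?thesis using Q by (metis mult.right_neutral mult_left_cancel of_nat_0_eq_iff less_irrefl)
  qed
  show ?thesis unfolding atkin_lehner_def M' eq iff dvd_def by blast
qed

lemma Gamma0_eq_atkin_lehner:
  assumes "N \<ge> 1"
  shows "Gamma0 N = atkin_lehner 1 N"
  using assms by (subst atkin_lehner_eq) (auto simp: Gamma0_def al_mat_def)

text \<open>Q R / gcd(Q, R)^2, the group law on exact divisors that multiplication of the cosets
  induces.\<close>

definition al_star :: "nat \<Rightarrow> nat \<Rightarrow> nat" where
  "al_star Q R = (Q div gcd Q R) * (R div gcd Q R)"

text \<open>The factors a, b, g, h collect the prime powers of N that lie in Q only, in R only, in
  both and in neither.\<close>

lemma exact_divisors_decomp:
  assumes "N \<ge> 1" "Q \<in> exact_divisors N" "R \<in> exact_divisors N"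
  obtains a b g h where "Q = g * a" "R = g * b" "N = a * b * g * h" "al_star Q R = a * b"
    "coprime (a * b) (g * h)" "a > 0" "b > 0" "g > 0"
proof -
  define g where "g = gcd Q R"
  have QN: "Q dvd N" "coprime Q (N div Q)" and RN: "R dvd N" "coprime R (N div R)"
    using assms by (auto simp: exact_divisors_def)
  have pos: "Q > 0" "R > 0" using QN(1) RN(1) assms(1) by (auto intro!: gr0I)
  have g: "g > 0" using pos by (simp add: g_def)
  obtain a where a: "Q = g * a" unfolding g_def by (metis dvdE gcd_dvd1)
  obtain b where b: "R = g * b" unfolding g_def by (metis dvdE gcd_dvd2)
  have ab: "coprime a b"
  proof -
    have "g * gcd a b = gcd Q R" by (simp only: a b gcd_mult_distrib_nat)
    hence "g * gcd a b = g * 1" by (simp only: g_def mult_1_right)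
    hence "gcd a b = 1" using g by (metis mult_left_cancel less_irrefl)
    thus ?thesis by (simp only: coprime_iff_gcd_eq_1)
  qed
  define R' where "R' = N div R"
  have N: "N = g * b * R'" using RN(1) b by (simp add: R'_def)
  have "g * a dvd g * (b * R')" using QN(1) N a by (simp add: mult.assoc)
  hence "a dvd b * R'" using g by simp
  hence "a dvd R'" using ab by (simp add: coprime_dvd_mult_right_iff)
  then obtain h where h: "R' = a * h" by auto
  have "N div Q = b * h"
    using pos(1) by (simp add: N a h mult_ac)
  hence 1: "coprime (g * a) (b * h)" using QN(2) a by simp
  have 2: "coprime (g * b) (a * h)" using RN(2) b h by (simp add: R'_def)
  have "coprime (a * b) (g * h)" using 1 2 ab by (auto simp: coprime_commute)
  moreover have "al_star Q R = a * b"
    using g by (simp add: al_star_def g_def[symmetric]) (simp add: a b)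
  moreover have "N = a * b * g * h" by (simp add: N h mult_ac)
  ultimately show ?thesis using that a b g pos by (metis mult_is_0 neq0_conv)
qed

lemma al_star_exact:
  assumes "N \<ge> 1" "Q \<in> exact_divisors N" "R \<in> exact_divisors N"
  shows "al_star Q R \<in> exact_divisors N"
proof -
  obtain a b g h where *: "Q = g * a" "R = g * b" "N = a * b * g * h" "al_star Q R = a * b"
    "coprime (a * b) (g * h)" "a > 0" "b > 0" "g > 0"
    by (rule exact_divisors_decomp[OF assms])
  have "N div (a * b) = g * h"
    unfolding *(3) mult.assoc[of "a * b"] using *(6,7) by (subst nonzero_mult_div_cancel_left) auto
  thus ?thesis using * by (auto simp: exact_divisors_def)
qed

text \<open>The product of the two integral matrices has determinant Q R = g^2 a b, and all its
  entries are divisible by g; after division by g it has the shape and determinant of a W-matrix for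
  a b.\<close>

lemma atkin_lehner_mult:
  assumes "N \<ge> 1" "Q \<in> exact_divisors N" "R \<in> exact_divisors N"
    and "A \<in> atkin_lehner Q N" "B \<in> atkin_lehner R N"
  shows "A ** B \<in> atkin_lehner (al_star Q R) N"
proof -
  obtain a b g h where *: "Q = g * a" "R = g * b" "N = a * b * g * h" "al_star Q R = a * b"
    "coprime (a * b) (g * h)" "a > 0" "b > 0" "g > 0"
    by (rule exact_divisors_decomp[OF assms(1-3)])
  obtain x y z w where A: "A = (1 / sqrt (real Q)) *\<^sub>R mat2 (of_int (int Q * x)) (of_int y) (of_int (int N * z)) (of_int (int Q * w))"
     "int Q * x * (int Q * w) - y * (int N * z) = int Q"
    using assms(4) by (auto simp: atkin_lehner_def)
  obtain x' y' z' w' where B: "B = (1 / sqrt (real R)) *\<^sub>R mat2 (of_int (int R * x')) (of_int y') (of_int (int N * z')) (of_int (int R * w'))"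
     "int R * x' * (int R * w') - y' * (int N * z') = int R"
    using assms(5) by (auto simp: atkin_lehner_def)
  define X where "X = int g * x * x' + int h * y * z'"
  define Y where "Y = int a * x * y' + int b * y * w'"
  define Z where "Z = int b * z * x' + int a * w * z'"
  define W where "W = int h * z * y' + int g * w * w'"
  have e1: "int Q * x * (int R * x') + y * (int N * z') = int g * (int (a * b) * X)"
    and e2: "int Q * x * y' + y * (int R * w') = int g * Y"
    and e3: "int N * z * (int R * x') + int Q * w * (int N * z') = int g * (int N * Z)"
    and e4: "int N * z * y' + int Q * w * (int R * w') = int g * (int (a * b) * W)"
    by (simp_all add: X_def Y_def Z_def W_def * algebra_simps)
  have "(int Q * x * (int R * x') + y * (int N * z')) * (int N * z * y' + int Q * w * (int R * w')) -
        (int Q * x * y' + y * (int R * w')) * (int N * z * (int R * x') + int Q * w * (int N * z')) =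
        (int Q * x * (int Q * w) - y * (int N * z)) * (int R * x' * (int R * w') - y' * (int N * z'))"
    by (simp add: algebra_simps)
  hence "int g * int g * (int (a * b) * X * (int (a * b) * W) - Y * (int N * Z)) = int g * int g * int (a * b)"
    unfolding e1 e2 e3 e4 A(2) B(2) by (simp add: * algebra_simps)
  hence det: "int (a * b) * X * (int (a * b) * W) - Y * (int N * Z) = int (a * b)"
    using *(8) by simp
  have sq: "1 / sqrt (real Q) * (1 / sqrt (real R)) * real g = 1 / sqrt (real (a * b))"
  proof -
    have "sqrt (real Q) * sqrt (real R) = real g * sqrt (real (a * b))"
      unfolding *(1,2) by (simp add: real_sqrt_mult)
    thus ?thesis using *(8) by simp
  qed
  have "A ** B = (1 / sqrt (real Q) * (1 / sqrt (real R))) *\<^sub>R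
      mat2 (of_int (int Q * x * (int R * x') + y * (int N * z'))) (of_int (int Q * x * y' + y * (int R * w')))
        (of_int (int N * z * (int R * x') + int Q * w * (int N * z'))) (of_int (int N * z * y' + int Q * w * (int R * w')))"
    unfolding A(1) B(1) scaleR_mat2 mat2_mult of_int_add of_int_mult
    by (simp only: mat2_eq_iff) (simp add: algebra_simps)
  also have "\<dots> = (1 / sqrt (real Q) * (1 / sqrt (real R)) * real g) *\<^sub>R
      mat2 (of_int (int (a * b) * X)) (of_int Y) (of_int (int N * Z)) (of_int (int (a * b) * W))"
    unfolding e1 e2 e3 e4 scaleR_mat2 of_int_mult[of "int g"] by (simp only: mat2_eq_iff of_int_of_nat_eq) simp
  finally show ?thesis using det unfolding sq *(4) atkin_lehner_def by blast
qed

lemma atkin_lehner_inv: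
  assumes "N \<ge> 1" "Q dvd N" "A \<in> atkin_lehner Q N"
  shows "inv\<^bsub>SL2R\<^esub> A \<in> atkin_lehner Q N" "A \<in> carrier SL2R"
proof -
  have Q: "Q > 0" using assms by (auto intro: gr0I)
  obtain x y c d where A: "A = al_mat Q (x, y, c, d)" "int Q * x * d - y * c = 1" "int (N div Q) dvd c"
    using assms by (auto simp: atkin_lehner_eq)
  have "sqrt Q * of_int x * (sqrt Q * of_int d) - of_int y / sqrt Q * (sqrt Q * of_int c) = real_of_int (int Q * x * d - y * c)"
    using Q by (simp add: algebra_simps)
  hence det: "sqrt Q * of_int x * (sqrt Q * of_int d) - of_int y / sqrt Q * (sqrt Q * of_int c) = 1"
    unfolding A(2) by simp
  have "inv\<^bsub>SL2R\<^esub> A = al_mat Q (d, - y, - c, x)"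
    unfolding A(1) al_mat_def prod.case by (subst inv_SL2R[OF det]) simp
  moreover have "int Q * d * x - (- y) * (- c) = 1" using A(2) by (simp add: mult_ac)
  ultimately show "inv\<^bsub>SL2R\<^esub> A \<in> atkin_lehner Q N"
    unfolding atkin_lehner_eq[OF assms(1,2)] using A(3) by (intro CollectI exI[of _ d] exI[of _ "- y"] exI[of _ "- c"] exI[of _ x]) auto
  show "A \<in> carrier SL2R" unfolding A(1) al_mat_def prod.case using det by (simp add: det_mat2)
qed

lemma one_exact: "N \<ge> 1 \<Longrightarrow> 1 \<in> exact_divisors N"
  by (simp add: exact_divisors_def)

text \<open>With an index set closed under \<open>al_star\<close> the union of the cosets is already
  closed under products and inverses, so generation adds nothing.\<close>

lemma Gamma_plus_closed:
  assumes N: "N \<ge> 1" and S: "S \<subseteq> exact_divisors N"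
    and star: "\<And>Q R. Q \<in> insert 1 S \<Longrightarrow> R \<in> insert 1 S \<Longrightarrow> al_star Q R \<in> insert 1 S"
  shows "Gamma_plus N S = (\<Union>Q\<in>insert 1 S. atkin_lehner Q N)"
proof -
  have S1: "insert 1 S \<subseteq> exact_divisors N" using S one_exact[OF N] by auto
  have dvd: "Q dvd N" if "Q \<in> insert 1 S" for Q using S1 that by (auto simp: exact_divisors_def)
  have gen: "Gamma_plus N S = generate SL2R (\<Union>Q\<in>insert 1 S. atkin_lehner Q N)"
    by (simp add: Gamma_plus_def Gamma0_eq_atkin_lehner[OF N])
  have "A \<in> (\<Union>Q\<in>insert 1 S. atkin_lehner Q N)" if "A \<in> Gamma_plus N S" for A
    using that unfolding gen
  proof (induction rule: generate.induct)
    case one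
    have "mat2 1 0 0 1 = mat2 (of_int 1) (of_int 0) (of_int 0) (of_int 1)" by simp
    hence "mat2 1 0 0 1 \<in> Gamma0 N" unfolding Gamma0_def by fastforce
    thus ?case by (simp add: Gamma0_eq_atkin_lehner[OF N])
  next
    case (inv A)
    then obtain Q where "Q \<in> insert 1 S" "A \<in> atkin_lehner Q N" by blast
    thus ?case using atkin_lehner_inv(1)[OF N dvd] by blast
  next
    case (eng A B)
    then obtain Q R where QR: "Q \<in> insert 1 S" "A \<in> atkin_lehner Q N" "R \<in> insert 1 S" "B \<in> atkin_lehner R N" by blast
    have "A ** B \<in> atkin_lehner (al_star Q R) N"
      by (rule atkin_lehner_mult[OF N _ _ QR(2,4)]) (use QR S1 in blast)+
    thus ?case using star[OF QR(1,3)] unfolding SL2R_simps by blast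
  qed blast
  moreover have "(\<Union>Q\<in>insert 1 S. atkin_lehner Q N) \<subseteq> Gamma_plus N S"
    unfolding gen by (auto intro: generate.incl)
  ultimately show ?thesis by blast
qed

lemma atkin_lehner_nonempty:
  assumes "N \<ge> 1" "Q \<in> exact_divisors N"
  shows "atkin_lehner Q N \<noteq> {}"
proof -
  have Q: "Q dvd N" "coprime Q (N div Q)" using assms by (auto simp: exact_divisors_def)
  have "gcd (int Q) (int (N div Q)) = 1"
    using Q(2) by (metis coprime_imp_gcd_eq_1 gcd_int_int_eq of_nat_1)
  then obtain x y where "x * int Q + y * int (N div Q) = 1"
    using bezout_int[of "int Q" "int (N div Q)"] by metis
  hence *: "int Q * x * 1 - (- y) * int (N div Q) = 1" by (simp add: algebra_simps)
  have "al_mat Q (x, - y, int (N div Q), 1) \<in> atkin_lehner Q N"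
    unfolding atkin_lehner_eq[OF assms(1) Q(1)] using *
    by (intro CollectI exI[of _ x] exI[of _ "- y"] exI[of _ "int (N div Q)"] exI[of _ 1]) simp
  thus ?thesis by blast
qed

text \<open>Suppose P = Q * R were missing. A product of elements for Q and R is an element for P
  inside the group, and since P * P = 1 all elements for P differ from it by Gamma_0(N). Adjoining P
  would not change the group, against the maximality of S.\<close>

lemma largest_generating_set_closed:
  assumes N: "N \<ge> 1" and L: "largest_generating_set N S"
    and QR: "Q \<in> insert 1 S" "R \<in> insert 1 S"
  shows "al_star Q R \<in> insert 1 S"
proof (rule ccontr)
  assume not: "al_star Q R \<notin> insert 1 S"
  define G where "G = Gamma_plus N S"
  interpret group SL2R by (rule group_SL2R)
  have S: "S \<subseteq> exact_divisors N - {1}" using L by (simp add: largest_generating_set_def)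
  have ex: "Q \<in> exact_divisors N" "R \<in> exact_divisors N" using QR S one_exact[OF N] by auto
  define P where "P = al_star Q R"
  have P: "P \<in> exact_divisors N" unfolding P_def by (rule al_star_exact[OF N ex])
  have dvd: "T dvd N" if "T \<in> exact_divisors N" for T using that by (simp add: exact_divisors_def)
  have gens: "Gamma0 N \<union> (\<Union>Q\<in>S. atkin_lehner Q N) \<subseteq> carrier SL2R"
    unfolding Gamma0_eq_atkin_lehner[OF N] using atkin_lehner_inv(2)[OF N dvd] S one_exact[OF N] by blast
  have sub: "subgroup G SL2R" unfolding G_def Gamma_plus_def by (rule generate_is_subgroup[OF gens])
  have incl: "atkin_lehner T N \<subseteq> G" if "T \<in> insert 1 S" for T
    using that unfolding G_def Gamma_plus_def Gamma0_eq_atkin_lehner[OF N] by (auto intro: generate.incl)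
  obtain A B where AB: "A \<in> atkin_lehner Q N" "B \<in> atkin_lehner R N"
    using atkin_lehner_nonempty[OF N] ex by blast
  define C where "C = A ** B"
  have C: "C \<in> atkin_lehner P N" unfolding C_def P_def by (rule atkin_lehner_mult[OF N ex AB])
  have CG: "C \<in> G" using subgroup.m_closed[OF sub] incl[OF QR(1)] incl[OF QR(2)] AB unfolding C_def by auto
  have PP: "al_star P P = 1"
  proof -
    have "P > 0" using dvd[OF P] N by (auto intro: gr0I)
    thus ?thesis by (simp add: al_star_def)
  qed
  have "atkin_lehner P N \<subseteq> G"
  proof
    fix D assume D: "D \<in> atkin_lehner P N"
    have "D ** inv\<^bsub>SL2R\<^esub> C \<in> atkin_lehner (al_star P P) N"
      by (rule atkin_lehner_mult[OF N P P D atkin_lehner_inv(1)[OF N dvd[OF P] C]])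
    hence "D ** inv\<^bsub>SL2R\<^esub> C \<in> G" using incl[of 1] unfolding PP by auto
    hence "D ** inv\<^bsub>SL2R\<^esub> C ** C \<in> G" using subgroup.m_closed[OF sub _ CG] by auto
    moreover have "D ** inv\<^bsub>SL2R\<^esub> C ** C = D"
    proof -
      have "inv\<^bsub>SL2R\<^esub> C ** C = mat 1" using l_inv[OF atkin_lehner_inv(2)[OF N dvd[OF P] C]]
        by (simp add: mat_1_mat2)
      thus ?thesis by (simp flip: matrix_mul_assoc)
    qed
    ultimately show "D \<in> G" by simp
  qed
  hence PG: "atkin_lehner P N \<subseteq> G" .
  define T where "T = insert P S"
  have "Gamma_plus N T = G"
  proof
    have "Gamma0 N \<union> (\<Union>Q\<in>T. atkin_lehner Q N) \<subseteq> G"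
      using incl PG by (auto simp: T_def Gamma0_eq_atkin_lehner[OF N])
    thus "Gamma_plus N T \<subseteq> G" unfolding Gamma_plus_def[of N T] by (rule generate_subgroup_incl[OF _ sub])
    show "G \<subseteq> Gamma_plus N T" unfolding G_def Gamma_plus_def
      by (rule mono_generate) (auto simp: T_def)
  qed
  moreover have "T \<subseteq> exact_divisors N - {1}" using S P not by (auto simp: T_def P_def)
  ultimately have "T \<subseteq> S" using L by (auto simp: largest_generating_set_def G_def)
  thus False using not by (simp add: T_def P_def)
qed

section \<open>Cosets and lower rows\<close>

lemma has_sum_Sigma_finite:
  fixes f :: "'a \<times> 'b \<Rightarrow> complex"
  assumes "finite A" "\<And>x. x \<in> A \<Longrightarrow> ((\<lambda>y. f (x, y)) has_sum g x) (B x)"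
  shows "(f has_sum (\<Sum>x\<in>A. g x)) (Sigma A B)"
  using assms
proof (induction A rule: finite_induct)
  case (insert x A)
  have "(f has_sum g x) (Pair x ` B x)"
    using insert.prems[of x] by (subst has_sum_reindex) (auto simp: o_def inj_on_def)
  moreover have "(f has_sum (\<Sum>x\<in>A. g x)) (Sigma A B)"
    using insert by auto
  ultimately have "(f has_sum (g x + (\<Sum>x\<in>A. g x))) (Pair x ` B x \<union> Sigma A B)"
    by (rule has_sum_Un_disjoint) (use insert in auto)
  also have "Pair x ` B x \<union> Sigma A B = Sigma (insert x A) B" by auto
  finally show ?case using insert by simp
qed auto

lemma finite_exact_divisors: "N \<ge> 1 \<Longrightarrow> finite (exact_divisors N)"
  by (rule finite_subset[of _ "{..N}"]) (auto simp: exact_divisors_def dest: dvd_imp_le)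

lemma moeb_al_mat:
  assumes "Q > 0"
  shows "moeb (al_mat Q (x, y, c, d)) \<tau> = al_point Q (x, y, c, d) \<tau>"
proof -
  define r where "r = complex_of_real (sqrt (real Q))"
  have r: "r \<noteq> 0" "of_nat Q = r * r" using assms
    by (auto simp: r_def simp flip: of_real_mult)
  have "moeb (al_mat Q (x, y, c, d)) \<tau> = (r * of_int x * \<tau> + of_int y / r) / (r * of_int c * \<tau> + r * of_int d)"
    by (simp add: moeb_def al_mat_def r_def)
  also have "\<dots> = (r * (r * of_int x * \<tau> + of_int y / r)) / (r * (r * of_int c * \<tau> + r * of_int d))"
    using r(1) by simp
  also have "\<dots> = al_point Q (x, y, c, d) \<tau>"
    using r(1) by (simp add: al_point_def r(2) algebra_simps)
  finally show ?thesis .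
qed

definition gamma_coset :: "real ^ 2 ^ 2 \<Rightarrow> (real ^ 2 ^ 2) set" where
  "gamma_coset A = {B ** A | B. B \<in> Gamma_inf}"

lemma Gamma_inf_eq: "Gamma_inf = {mat2 \<epsilon> (of_int t) 0 \<epsilon> | \<epsilon> t. \<epsilon> = 1 \<or> \<epsilon> = - 1}"
  unfolding Gamma_inf_def by auto

lemma gamma_coset_mat2:
  "gamma_coset (mat2 a b c d) = {mat2 (\<epsilon> * a + of_int t * c) (\<epsilon> * b + of_int t * d) (\<epsilon> * c) (\<epsilon> * d) | \<epsilon> t. \<epsilon> = 1 \<or> \<epsilon> = - 1}"
proof -
  have "gamma_coset (mat2 a b c d) = (\<lambda>(\<epsilon>, t). mat2 \<epsilon> (of_int t) 0 \<epsilon> ** mat2 a b c d) ` {(\<epsilon>, t). \<epsilon> = 1 \<or> \<epsilon> = - 1}"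
    unfolding gamma_coset_def Gamma_inf_eq by auto
  thus ?thesis by (auto simp: mat2_mult image_iff)
qed

lemma moeb_gamma_coset:
  assumes \<tau>: "Im \<tau> > 0" and Q: "Q > 0" and cd: "c \<noteq> 0 \<or> d \<noteq> 0"
    and B: "B \<in> gamma_coset (al_mat Q (x, y, c, d))"
  shows "\<exists>t. moeb B \<tau> = al_point Q (x, y, c, d) \<tau> + of_int t"
proof -
  define A where "A = al_mat Q (x, y, c, d)"
  obtain a1 b1 c1 d1 where A1: "A = mat2 a1 b1 c1 d1" using mat2_eta by blast
  have cd1: "c1 \<noteq> 0 \<or> d1 \<noteq> 0" using cd Q A1 by (auto simp: A_def al_mat_def)
  have nz: "of_real c1 * \<tau> + of_real d1 \<noteq> 0"
    using lattice_bound[OF \<tau>, of c1 d1] lattice_const_pos[OF \<tau>] cd1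
    by (auto simp: mult_le_0_iff)
  obtain \<epsilon> t where B': "B = mat2 (\<epsilon> * a1 + of_int t * c1) (\<epsilon> * b1 + of_int t * d1) (\<epsilon> * c1) (\<epsilon> * d1)" "\<epsilon> = 1 \<or> \<epsilon> = - 1"
    using B unfolding A_def[symmetric] A1 gamma_coset_mat2 by blast
  have "moeb B \<tau> = moeb A \<tau> + of_int (if \<epsilon> = 1 then t else - t)"
    using B'(2)
  proof (elim disjE)
    assume e: "\<epsilon> = 1"
    show ?thesis using nz unfolding B'(1) A1 moeb_def mat2_nth e by (simp add: field_simps)
  next
    assume e: "\<epsilon> = - 1"
    define X where "X = of_real a1 * \<tau> + of_real b1"
    define D where "D = of_real c1 * \<tau> + of_real d1"
    have D: "D \<noteq> 0" using nz by (simp add: D_def)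
    have num: "of_real (\<epsilon> * a1 + of_int t * c1) * \<tau> + of_real (\<epsilon> * b1 + of_int t * d1) = - X + of_int t * D"
      and den: "of_real (\<epsilon> * c1) * \<tau> + of_real (\<epsilon> * d1) = - D"
      by (simp_all add: e X_def D_def algebra_simps)
    have "moeb B \<tau> = (- X + of_int t * D) / (- D)"
      unfolding B'(1) moeb_def mat2_nth num den ..
    also have "\<dots> = X / D - of_int t" using D by (simp add: field_simps)
    finally show ?thesis using e by (simp add: A1 moeb_def X_def D_def)
  qed
  also have "moeb A \<tau> = al_point Q (x, y, c, d) \<tau>" unfolding A_def by (rule moeb_al_mat[OF Q])
  finally show ?thesis by blast
qed

lemma gamma_coset_self: "A \<in> gamma_coset A"
proof -
  obtain a b c d where A: "A = mat2 a b c d" using mat2_eta by blast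
  show ?thesis unfolding A gamma_coset_mat2
    by (intro CollectI exI[of _ 1] exI[of _ 0]) simp
qed

lemma gamma_coset_eqI:
  assumes "B \<in> gamma_coset A"
  shows "gamma_coset B = gamma_coset A"
proof -
  have mult: "X ** Y \<in> Gamma_inf" if XY: "X \<in> Gamma_inf" "Y \<in> Gamma_inf" for X Y
  proof -
    obtain e t e' t' where *: "X = mat2 e (of_int t) 0 e" "e = 1 \<or> e = - 1" "Y = mat2 e' (of_int t') 0 e'" "e' = 1 \<or> e' = - 1"
      using XY unfolding Gamma_inf_eq by blast
    have "X ** Y = mat2 (e * e') (of_int (\<lfloor>e\<rfloor> * t' + t * \<lfloor>e'\<rfloor>)) 0 (e * e')"
      using *(2,4) unfolding * mat2_mult by auto
    moreover have "e * e' = 1 \<or> e * e' = - 1" using *(2,4) by auto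
    ultimately show ?thesis unfolding Gamma_inf_eq by blast
  qed
  have inv: "\<exists>Y\<in>Gamma_inf. Y ** X = mat 1" if X: "X \<in> Gamma_inf" for X
  proof -
    obtain e t where *: "X = mat2 e (of_int t) 0 e" "e = 1 \<or> e = - 1"
      using X unfolding Gamma_inf_eq by blast
    have "mat2 e (of_int (- t)) 0 e \<in> Gamma_inf" unfolding Gamma_inf_eq using *(2) by blast
    moreover have "mat2 e (of_int (- t)) 0 e ** X = mat 1"
      using *(2) unfolding * mat2_mult mat_1_mat2 by auto
    ultimately show ?thesis by blast
  qed
  obtain X where X: "X \<in> Gamma_inf" "B = X ** A" using assms by (auto simp: gamma_coset_def)
  obtain Y where Y: "Y \<in> Gamma_inf" "Y ** X = mat 1" using inv[OF X(1)] by blast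
  have A: "A = Y ** B" by (simp add: X(2) matrix_mul_assoc Y(2))
  have "Z ** B \<in> gamma_coset A" if "Z \<in> Gamma_inf" for Z
    using mult[OF that X(1)] unfolding gamma_coset_def X(2) matrix_mul_assoc by blast
  moreover have "Z ** A \<in> gamma_coset B" if "Z \<in> Gamma_inf" for Z
    using mult[OF that Y(1)] unfolding gamma_coset_def A[symmetric] by (subst A) (auto simp: matrix_mul_assoc)
  ultimately show ?thesis unfolding gamma_coset_def[of B] gamma_coset_def[of A]
    by (auto simp: gamma_coset_def)
qed

text \<open>Pairs of Q and a normalised primitive row (c, w) correspond to the cosets: the row fixes
  the matrix up to a left translation, the normalisation removes the sign, and Q is recovered from
  the length of the row sqrt Q * (c, w).\<close>

lemma niebur_G_eq_sum:
  assumes N: "N \<ge> 1" and S: "S \<subseteq> exact_divisors N"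
    and star: "\<And>Q R. Q \<in> insert 1 S \<Longrightarrow> R \<in> insert 1 S \<Longrightarrow> al_star Q R \<in> insert 1 S"
    and n: "n \<ge> 1" and \<tau>: "Im \<tau> > 0" and s: "Re s > 1"
  shows "niebur_G (Gamma_plus N S) n \<tau> s =
    2 * of_real pi * (\<Sum>Q\<in>insert 1 S. al_sum Q (N div Q) (niebur_f n s) \<tau>)"
proof -
  define S1 where "S1 = insert 1 S"
  have S1: "S1 \<subseteq> exact_divisors N" using S one_exact[OF N] by (auto simp: S1_def)
  have fin: "finite S1" using finite_subset[OF S1 finite_exact_divisors[OF N]] .
  have dvd: "Q dvd N" "Q > 0" if "Q \<in> S1" for Q using that S1 N by (auto simp: exact_divisors_def intro!: gr0I)
  define G where "G = Gamma_plus N S"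
  have G: "G = (\<Union>Q\<in>S1. atkin_lehner Q N)"
    unfolding G_def S1_def by (rule Gamma_plus_closed[OF N S star])
  define I where "I = Sigma S1 (\<lambda>Q. al_index Q (N div Q))"
  define \<Phi> where "\<Phi> = (\<lambda>(Q, x). gamma_coset (al_mat Q (al_lift Q x)))"
  define R where "R = rcosets\<^bsub>SL2R\<lparr>carrier := G\<rparr>\<^esub> Gamma_inf"
  have R: "R = gamma_coset ` G"
    by (auto simp: R_def RCOSETS_def r_coset_def gamma_coset_def)
  have idx: "Q \<in> S1" "Q > 0" "Q dvd N" "coprime (int Q * w) c" "int (N div Q) dvd c" "c > 0 \<or> c = 0 \<and> w > 0"
    if "(Q, (c, w)) \<in> I" for Q c w
    using that dvd by (auto simp: I_def al_index_def)
  have bij: "bij_betw \<Phi> I R"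
  proof (rule bij_betw_imageI)
    show "inj_on \<Phi> I"
    proof (rule inj_onI)
      fix p p' assume p: "p \<in> I" "p' \<in> I" "\<Phi> p = \<Phi> p'"
      obtain Q c w Q' c' w' where pp: "p = (Q, (c, w))" "p' = (Q', (c', w'))" by (metis surj_pair)
      note i = idx[OF p(1)[unfolded pp]] and i' = idx[OF p(2)[unfolded pp]]
      obtain x y where l: "al_lift Q (c, w) = (x, y, c, w)" by (rule al_liftE[OF i(4)])
      obtain x' y' where l': "al_lift Q' (c', w') = (x', y', c', w')" by (rule al_liftE[OF i'(4)])
      have "al_mat Q (x, y, c, w) \<in> gamma_coset (al_mat Q' (x', y', c', w'))"
        using p(3) gamma_coset_self by (auto simp: \<Phi>_def pp l l')
      then obtain e where e: "e = 1 \<or> e = - 1" "sqrt Q * of_int c = e * (sqrt Q' * of_int c')"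
         "sqrt Q * of_int w = e * (sqrt Q' * of_int w')"
        by (auto simp: al_mat_def gamma_coset_mat2)
      have pos: "sqrt (real Q) > 0" "sqrt (real Q') > 0" using i(2) i'(2) by auto
      \<comment> \<open>Eliminating the sign and the square roots leaves proportional rows; both are
        primitive and normalised, so they coincide.\<close>
      have cross: "c * w' = c' * w"
      proof -
        have "sqrt Q * of_int c * (e * (sqrt Q' * of_int w')) = e * (sqrt Q' * of_int c') * (sqrt Q * of_int w)"
          by (simp only: e(2) e(3)[symmetric])
        hence "(sqrt Q * sqrt Q' * e) * real_of_int (c * w') = (sqrt Q * sqrt Q' * e) * real_of_int (c' * w)"
          by (simp add: mult_ac)
        moreover have "sqrt Q * sqrt Q' * e \<noteq> 0" using pos e(1) by auto
        ultimately show ?thesis by (metis mult_left_cancel of_int_eq_iff)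
      qed
      have cop: "coprime w c" "coprime w' c'" using i(4) i'(4) by auto
      have eq: "c = c' \<and> w = w'"
      proof (cases "c = 0")
        case True
        hence "w = 1" using i(6) cop by auto
        moreover have "c' = 0" using cross True \<open>w = 1\<close> by simp
        moreover hence "w' = 1" using i'(6) cop by auto
        ultimately show ?thesis using True by simp
      next
        case False
        hence c: "c > 0" using i(6) by auto
        have "c' \<noteq> 0"
        proof
          assume "c' = 0"
          hence "w' = 0" using cross c by simp
          thus False using i'(6) \<open>c' = 0\<close> by simp
        qed
        hence c': "c' > 0" using i'(6) by auto
        have "c dvd c' * w" using cross by (metis dvd_triv_left)
        hence "c dvd c'" using cop by (simp add: coprime_dvd_mult_left_iff coprime_commute)
        moreover have "c' dvd c * w'" using cross by (metis dvd_triv_left)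
        hence "c' dvd c" using cop by (simp add: coprime_dvd_mult_left_iff coprime_commute)
        ultimately have "c = c'" using c c' by (simp add: zdvd_antisym_nonneg)
        thus ?thesis using cross c by simp
      qed
      have "real Q = real Q'"
      proof -
        obtain k where k: "k \<noteq> 0" "sqrt Q * real_of_int k = e * (sqrt Q' * real_of_int k)"
          using e(2,3) eq i(6) by (metis less_irrefl)
        hence "sqrt Q = e * sqrt Q'" by simp
        hence "(sqrt Q)\<^sup>2 = (e * sqrt Q')\<^sup>2" by simp
        thus ?thesis using e(1) by (auto simp: power_mult_distrib)
      qed
      thus "p = p'" using eq by (simp add: pp)
    qed
    show "\<Phi> ` I = R"
    proof (intro equalityI subsetI)
      fix C assume "C \<in> \<Phi> ` I"
      then obtain Q c w where C: "(Q, (c, w)) \<in> I" "C = \<Phi> (Q, (c, w))" by (metis (no_types, lifting) imageE surj_pair)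
      note i = idx[OF C(1)]
      obtain x y where l: "al_lift Q (c, w) = (x, y, c, w)" "int Q * x * w - y * c = 1" by (rule al_liftE[OF i(4)])
      have "al_mat Q (x, y, c, w) \<in> atkin_lehner Q N"
        unfolding atkin_lehner_eq[OF N i(3)] using l(2) i(5)
        by (intro CollectI exI[of _ x] exI[of _ y] exI[of _ c] exI[of _ w]) simp
      hence "al_mat Q (x, y, c, w) \<in> G" using i(1) unfolding G by blast
      thus "C \<in> R" unfolding R C(2) \<Phi>_def by (simp add: l(1))
    next
      fix C assume "C \<in> R"
      then obtain A Q where A: "A \<in> atkin_lehner Q N" "Q \<in> S1" "C = gamma_coset A" unfolding R G by blast
      obtain x y c d where A': "A = al_mat Q (x, y, c, d)" "int Q * x * d - y * c = 1" "int (N div Q) dvd c"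
        using A(1) unfolding atkin_lehner_eq[OF N dvd(1)[OF A(2)]] by blast
      \<comment> \<open>The sign that brings the lower row into the normalised half.\<close>
      define e where "e = (if c > 0 \<or> c = 0 \<and> d > 0 then 1 else - 1 :: int)"
      have cd: "c \<noteq> 0 \<or> d \<noteq> 0" using A'(2) by auto
      have e: "e * c > 0 \<or> e * c = 0 \<and> e * d > 0" "e = 1 \<or> e = - 1" using cd by (auto simp: e_def)
      have ee: "e * e = 1" using e(2) by auto
      have det: "int Q * (e * x) * (e * d) - (e * y) * (e * c) = 1"
      proof -
        have "int Q * (e * x) * (e * d) - (e * y) * (e * c) = (e * e) * (int Q * x * d - y * c)" by (simp add: algebra_simps)
        thus ?thesis using ee A'(2) by simp
      qed
      have cop: "coprime (int Q * (e * d)) (e * c)"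
      proof (rule coprimeI)
        fix k assume "k dvd int Q * (e * d)" "k dvd e * c"
        hence "k dvd (int Q * (e * d)) * (e * x) - (e * y) * (e * c)" by (intro dvd_diff) auto
        also have "(int Q * (e * d)) * (e * x) - (e * y) * (e * c) = 1" using det by (simp add: mult_ac)
        finally show "is_unit k" .
      qed
      have mem: "(Q, (e * c, e * d)) \<in> I"
        using A(2) A'(3) e(1) cop by (auto simp: I_def al_index_def)
      obtain x' y' where l: "al_lift Q (e * c, e * d) = (x', y', e * c, e * d)" "int Q * x' * (e * d) - y' * (e * c) = 1"
        by (rule al_liftE[OF cop])
      have "\<exists>t. x' = e * x + t * (e * c) \<and> y' = e * y + t * (int Q * (e * d))"
      proof -
        \<comment> \<open>The upper right entry of one unimodular matrix times the inverse of the
          other; as the lower rows agree, this quotient is a translation by t.\<close>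
        define t where "t = x' * (e * y) * (- 1) + y' * (e * x)"
        have 1: "int Q * x' * (e * d) - y' * (e * c) = 1" "int Q * (e * x) * (e * d) - (e * y) * (e * c) = 1"
          using l(2) det by auto
        have "e * x + t * (e * c) = e * x * (int Q * x' * (e * d)) - x' * (e * y) * (e * c) +
           e * x * (1 - (int Q * x' * (e * d) - y' * (e * c)))"
          by (simp add: t_def algebra_simps)
        also have "\<dots> = x' * (int Q * (e * x) * (e * d) - (e * y) * (e * c))"
          unfolding 1(1) by (simp add: algebra_simps)
        also have "\<dots> = x'" unfolding 1 by simp
        finally have x: "x' = e * x + t * (e * c)" by simp
        have "e * y + t * (int Q * (e * d)) = y' * (int Q * (e * x) * (e * d)) - e * y * (int Q * x' * (e * d)) + e * y"
          by (simp add: t_def algebra_simps)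
        also have "\<dots> = y' * (int Q * (e * x) * (e * d) - (e * y) * (e * c)) -
           e * y * (int Q * x' * (e * d) - y' * (e * c)) + e * y"
          by (simp add: algebra_simps)
        also have "\<dots> = y'" unfolding 1 by simp
        finally show ?thesis using x by metis
      qed
      then obtain t where t: "x' = e * x + t * (e * c)" "y' = e * y + t * (int Q * (e * d))" by blast
      have Q: "sqrt (real Q) > 0" using dvd(2)[OF A(2)] by simp
        have "real_of_int y' / sqrt Q = of_int e * (of_int y / sqrt Q) + of_int (t * e) * (sqrt Q * of_int d)"
        proof -
          have "real_of_int (int Q) / sqrt Q = sqrt Q" by (simp add: real_div_sqrt)
          moreover have "real_of_int (t * (int Q * (e * d))) / sqrt Q =
              real_of_int (int Q) / sqrt Q * (of_int t * of_int e * of_int d)" by simp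
          ultimately have "real_of_int (t * (int Q * (e * d))) / sqrt Q = of_int (t * e) * (sqrt Q * of_int d)"
            by (simp only:) simp
          thus ?thesis unfolding t(2) of_int_add add_divide_distrib by simp
        qed
      hence eq: "mat2 (sqrt Q * of_int x') (of_int y' / sqrt Q) (sqrt Q * of_int (e * c)) (sqrt Q * of_int (e * d)) =
          mat2 (of_int e * (sqrt Q * of_int x) + of_int (t * e) * (sqrt Q * of_int c))
            (of_int e * (of_int y / sqrt Q) + of_int (t * e) * (sqrt Q * of_int d))
            (of_int e * (sqrt Q * of_int c)) (of_int e * (sqrt Q * of_int d))"
          by (simp add: t(1) algebra_simps)
      have "al_mat Q (x', y', e * c, e * d) \<in> gamma_coset A"
        unfolding A'(1) al_mat_def prod.case gamma_coset_mat2
        by (rule CollectI, rule exI[of _ "of_int e"], rule exI[of _ "t * e"], rule conjI[OF eq])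
           (use e(2) in auto)
      hence "C = \<Phi> (Q, (e * c, e * d))"
        unfolding A(3) \<Phi>_def prod.case l(1) by (rule gamma_coset_eqI[symmetric])
      thus "C \<in> \<Phi> ` I" using mem by blast
    qed
  qed
  define F where "F = (\<lambda>C. niebur_f n s (moeb (SOME \<gamma>. \<gamma> \<in> C) \<tau>))"
  define f where "f = (\<lambda>(Q, x). niebur_f n s (al_point Q (al_lift Q x) \<tau>))"
  have Ff: "F (\<Phi> p) = f p" if p: "p \<in> I" for p
  proof -
    obtain Q c w where pp: "p = (Q, (c, w))" by (metis surj_pair)
    note i = idx[OF p[unfolded pp]]
    obtain x y where l: "al_lift Q (c, w) = (x, y, c, w)" "int Q * x * w - y * c = 1" by (rule al_liftE[OF i(4)])
    \<comment> \<open>The chosen representative differs from the lift by a sign and a translation;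
      the sign acts trivially, and \<open>niebur_f\<close> is invariant under integer
      translations.\<close>
    have "(SOME \<gamma>. \<gamma> \<in> \<Phi> p) \<in> \<Phi> p"
      by (rule someI_ex) (auto simp: \<Phi>_def pp intro: gamma_coset_self)
    hence mem: "(SOME \<gamma>. \<gamma> \<in> \<Phi> p) \<in> gamma_coset (al_mat Q (x, y, c, w))"
      unfolding \<Phi>_def pp prod.case l(1) .
    have "c \<noteq> 0 \<or> w \<noteq> 0" using i(6) by auto
    from moeb_gamma_coset[OF \<tau> i(2) this mem]
    obtain t where "moeb (SOME \<gamma>. \<gamma> \<in> \<Phi> p) \<tau> = al_point Q (x, y, c, w) \<tau> + of_int t"
      by blast
    thus ?thesis unfolding F_def f_def pp prod.case l(1) by (simp add: niebur_f_shift)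
  qed
  have "((\<lambda>p. f p) has_sum (\<Sum>Q\<in>S1. al_sum Q (N div Q) (niebur_f n s) \<tau>)) I"
    unfolding I_def
  proof (rule has_sum_Sigma_finite[OF fin])
    fix Q assume "Q \<in> S1"
    hence "Q \<ge> 1" using dvd(2) by (simp add: Suc_leI)
    from has_sum_al[OF this n \<tau> s]
    have "(\<lambda>x. niebur_f n s (al_point Q (al_lift Q x) \<tau>)) summable_on al_index Q (N div Q)"
      by (rule has_sum_imp_summable)
    thus "((\<lambda>x. f (Q, x)) has_sum al_sum Q (N div Q) (niebur_f n s) \<tau>) (al_index Q (N div Q))"
      unfolding f_def prod.case al_sum_def by (rule has_sum_infsum)
  qed
  hence "((\<lambda>p. F (\<Phi> p)) has_sum (\<Sum>Q\<in>S1. al_sum Q (N div Q) (niebur_f n s) \<tau>)) I"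
    by (subst has_sum_cong[OF Ff])
  hence "(F has_sum (\<Sum>Q\<in>S1. al_sum Q (N div Q) (niebur_f n s) \<tau>)) R"
    by (subst (asm) has_sum_reindex_bij_betw[OF bij])
  hence "infsum F R = (\<Sum>Q\<in>S1. al_sum Q (N div Q) (niebur_f n s) \<tau>)" by (rule infsumI)
  thus ?thesis unfolding niebur_G_def F_def R_def G_def S1_def by simp
qed

section \<open>Expansion and Fourier coefficients of $j_{\Gamma,n}$\<close>

lemma has_integral_ee:
  "((\<lambda>x. ee (of_int m * x)) has_integral (if m = 0 then 1 else 0)) {0..1}"
proof (cases "m = 0")
  case True
  thus ?thesis using has_integral_const_real[of "1::complex" 0 1] by simp
next
  case False
  define K where "K = 2 * of_real pi * \<i> * (of_int m :: complex)"
  have K: "K \<noteq> 0" using False by (simp add: K_def)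
  have ee: "ee (of_int m * x) = exp (K * of_real x)" for x
    by (simp add: ee_def K_def mult_ac)
  have "((\<lambda>x. exp (K * of_real x)) has_integral (exp (K * of_real 1) / K - exp (K * of_real 0) / K)) {0..1}"
  proof (rule fundamental_theorem_of_calculus)
    fix x :: real
    have "((\<lambda>z. exp (K * z) / K) has_field_derivative exp (K * of_real x)) (at (of_real x))"
      using K by (auto intro!: derivative_eq_intros)
    thus "((\<lambda>x. exp (K * of_real x) / K) has_vector_derivative exp (K * of_real x)) (at x within {0..1})"
      by (rule has_vector_derivative_real_field)
  qed auto
  also have "exp (K * of_real 1) = 1" using ee[of 1] by simp
  finally show ?thesis using False by (simp add: ee)
qed

lemma continuous_on_ee [continuous_intros]: "continuous_on S f \<Longrightarrow> continuous_on S (\<lambda>x. ee (f x))"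
  unfolding ee_def by (intro continuous_intros)

text \<open>Stated for general E because it is applied to e((l - k) x), e(l x), e(l p x) and the
  mean of e(l (x + i) / p) over i.\<close>

lemma has_integral_series:
  fixes A :: "int \<Rightarrow> complex"
  assumes A: "(\<lambda>l. cmod (A l)) summable_on UNIV"
    and E: "\<And>l. continuous_on {0..1} (E l)" "\<And>l x. cmod (E l x) \<le> 1"
      "\<And>l. (E l has_integral (if l = k then 1 else 0)) {0..(1::real)}"
    and F: "\<And>x. ((\<lambda>l. A l * E l x) has_sum F x) UNIV"
  shows "(F has_integral A k) {0..1}"
proof -
  have "uniform_limit {0..1} (\<lambda>X x. \<Sum>l\<in>X. A l * E l x) F (finite_subsets_at_top UNIV)"
    by (rule Weierstrass_m_test_general'[OF _ F A])
       (use E(2) in \<open>auto simp: norm_mult intro: mult_left_le\<close>)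
  moreover have "continuous_on {0..1} (\<lambda>x. \<Sum>l\<in>X. A l * E l x)" for X
    by (intro continuous_intros E)
  ultimately obtain I J where IJ: "\<And>X. ((\<lambda>x. \<Sum>l\<in>X. A l * E l x) has_integral I X) {0..1}"
     "(F has_integral J) {0..1}" "(I \<longlongrightarrow> J) (finite_subsets_at_top UNIV)"
    by (rule uniform_limit_integral) auto
  have "I X = A k" if "finite X" "k \<in> X" for X
  proof -
    have "((\<lambda>x. \<Sum>l\<in>X. A l * E l x) has_integral (\<Sum>l\<in>X. A l * (if l = k then 1 else 0))) {0..1}"
      using that by (intro has_integral_sum has_integral_mult_right E)
    also have "(\<Sum>l\<in>X. A l * (if l = k then 1 else 0)) = A k"
      using that by (simp add: if_distrib[of "(*) _"] cong: if_cong)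
    finally show ?thesis using IJ(1) has_integral_unique by blast
  qed
  \<comment> \<open>Partial integrals are exactly A k as soon as X contains k, so the limit needs no
    estimate.\<close>
  hence "eventually (\<lambda>X. I X = A k) (finite_subsets_at_top UNIV)"
    unfolding eventually_finite_subsets_at_top by (intro exI[of _ "{k}"]) auto
  hence "(I \<longlongrightarrow> A k) (finite_subsets_at_top UNIV)" by (rule tendsto_eventually)
  hence "J = A k" using IJ(3) tendsto_unique finite_subsets_at_top_neq_bot by blast
  thus ?thesis using IJ(2) by simp
qed

lemma qe_Complex: "qe (Complex x y) l = of_real (exp (- (2 * pi * real_of_int \<bar>l\<bar> * y))) * ee (of_int l * x)"
proof -
  have 1: "qq (Complex x y) ^ n = of_real (exp (- (2 * pi * real n * y))) * ee (real n * x)" for n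
  proof -
    have "qq (Complex x y) ^ n = exp (of_nat n * (2 * of_real pi * \<i> * Complex x y))"
      by (simp add: qq_def exp_of_nat_mult)
    also have "of_nat n * (2 * of_real pi * \<i> * Complex x y) =
       of_real (- (2 * pi * real n * y)) + 2 * of_real pi * \<i> * of_real (real n * x)"
      by (simp add: complex_eq_iff)
    finally show ?thesis by (simp only: exp_add ee_def exp_of_real)
  qed
  show ?thesis
  proof (cases "l \<ge> 0")
    case True
    thus ?thesis using 1[of "nat l"] by (simp add: qe_def)
  next
    case False
    have "qe (Complex x y) l = cnj (qq (Complex x y) ^ nat (- l))" using False by (simp add: qe_def)
    also have "\<dots> = of_real (exp (- (2 * pi * real (nat (- l)) * y))) * ee (- (real (nat (- l)) * x))"
      unfolding 1 by (simp add: cnj_ee)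
    finally show ?thesis using False by simp
  qed
qed

lemma qq_power:
  "qq \<tau> ^ n = ee (real n * Re \<tau>) * of_real (exp (- (2 * pi * real n * Im \<tau>)))"
  using qe_Complex[of "Re \<tau>" "Im \<tau>" "int n"] by (simp add: qe_def mult_ac)

lemma cnj_qq_power:
  "cnj (qq \<tau>) ^ n = ee (- real n * Re \<tau>) * of_real (exp (- (2 * pi * real n * Im \<tau>)))"
  unfolding complex_cnj_power [symmetric] qq_power by (simp add: cnj_ee)

lemma inverse_qq_power:
  "inverse (qq \<tau>) ^ n = ee (- real n * Re \<tau>) * of_real (exp (2 * pi * real n * Im \<tau>))"
proof -
  have "qq \<tau> ^ n * (ee (- real n * Re \<tau>) * of_real (exp (2 * pi * real n * Im \<tau>))) =
    (ee (real n * Re \<tau>) * ee (- real n * Re \<tau>)) *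
      of_real (exp (- (2 * pi * real n * Im \<tau>)) * exp (2 * pi * real n * Im \<tau>))"
    unfolding qq_power by (simp only: of_real_mult mult_ac)
  also have "\<dots> = 1" by (simp add: ee_add [symmetric] exp_add [symmetric])
  finally show ?thesis unfolding power_inverse by (rule inverse_unique)
qed

text \<open>With \<open>int_series_join\<close> this passes between two-sided series in
  \<open>qe\<close> and the form with separate constant term that \<open>is_niebur_expansion\<close>
  prescribes.\<close>

lemma int_series_split:
  fixes k :: "int \<Rightarrow> complex"
  assumes "((\<lambda>l. k l * qe \<tau> l) has_sum S) UNIV"
  shows "(\<lambda>l. k (int l) * qq \<tau> ^ l) summable_on {1..}" "(\<lambda>l. k (- int l) * cnj (qq \<tau>) ^ l) summable_on {1..}"
    "S = k 0 + (\<Sum>\<^sub>\<infinity>l\<in>{1..}. k (int l) * qq \<tau> ^ l + k (- int l) * cnj (qq \<tau>) ^ l)"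
proof -
  define f where "f = (\<lambda>l. k l * qe \<tau> l)"
  have f: "f summable_on X" for X
    using summable_on_subset_banach[OF has_sum_imp_summable[OF assms]] by (simp add: f_def)
  have 1: "f (int l) = k (int l) * qq \<tau> ^ l" "f (- int l) = k (- int l) * cnj (qq \<tau>) ^ l" for l
    by (auto simp: f_def qe_def)
  have "(f \<circ> int) summable_on {1..}" "(f \<circ> (\<lambda>l. - int l)) summable_on {1..}"
    using f by (auto simp: summable_on_reindex[symmetric] inj_on_def)
  thus s: "(\<lambda>l. k (int l) * qq \<tau> ^ l) summable_on {1..}" "(\<lambda>l. k (- int l) * cnj (qq \<tau>) ^ l) summable_on {1..}"
    by (simp_all add: o_def 1)
  have "((\<lambda>l. f (int l)) has_sum (f 0 + (\<Sum>\<^sub>\<infinity>l\<in>{1..}. k (int l) * qq \<tau> ^ l))) UNIV"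
  proof -
    have "((\<lambda>l. f (int l)) has_sum (\<Sum>\<^sub>\<infinity>l\<in>{1..}. k (int l) * qq \<tau> ^ l)) {1..}"
      unfolding 1 by (rule has_sum_infsum[OF s(1)])
    hence "((\<lambda>l. f (int l)) has_sum (f (int 0) + (\<Sum>\<^sub>\<infinity>l\<in>{1..}. k (int l) * qq \<tau> ^ l))) (insert 0 {1..})"
      by (intro has_sum_insert) auto
    also have "insert 0 {1..} = (UNIV :: nat set)" by auto
    finally show ?thesis by simp
  qed
  moreover have "((\<lambda>l. f (- int l)) has_sum (\<Sum>\<^sub>\<infinity>l\<in>{1..}. k (- int l) * cnj (qq \<tau>) ^ l)) {1..}"
    unfolding 1 by (rule has_sum_infsum[OF s(2)])
  ultimately have "(f has_sum (f 0 + (\<Sum>\<^sub>\<infinity>l\<in>{1..}. k (int l) * qq \<tau> ^ l) + (\<Sum>\<^sub>\<infinity>l\<in>{1..}. k (- int l) * cnj (qq \<tau>) ^ l))) UNIV"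
    by (rule has_sum_int_split)
  hence "S = f 0 + (\<Sum>\<^sub>\<infinity>l\<in>{1..}. k (int l) * qq \<tau> ^ l) + (\<Sum>\<^sub>\<infinity>l\<in>{1..}. k (- int l) * cnj (qq \<tau>) ^ l)"
    using assms has_sum_unique unfolding f_def by blast
  also have "\<dots> = k 0 + (\<Sum>\<^sub>\<infinity>l\<in>{1..}. k (int l) * qq \<tau> ^ l + k (- int l) * cnj (qq \<tau>) ^ l)"
    by (subst infsum_add[OF s]) (simp add: f_def qe_def add_ac)
  finally show "S = k 0 + (\<Sum>\<^sub>\<infinity>l\<in>{1..}. k (int l) * qq \<tau> ^ l + k (- int l) * cnj (qq \<tau>) ^ l)" .
qed

lemma int_series_join:
  fixes k :: "int \<Rightarrow> complex"
  assumes s: "(\<lambda>l. k (int l) * qq \<tau> ^ l) summable_on {1..}" "(\<lambda>l. k (- int l) * cnj (qq \<tau>) ^ l) summable_on {1..}"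
  shows "((\<lambda>l. k l * qe \<tau> l) has_sum
    (k 0 + (\<Sum>\<^sub>\<infinity>l\<in>{1..}. k (int l) * qq \<tau> ^ l + k (- int l) * cnj (qq \<tau>) ^ l))) UNIV"
proof -
  define f where "f = (\<lambda>l. k l * qe \<tau> l)"
  have 1: "f (int l) = k (int l) * qq \<tau> ^ l" "f (- int l) = k (- int l) * cnj (qq \<tau>) ^ l" for l
    by (auto simp: f_def qe_def)
  have "((\<lambda>l. f (int l)) has_sum (f 0 + (\<Sum>\<^sub>\<infinity>l\<in>{1..}. k (int l) * qq \<tau> ^ l))) UNIV"
  proof -
    have "((\<lambda>l. f (int l)) has_sum (\<Sum>\<^sub>\<infinity>l\<in>{1..}. k (int l) * qq \<tau> ^ l)) {1..}"
      unfolding 1 by (rule has_sum_infsum[OF s(1)])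
    hence "((\<lambda>l. f (int l)) has_sum (f (int 0) + (\<Sum>\<^sub>\<infinity>l\<in>{1..}. k (int l) * qq \<tau> ^ l))) (insert 0 {1..})"
      by (intro has_sum_insert) auto
    also have "insert 0 {1..} = (UNIV :: nat set)" by auto
    finally show ?thesis by simp
  qed
  moreover have "((\<lambda>l. f (- int l)) has_sum (\<Sum>\<^sub>\<infinity>l\<in>{1..}. k (- int l) * cnj (qq \<tau>) ^ l)) {1..}"
    unfolding 1 by (rule has_sum_infsum[OF s(2)])
  ultimately have "(f has_sum (f 0 + (\<Sum>\<^sub>\<infinity>l\<in>{1..}. k (int l) * qq \<tau> ^ l) + (\<Sum>\<^sub>\<infinity>l\<in>{1..}. k (- int l) * cnj (qq \<tau>) ^ l))) UNIV"
    by (rule has_sum_int_split)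
  also have "f 0 + (\<Sum>\<^sub>\<infinity>l\<in>{1..}. k (int l) * qq \<tau> ^ l) + (\<Sum>\<^sub>\<infinity>l\<in>{1..}. k (- int l) * cnj (qq \<tau>) ^ l) =
     k 0 + (\<Sum>\<^sub>\<infinity>l\<in>{1..}. k (int l) * qq \<tau> ^ l + k (- int l) * cnj (qq \<tau>) ^ l)"
    by (subst infsum_add[OF s]) (simp add: f_def qe_def add_ac)
  finally show ?thesis by (simp add: f_def)
qed

lemma is_niebur_expansionD:
  assumes "is_niebur_expansion \<Gamma> n c" "Im \<tau> > 0"
  shows "((\<lambda>l. c l * qe \<tau> l) has_sum (niebur_j \<Gamma> n \<tau> - (inverse (qq \<tau>) ^ n - cnj (qq \<tau>) ^ n))) UNIV"
proof -
  have "\<tau> \<in> upper_half_plane" using assms by (simp add: upper_half_plane_def)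
  hence *: "(\<lambda>l. c (int l) * qq \<tau> ^ l) summable_on {1..}" "(\<lambda>l. c (- int l) * cnj (qq \<tau>) ^ l) summable_on {1..}"
     "niebur_j \<Gamma> n \<tau> = inverse (qq \<tau>) ^ n - cnj (qq \<tau>) ^ n + c 0 +
       (\<Sum>\<^sub>\<infinity>l\<in>{1..}. c (int l) * qq \<tau> ^ l + c (- int l) * cnj (qq \<tau>) ^ l)"
    using assms(1) unfolding is_niebur_expansion_def by blast+
  have "niebur_j \<Gamma> n \<tau> - (inverse (qq \<tau>) ^ n - cnj (qq \<tau>) ^ n) =
     c 0 + (\<Sum>\<^sub>\<infinity>l\<in>{1..}. c (int l) * qq \<tau> ^ l + c (- int l) * cnj (qq \<tau>) ^ l)"
    unfolding *(3) by simp
  thus ?thesis using int_series_join[OF *(1,2)] by simp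
qed

text \<open>Integration against e(-k x) on the line of height 1. The factor exp(-2 pi |k|) never
  vanishes, so this determines c k and makes the description of \<open>niebur_c\<close>
  unique.\<close>

lemma niebur_expansion_coeff:
  assumes "is_niebur_expansion \<Gamma> n c"
  shows "((\<lambda>x. (niebur_j \<Gamma> n (Complex x 1) - (inverse (qq (Complex x 1)) ^ n - cnj (qq (Complex x 1)) ^ n)) * ee (of_int (- k) * x))
    has_integral (c k * of_real (exp (- (2 * pi * real_of_int \<bar>k\<bar>))))) {0..1}"
proof -
  define A where "A = (\<lambda>l. c l * of_real (exp (- (2 * pi * real_of_int \<bar>l\<bar>))))"
  have sums: "((\<lambda>l. A l * ee (of_int l * x)) has_sum
     (niebur_j \<Gamma> n (Complex x 1) - (inverse (qq (Complex x 1)) ^ n - cnj (qq (Complex x 1)) ^ n))) UNIV" for x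
    using is_niebur_expansionD[OF assms, of "Complex x 1"] by (simp add: qe_Complex A_def mult.assoc)
  have "A summable_on UNIV" using has_sum_imp_summable[OF sums[of 0]] by simp
  hence A: "(\<lambda>l. cmod (A l)) summable_on UNIV"
    using summable_on_iff_abs_summable_on_complex by blast
  have "((\<lambda>x. (niebur_j \<Gamma> n (Complex x 1) - (inverse (qq (Complex x 1)) ^ n - cnj (qq (Complex x 1)) ^ n)) * ee (of_int (- k) * x))
    has_integral A k) {0..1}"
  proof (rule has_integral_series[OF A, where E = "\<lambda>l x. ee (of_int (l - k) * x)"])
    show "((\<lambda>x. ee (of_int (l - k) * x)) has_integral (if l = k then 1 else 0)) {0..1}" for l
      using has_integral_ee[of "l - k"] by simp
    fix x
    have "((\<lambda>l. A l * ee (of_int l * x) * ee (of_int (- k) * x)) has_sum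
      ((niebur_j \<Gamma> n (Complex x 1) - (inverse (qq (Complex x 1)) ^ n - cnj (qq (Complex x 1)) ^ n)) * ee (of_int (- k) * x))) UNIV"
      by (intro has_sum_cmult_left sums)
    also have "(\<lambda>l. A l * ee (of_int l * x) * ee (of_int (- k) * x)) = (\<lambda>l. A l * ee (of_int (l - k) * x))"
      unfolding mult.assoc ee_add [symmetric] by (simp add: algebra_simps)
    finally show "((\<lambda>l. A l * ee (of_int (l - k) * x)) has_sum
      ((niebur_j \<Gamma> n (Complex x 1) - (inverse (qq (Complex x 1)) ^ n - cnj (qq (Complex x 1)) ^ n)) * ee (of_int (- k) * x))) UNIV" .
  qed (auto intro!: continuous_intros)
  thus ?thesis by (simp add: A_def)
qed

lemma is_niebur_expansion_niebur_c:
  assumes "is_niebur_expansion \<Gamma> n c"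
  shows "is_niebur_expansion \<Gamma> n (niebur_c \<Gamma> n)"
  unfolding niebur_c_def
proof (rule theI[of "is_niebur_expansion \<Gamma> n" c, OF assms])
  fix c' assume c': "is_niebur_expansion \<Gamma> n c'"
  show "c' = c"
  proof
    fix k
    have "c' k * of_real (exp (- (2 * pi * real_of_int \<bar>k\<bar>))) = c k * of_real (exp (- (2 * pi * real_of_int \<bar>k\<bar>)))"
      by (rule has_integral_unique[OF niebur_expansion_coeff[OF c'] niebur_expansion_coeff[OF assms]])
    thus "c' k = c k" by simp
  qed
qed

text \<open>On a horizontal line q^(-n) - (cnj q)^n is a multiple of e(-n x), so the principal part
  changes only the coefficient at l = -n; as n is positive, the constant coefficient is
  unaffected.\<close>

lemma niebur_j_fourier:
  assumes ex: "is_niebur_expansion \<Gamma> n c" and n: "n \<ge> 1" and y: "y > 0"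
  obtains A where "(\<lambda>l. cmod (A l)) summable_on UNIV" "A 0 = niebur_c \<Gamma> n 0"
    "\<And>x. ((\<lambda>l. A l * ee (of_int l * x)) has_sum niebur_j \<Gamma> n (Complex x y)) UNIV"
proof -
  define C where "C = niebur_c \<Gamma> n"
  define d where "d = (exp (2 * pi * real n * y) - exp (- (2 * pi * real n * y)))"
  define A where "A = (\<lambda>l. C l * of_real (exp (- (2 * pi * real_of_int \<bar>l\<bar> * y))) + (if l = - int n then of_real d else 0))"
  have sums: "((\<lambda>l. A l * ee (of_int l * x)) has_sum niebur_j \<Gamma> n (Complex x y)) UNIV" for x
  proof -
    define q where "q = qq (Complex x y)"
    have "((\<lambda>l. C l * qe (Complex x y) l) has_sum (niebur_j \<Gamma> n (Complex x y) - (inverse q ^ n - cnj q ^ n))) UNIV"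
      unfolding C_def q_def by (rule is_niebur_expansionD[OF is_niebur_expansion_niebur_c[OF ex]]) (use y in simp)
    moreover have "((\<lambda>l. (if l = - int n then of_real d else 0) * ee (of_int l * x)) has_sum (of_real d * ee (- real n * x))) UNIV"
    proof -
      have "((\<lambda>l. (if l = - int n then of_real d else 0) * ee (of_int l * x)) has_sum (of_real d * ee (- real n * x))) {- int n}"
        by (rule has_sum_finiteI) auto
      thus ?thesis by (subst has_sum_cong_neutral[where T = "{- int n}"]) auto
    qed
    ultimately have "((\<lambda>l. C l * qe (Complex x y) l + (if l = - int n then of_real d else 0) * ee (of_int l * x)) has_sum
      (niebur_j \<Gamma> n (Complex x y) - (inverse q ^ n - cnj q ^ n) + of_real d * ee (- real n * x))) UNIV"
      by (rule has_sum_add)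
    also have "(\<lambda>l. C l * qe (Complex x y) l + (if l = - int n then of_real d else 0) * ee (of_int l * x)) = (\<lambda>l. A l * ee (of_int l * x))"
      by (simp add: fun_eq_iff qe_Complex A_def algebra_simps)
    also have "inverse q ^ n - cnj q ^ n = of_real d * ee (- real n * x)"
      unfolding q_def inverse_qq_power cnj_qq_power by (simp add: d_def algebra_simps)
    finally show ?thesis by simp
  qed
  have "A summable_on UNIV" using has_sum_imp_summable[OF sums[of 0]] by simp
  hence A: "(\<lambda>l. cmod (A l)) summable_on UNIV"
    using summable_on_iff_abs_summable_on_complex by blast
  show ?thesis by (rule that[OF A _ sums]) (use n in \<open>simp add: A_def C_def\<close>)
qed

lemma niebur_j_integral:
  assumes ex: "is_niebur_expansion \<Gamma> n c" and n: "n \<ge> 1" and y: "y > 0"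
  shows "((\<lambda>x. niebur_j \<Gamma> n (Complex x y)) has_integral niebur_c \<Gamma> n 0) {0..1}"
proof -
  obtain A where A: "(\<lambda>l. cmod (A l)) summable_on UNIV" "A 0 = niebur_c \<Gamma> n 0"
    "\<And>x. ((\<lambda>l. A l * ee (of_int l * x)) has_sum niebur_j \<Gamma> n (Complex x y)) UNIV"
    using niebur_j_fourier[OF assms] by blast
  show ?thesis unfolding A(2)[symmetric]
    by (rule has_integral_series[OF A(1) _ _ has_integral_ee A(3)]) (auto intro!: continuous_intros)
qed

lemma niebur_j_integral_scaled:
  assumes ex: "is_niebur_expansion \<Gamma> n c" and n: "n \<ge> 1" and y: "y > 0" and p: "p > 0"
  shows "((\<lambda>x. niebur_j \<Gamma> n (of_nat p * Complex x y)) has_integral niebur_c \<Gamma> n 0) {0..1}"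
proof -
  obtain A where A: "(\<lambda>l. cmod (A l)) summable_on UNIV" "A 0 = niebur_c \<Gamma> n 0"
    "\<And>x. ((\<lambda>l. A l * ee (of_int l * x)) has_sum niebur_j \<Gamma> n (Complex x (real p * y))) UNIV"
    using niebur_j_fourier[OF ex n, of "real p * y"] y p by auto
  have eq: "of_nat p * Complex x y = Complex (real p * x) (real p * y)" for x
    by (simp add: complex_eq_iff)
  show ?thesis unfolding A(2)[symmetric] eq
  proof (rule has_integral_series[OF A(1) _ _ _ A(3)])
    show "((\<lambda>x. ee (of_int l * (real p * x))) has_integral (if l = 0 then 1 else 0)) {0..1}" for l
      using has_integral_ee[of "l * int p"] p by (simp add: mult.assoc)
  qed (auto intro!: continuous_intros)
qed

text \<open>The mean over i removes the frequencies not divisible by p and turns l into l / p. The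
  constant term survives alone in the integral, multiplied by the number p of summands.\<close>

lemma niebur_j_integral_U_star:
  assumes ex: "is_niebur_expansion \<Gamma> n c" and n: "n \<ge> 1" and y: "y > 0" and p: "p > 0"
  shows "((\<lambda>x. U_star p (niebur_j \<Gamma> n) (Complex x y)) has_integral (of_nat p * niebur_c \<Gamma> n 0)) {0..1}"
proof -
  obtain A where A: "(\<lambda>l. cmod (A l)) summable_on UNIV" "A 0 = niebur_c \<Gamma> n 0"
    "\<And>x. ((\<lambda>l. A l * ee (of_int l * x)) has_sum niebur_j \<Gamma> n (Complex x (y / real p))) UNIV"
    using niebur_j_fourier[OF ex n, of "y / real p"] y p by auto
  define E where "E = (\<lambda>l x. (\<Sum>i<p. ee (of_int l * ((x + real i) / real p))) / of_nat p)"
  have eq: "(Complex x y + of_nat i) / of_nat p = Complex ((x + real i) / real p) (y / real p)" for x i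
    using p by (simp add: complex_eq_iff Re_divide_of_nat Im_divide_of_nat)
  have E: "E l x = (if int p dvd l then ee (of_int (l div int p) * x) else 0)" for l x
  proof -
    have "(\<Sum>i<p. ee (of_int l * ((x + real i) / real p))) = (\<Sum>i<p. ee (of_int l * x / real p) * ec p (l * int i))"
      by (intro sum.cong refl) (simp add: ec_def ee_add [symmetric] ring_distribs add_divide_distrib)
    also have "\<dots> = ee (of_int l * x / real p) * (if int p dvd l then of_nat p else 0)"
      by (simp only: sum_distrib_left [symmetric] sum_ec[OF p])
    finally have "E l x = (if int p dvd l then ee (of_int l * x / real p) else 0)"
      using p by (simp add: E_def)
    moreover have "of_int l * x / real p = of_int (l div int p) * x" if "int p dvd l"
      using that p by (auto elim!: dvdE)
    ultimately show ?thesis by auto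
  qed
  have "((\<lambda>x. U_star p (niebur_j \<Gamma> n) (Complex x y) / of_nat p) has_integral A 0) {0..1}"
  proof (rule has_integral_series[OF A(1), where E = E])
    show "continuous_on {0..1} (E l)" for l unfolding E_def using p by (intro continuous_intros) auto
    show "cmod (E l x) \<le> 1" for l x unfolding E by simp
    show "(E l has_integral (if l = 0 then 1 else 0)) {0..1}" for l
    proof (cases "int p dvd l")
      case True
      hence "l div int p = 0 \<longleftrightarrow> l = 0" using p by auto
      thus ?thesis using has_integral_ee[of "l div int p"] True by (simp add: E[abs_def])
    next
      case False
      moreover have "l \<noteq> 0" using False by auto
      ultimately show ?thesis by (simp add: E[abs_def])
    qed
    fix x
    have "((\<lambda>l. \<Sum>i<p. A l * ee (of_int l * ((x + real i) / real p))) has_sum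
       (\<Sum>i<p. niebur_j \<Gamma> n (Complex ((x + real i) / real p) (y / real p)))) UNIV"
      by (intro has_sum_finite_sum A(3))
    hence "((\<lambda>l. (\<Sum>i<p. A l * ee (of_int l * ((x + real i) / real p))) / of_nat p) has_sum
       ((\<Sum>i<p. niebur_j \<Gamma> n (Complex ((x + real i) / real p) (y / real p))) / of_nat p)) UNIV"
      by (rule has_sum_divide_const)
    thus "((\<lambda>l. A l * E l x) has_sum (U_star p (niebur_j \<Gamma> n) (Complex x y) / of_nat p)) UNIV"
      by (simp add: E_def U_star_def eq sum_distrib_left)
  qed
  from has_integral_mult_right[OF this, of "of_nat p"] show ?thesis using p by (simp add: A(2))
qed

text \<open>The form in which the convention on S is used: closure under \<open>al_star\<close>,
  unlike maximality, is read off the set itself and passes directly to the plicate level.\<close>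

definition al_closed :: "nat \<Rightarrow> nat set \<Rightarrow> bool" where
  "al_closed N S \<longleftrightarrow> N \<ge> 1 \<and> S \<subseteq> exact_divisors N - {1} \<and>
     (\<forall>Q\<in>insert 1 S. \<forall>R\<in>insert 1 S. al_star Q R \<in> insert 1 S)"

section \<open>Continuation and expansion for the group\<close>

definition niebur_cont :: "nat \<Rightarrow> nat set \<Rightarrow> nat \<Rightarrow> complex \<Rightarrow> complex \<Rightarrow> complex" where
  "niebur_cont N S n \<tau> s = 2 * of_real pi * (niebur_f n s \<tau> +
     (\<Sum>Q\<in>insert 1 S. ncont (al_weight Q (N div Q) n) (real n / real Q) \<tau> s))"

lemma al_closedD:
  assumes "al_closed N S"
  shows "N \<ge> 1" "finite (insert 1 S)" "S \<subseteq> exact_divisors N" "\<And>Q. Q \<in> insert 1 S \<Longrightarrow> Q \<ge> 1"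
    "\<And>Q. Q \<in> insert 1 S \<Longrightarrow> Q \<in> exact_divisors N"
    "\<And>Q R. Q \<in> insert 1 S \<Longrightarrow> R \<in> insert 1 S \<Longrightarrow> al_star Q R \<in> insert 1 S"
proof -
  show N: "N \<ge> 1" and S: "S \<subseteq> exact_divisors N" using assms by (auto simp: al_closed_def)
  show "finite (insert 1 S)" using finite_subset[OF S finite_exact_divisors[OF N]] by simp
  show ex: "Q \<in> exact_divisors N" if "Q \<in> insert 1 S" for Q using that S one_exact[OF N] by auto
  show "Q \<ge> 1" if "Q \<in> insert 1 S" for Q
    using ex[OF that] N by (auto simp: exact_divisors_def Suc_le_eq intro!: gr0I)
  show "al_star Q R \<in> insert 1 S" if "Q \<in> insert 1 S" "R \<in> insert 1 S" for Q R
    using assms that unfolding al_closed_def by blast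
qed

lemma niebur_f_eq_bes:
  assumes "n \<ge> 1" "Im \<tau> > 0" "Re s > 0"
  shows "niebur_f n s \<tau> = ee (- real n * Re \<tau>) * (of_real (real n * Im \<tau>) powr s * bes s (real n * Im \<tau>))"
  using bessel_I_eq_bes[of "real n * Im \<tau>" s] assms by (simp add: niebur_f_def mult.assoc)

lemma niebur_cont_holomorphic:
  assumes "al_closed N S" "n \<ge> 1" "Im \<tau> > 0"
  shows "niebur_cont N S n \<tau> holomorphic_on {s. Re s > 15 / 16}"
proof -
  note D = al_closedD[OF assms(1)]
  have "(\<lambda>s. ee (- real n * Re \<tau>) * (of_real (real n * Im \<tau>) powr s * bes s (real n * Im \<tau>))) holomorphic_on {s. Re s > 15 / 16}"
    using assms by (intro holomorphic_intros holomorphic_on_subset[OF bes_holomorphic]) auto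
  hence "(\<lambda>s. niebur_f n s \<tau>) holomorphic_on {s. Re s > 15 / 16}"
    by (rule holomorphic_transform) (use assms niebur_f_eq_bes in auto)
  moreover have "ncont (al_weight Q (N div Q) n) (real n / real Q) \<tau> holomorphic_on {s. Re s > 15 / 16}"
    if "Q \<in> insert 1 S" for Q
    using niebur_weight.ncont_holomorphic[OF al_weight_niebur_weight[OF D(4)[OF that] assms(2)] assms(3)] .
  ultimately show ?thesis unfolding niebur_cont_def by (intro holomorphic_intros) auto
qed

lemma niebur_G_eq_cont:
  assumes "al_closed N S" "n \<ge> 1" "Im \<tau> > 0" "Re s > 1"
  shows "niebur_G (Gamma_plus N S) n \<tau> s = niebur_cont N S n \<tau> s"
proof -
  note D = al_closedD[OF assms(1)]
  have "al_sum Q (N div Q) (niebur_f n s) \<tau> = (if Q = 1 then niebur_f n s \<tau> else 0) +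
     ncont (al_weight Q (N div Q) n) (real n / real Q) \<tau> s" if "Q \<in> insert 1 S" for Q
    unfolding al_sum_def by (rule infsumI, rule has_sum_al[OF D(4)[OF that] assms(2-4)])
  hence "(\<Sum>Q\<in>insert 1 S. al_sum Q (N div Q) (niebur_f n s) \<tau>) =
    (\<Sum>Q\<in>insert 1 S. (if Q = 1 then niebur_f n s \<tau> else 0) +
     ncont (al_weight Q (N div Q) n) (real n / real Q) \<tau> s)"
    by (rule sum.cong[OF refl])
  also have "\<dots> = niebur_f n s \<tau> + (\<Sum>Q\<in>insert 1 S. ncont (al_weight Q (N div Q) n) (real n / real Q) \<tau> s)"
    unfolding sum.distrib using D(2) by (subst sum.delta) auto
  finally show ?thesis
    using niebur_G_eq_sum[OF D(1,3,6) assms(2-4)] by (simp add: niebur_cont_def)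
qed

text \<open>The half-planes may differ; the identity theorem is applied on their intersection, which
  is connected and contains 1. It yields both the uniqueness in the definition of
  \<open>niebur_j\<close> and the passage of the Hecke identity to s = 1.\<close>

lemma half_plane_continuation_unique:
  assumes "g holomorphic_on {s. Re s > \<sigma>}" "h holomorphic_on {s. Re s > \<sigma>'}" "\<sigma> < 1" "\<sigma>' < 1"
    "\<And>s. Re s > 1 \<Longrightarrow> g s = h s"
  shows "g 1 = h 1"
proof -
  define U where "U = {s. Re s > max \<sigma> \<sigma>'}"
  have "open U" "connected U"
    unfolding U_def by (intro open_halfspace_Re_gt convex_connected convex_halfspace_Re_gt)+
  moreover have "1 \<in> U" using assms(3,4) by (simp add: U_def)
  ultimately have U: "open U" "connected U" "1 \<in> U" .
  show ?thesis
  proof (rule analytic_continuation_open[where s = "{s. Re s > 1}" and s' = U and f = g and g = h])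
    show "{s. Re s > 1} \<noteq> {}" by (auto intro: exI[of _ 2])
    show "{s. Re s > 1} \<subseteq> U" using assms(3,4) by (auto simp: U_def)
    show "g holomorphic_on U" "h holomorphic_on U"
      by (rule holomorphic_on_subset[OF assms(1)] holomorphic_on_subset[OF assms(2)]; auto simp: U_def)+
  qed (use U assms in \<open>auto simp: open_halfspace_Re_gt\<close>)
qed

lemma niebur_j_eq_cont:
  assumes "al_closed N S" "n \<ge> 1" "Im \<tau> > 0"
  shows "niebur_j (Gamma_plus N S) n \<tau> = niebur_cont N S n \<tau> 1"
  unfolding niebur_j_def
proof (rule the_equality)
  show "\<exists>\<sigma><1. \<exists>g. g holomorphic_on {s. Re s > \<sigma>} \<and>
     (\<forall>s. Re s > 1 \<longrightarrow> g s = niebur_G (Gamma_plus N S) n \<tau> s) \<and> niebur_cont N S n \<tau> 1 = g 1"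
    by (rule exI[of _ "15 / 16"], intro conjI exI[of _ "niebur_cont N S n \<tau>"])
       (use niebur_cont_holomorphic[OF assms] niebur_G_eq_cont[OF assms] in auto)
next
  fix v assume "\<exists>\<sigma><1. \<exists>g. g holomorphic_on {s. Re s > \<sigma>} \<and>
     (\<forall>s. Re s > 1 \<longrightarrow> g s = niebur_G (Gamma_plus N S) n \<tau> s) \<and> v = g 1"
  then obtain \<sigma> g where g: "\<sigma> < 1" "g holomorphic_on {s. Re s > \<sigma>}"
     "\<And>s. Re s > 1 \<Longrightarrow> g s = niebur_G (Gamma_plus N S) n \<tau> s" "v = g 1" by blast
  show "v = niebur_cont N S n \<tau> 1" unfolding g(4)
    by (rule half_plane_continuation_unique[OF g(2) niebur_cont_holomorphic[OF assms] g(1)])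
       (use g(3) niebur_G_eq_cont[OF assms] in auto)
qed

lemma niebur_f_1:
  assumes "n \<ge> 1" "Im \<tau> > 0"
  shows "2 * of_real pi * niebur_f n 1 \<tau> = inverse (qq \<tau>) ^ n - cnj (qq \<tau>) ^ n"
proof -
  define Y where "Y = real n * Im \<tau>"
  have Y: "Y > 0" using assms by (simp add: Y_def)
  have "2 * of_real pi * niebur_f n 1 \<tau> = 2 * of_real pi * (ee (- real n * Re \<tau>) * (of_real Y * bes 1 Y))"
    using niebur_f_eq_bes[OF assms, of 1] Y by (simp add: Y_def)
  also have "\<dots> = ee (- real n * Re \<tau>) * of_real (2 * sinh (2 * pi * Y))"
    unfolding bes_1[OF Y] by simp
  also have "\<dots> = ee (- real n * Re \<tau>) * of_real (exp (2 * pi * Y)) - ee (- real n * Re \<tau>) * of_real (exp (- (2 * pi * Y)))"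
    by (simp add: sinh_def algebra_simps)
  finally show ?thesis unfolding inverse_qq_power cnj_qq_power by (simp add: Y_def mult_ac)
qed

text \<open>The finitely many Q are expanded separately and added; the principal part comes from the
  identity coset alone, through \<open>niebur_f_1\<close>.\<close>

lemma niebur_expansion_exists:
  assumes "al_closed N S" "n \<ge> 1"
  shows "\<exists>c. is_niebur_expansion (Gamma_plus N S) n c"
proof -
  note D = al_closedD[OF assms(1)]
  have "\<exists>k. \<forall>\<tau>. Im \<tau> > 0 \<longrightarrow> ((\<lambda>l. k l * qe \<tau> l) has_sum
      (2 * of_real pi * ncont (al_weight Q (N div Q) n) (real n / real Q) \<tau> 1)) UNIV" if "Q \<in> insert 1 S" for Q
    using niebur_weight.ncont_1_expansion[OF al_weight_niebur_weight[OF D(4)[OF that] assms(2)]] by metis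
  then obtain k where k: "\<And>Q \<tau>. Q \<in> insert 1 S \<Longrightarrow> Im \<tau> > 0 \<Longrightarrow> ((\<lambda>l. k Q l * qe \<tau> l) has_sum
      (2 * of_real pi * ncont (al_weight Q (N div Q) n) (real n / real Q) \<tau> 1)) UNIV"
    by metis
  define c where "c = (\<lambda>l. \<Sum>Q\<in>insert 1 S. k Q l)"
  have "is_niebur_expansion (Gamma_plus N S) n c"
    unfolding is_niebur_expansion_def
  proof
    fix \<tau> assume "\<tau> \<in> upper_half_plane"
    hence \<tau>: "Im \<tau> > 0" by (simp add: upper_half_plane_def)
    define T where "T = (\<Sum>Q\<in>insert 1 S. 2 * of_real pi * ncont (al_weight Q (N div Q) n) (real n / real Q) \<tau> 1)"
    have "((\<lambda>l. \<Sum>Q\<in>insert 1 S. k Q l * qe \<tau> l) has_sum T) UNIV"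
      unfolding T_def by (intro has_sum_finite_sum k \<tau>)
    hence "((\<lambda>l. c l * qe \<tau> l) has_sum T) UNIV" by (simp only: c_def sum_distrib_right)
    note X = int_series_split[OF this]
    have "niebur_j (Gamma_plus N S) n \<tau> = 2 * of_real pi * niebur_f n 1 \<tau> + T"
      unfolding niebur_j_eq_cont[OF assms \<tau>] niebur_cont_def T_def sum_distrib_left [symmetric] by (rule distrib_left)
    thus "(\<lambda>l. c (int l) * qq \<tau> ^ l) summable_on {1..} \<and>
     (\<lambda>l. c (- int l) * cnj (qq \<tau>) ^ l) summable_on {1..} \<and>
     niebur_j (Gamma_plus N S) n \<tau> = inverse (qq \<tau>) ^ n - cnj (qq \<tau>) ^ n + c 0 +
       (\<Sum>\<^sub>\<infinity>l\<in>{1..}. c (int l) * qq \<tau> ^ l + c (- int l) * cnj (qq \<tau>) ^ l)"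
      using X unfolding niebur_f_1[OF assms(2) \<tau>] by (simp add: add.assoc)
  qed
  thus ?thesis by blast
qed

section \<open>The Hecke correspondence\<close>

text \<open>The tuple \<open>(x, y, c, d)\<close> stands for the matrix \<open>(Q x, y; Q c, Q d)\<close>, and \<open>tshift\<close> is
  multiplication by \<open>(1 t; 0 1)\<close> on the left.\<close>

definition tshift :: "nat \<Rightarrow> int \<Rightarrow> int \<times> int \<times> int \<times> int \<Rightarrow> int \<times> int \<times> int \<times> int" where
  "tshift Q t = (\<lambda>(x, y, c, d). (x + t * c, y + t * (int Q * d), c, d))"

definition torbit :: "nat \<Rightarrow> int \<times> int \<times> int \<times> int \<Rightarrow> (int \<times> int \<times> int \<times> int) set" where
  "torbit Q T = range (\<lambda>t. tshift Q t T)"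

text \<open>The matrices (Q x, y; Q c, Q d) of determinant Q r, normalised in sign; r = p is the
  case used.\<close>

definition tmats :: "nat \<Rightarrow> nat \<Rightarrow> int \<Rightarrow> (int \<times> int \<times> int \<times> int) set" where
  "tmats Q M r = {(x, y, c, d). int Q * x * d - y * c = r \<and> int M dvd c \<and> (c > 0 \<or> c = 0 \<and> d > 0)}"

lemma tshift_0 [simp]: "tshift Q 0 T = T"
  by (simp add: tshift_def split: prod.splits)

lemma tshift_tshift: "tshift Q s (tshift Q t T) = tshift Q (s + t) T"
  by (simp add: tshift_def algebra_simps split: prod.splits)

lemma torbit_self: "T \<in> torbit Q T"
  unfolding torbit_def by (rule range_eqI[of _ _ 0]) simp

lemma torbit_tshift [simp]: "torbit Q (tshift Q t T) = torbit Q T"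
proof -
  have "tshift Q s T \<in> range (\<lambda>x. tshift Q (x + t) T)" for s
    by (rule range_eqI[of _ _ "s - t"]) simp
  thus ?thesis unfolding torbit_def tshift_tshift by blast
qed

lemma torbit_eq_iff: "torbit Q T = torbit Q T' \<longleftrightarrow> (\<exists>t. T' = tshift Q t T)"
proof
  assume "torbit Q T = torbit Q T'"
  hence "T' \<in> torbit Q T" using torbit_self by blast
  thus "\<exists>t. T' = tshift Q t T" by (auto simp: torbit_def)
qed auto

lemma al_point_tshift:
  assumes "Im \<tau> > 0" "Q > 0" "c \<noteq> 0 \<or> d \<noteq> 0"
  shows "al_point Q (tshift Q t (x, y, c, d)) \<tau> = al_point Q (x, y, c, d) \<tau> + of_int t"
proof -
  have "complex_of_int c * \<tau> + of_int d \<noteq> 0"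
  proof -
    have "real_of_int c \<noteq> 0 \<or> real_of_int d \<noteq> 0" using assms(3) by simp
    thus ?thesis using lattice_bound[OF assms(1), of "of_int c" "of_int d"] lattice_const_pos[OF assms(1)]
      by (auto simp: mult_le_0_iff)
  qed
  thus ?thesis using assms(2) by (simp add: al_point_def tshift_def divide_simps) (simp add: algebra_simps)
qed

lemma det_1_unique:
  fixes q x y x' y' c d :: int
  assumes "q * x * d - y * c = 1" "q * x' * d - y' * c = 1"
  obtains t where "x' = x + t * c" "y' = y + t * (q * d)"
proof -
  \<comment> \<open>The upper right entry of A' A^(-1) for A = (x, y; c, q d) and A' = (x', y'; c, q
    d).\<close>
  define t where "t = y' * x - x' * y"
  have "x + t * c = x * (q * x' * d) - x' * y * c + x * (1 - (q * x' * d - y' * c))"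
    by (simp add: t_def algebra_simps)
  also have "\<dots> = x' * (q * x * d - y * c)" unfolding assms(2) by (simp add: algebra_simps)
  finally have "x' = x + t * c" using assms(1) by simp
  moreover have "y + t * (q * d) = y' * (q * x * d - y * c) - y * (q * x' * d - y' * c) + y"
    by (simp add: t_def algebra_simps)
  hence "y' = y + t * (q * d)" using assms by simp
  ultimately show ?thesis by (rule that)
qed

lemma det_1_coprime: "int Q * x * d - y * c = 1 \<Longrightarrow> coprime (int Q * d) c"
proof (rule coprimeI)
  fix k assume *: "int Q * x * d - y * c = 1" "k dvd int Q * d" "k dvd c"
  have "k dvd (int Q * d) * x - y * c" using *(2,3) by (intro dvd_diff) auto
  also have "(int Q * d) * x - y * c = 1" using *(1) by (simp add: mult_ac)
  finally show "is_unit k" .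
qed

lemma al_lift_shift:
  assumes "int Q * x * d - y * c = 1"
  obtains t where "al_lift Q (c, d) = tshift Q t (x, y, c, d)"
proof -
  obtain x' y' where l: "al_lift Q (c, d) = (x', y', c, d)" "int Q * x' * d - y' * c = 1"
    by (rule al_liftE[OF det_1_coprime[OF assms]])
  obtain t where "x' = x + t * c" "y' = y + t * (int Q * d)"
    by (rule det_1_unique[OF assms l(2)])
  thus ?thesis using l(1) by (intro that[of t]) (simp add: tshift_def)
qed

text \<open>Products of a representative with \<open>(1 i; 0 p)\<close> and \<open>(p 0; 0 1)\<close> on the right, and with
  \<open>(p 0; 0 1)\<close> and \<open>(1 j; 0 p)\<close> on the left.\<close>

definition hecke_L1 :: "nat \<Rightarrow> nat \<Rightarrow> nat \<times> int \<times> int \<Rightarrow> int \<times> int \<times> int \<times> int" where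
  "hecke_L1 p Q = (\<lambda>(i, v). case al_lift Q v of (x, y, c, d) \<Rightarrow>
     (x, int Q * x * int i + int p * y, c, c * int i + int p * d))"

definition hecke_L2 :: "nat \<Rightarrow> nat \<Rightarrow> int \<times> int \<Rightarrow> int \<times> int \<times> int \<times> int" where
  "hecke_L2 p Q v = (case al_lift Q v of (x, y, c, d) \<Rightarrow> (int p * x, y, int p * c, d))"

definition hecke_R1 :: "nat \<Rightarrow> nat \<Rightarrow> int \<times> int \<Rightarrow> int \<times> int \<times> int \<times> int" where
  "hecke_R1 p Q v = (case al_lift Q v of (x, y, c, d) \<Rightarrow> (int p * x, int p * y, c, d))"

definition hecke_R2 :: "nat \<Rightarrow> nat \<Rightarrow> nat \<times> int \<times> int \<Rightarrow> int \<times> int \<times> int \<times> int" where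
  "hecke_R2 p Q = (\<lambda>(j, v). case al_lift Q v of (x, y, c, d) \<Rightarrow>
     (x + int j * c, y + int j * (int Q * d), int p * c, int p * d))"

lemma al_indexE:
  assumes "v \<in> al_index Q M"
  obtains x y c d where "v = (c, d)" "al_lift Q (c, d) = (x, y, c, d)" "int Q * x * d - y * c = 1"
    "int M dvd c" "c > 0 \<or> c = 0 \<and> d > 0"
proof -
  obtain c d where v: "v = (c, d)" "c > 0 \<or> c = 0 \<and> d > 0" "int M dvd c" "coprime (int Q * d) c"
    using assms by (auto simp: al_index_def)
  obtain x y where "al_lift Q (c, d) = (x, y, c, d)" "int Q * x * d - y * c = 1" by (rule al_liftE[OF v(4)])
  thus ?thesis using that v by auto
qed

lemma al_indexI:
  assumes "int Q * x * d - y * c = 1" "int M dvd c" "c > 0 \<or> c = 0 \<and> d > 0"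
  shows "(c, d) \<in> al_index Q M"
  using assms det_1_coprime[OF assms(1)] by (auto simp: al_index_def)

section \<open>Factorisations of the matrices with r = p\<close>

context
  fixes p Q M M' :: nat
  assumes p: "prime p" and Q: "Q > 0" and M: "M > 0"
  assumes M': "M' = M div gcd p M"
begin

lemma p_pos: "p > 0" using p prime_gt_0_nat by blast

lemma p_prime_int: "prime (int p)" using p by simp

text \<open>This is where the plicate level comes from: once the lower left entry is multiplied by
  p, divisibility by M is divisibility by M / gcd(p, M).\<close>

lemma dvd_M'_iff: "int M dvd int p * c \<longleftrightarrow> int M' dvd c"
proof (cases "p dvd M")
  case True
  then obtain m where m: "M = p * m" by auto
  have "M' = m" using p_pos by (simp add: M' m)
  thus ?thesis using p_pos by (simp add: m)
next
  case False
  hence "coprime p M" using p by (simp add: prime_imp_coprime)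
  hence "M' = M" "coprime (int M) (int p)" by (simp_all add: M' coprime_commute)
  thus ?thesis by (simp add: coprime_dvd_mult_right_iff)
qed

lemma solve_mod_p:
  assumes "\<not> int p dvd a"
  obtains i where "i < p" "int p dvd b - a * int i"
proof -
  have cop: "coprime a (int p)" using assms p_prime_int by (metis coprime_commute prime_imp_coprime)
  define i where "i = nat ((modular_inverse (int p) a * b) mod int p)"
  have i: "int i = (modular_inverse (int p) a * b) mod int p" using p_pos by (simp add: i_def)
  have "[a * int i = a * (modular_inverse (int p) a * b)] (mod int p)"
    unfolding i by (simp add: cong_def mod_mult_right_eq)
  also have "a * (modular_inverse (int p) a * b) = (a * modular_inverse (int p) a) * b" by simp
  also have "[(a * modular_inverse (int p) a) * b = 1 * b] (mod int p)"
    by (intro cong_mult cong_refl cong_modular_inverse1 cop)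
  finally have "int p dvd b - a * int i" by (simp add: cong_iff_dvd_diff dvd_diff_commute)
  moreover have "int i < int p" unfolding i using p_pos by simp
  ultimately show ?thesis using that[of i] by simp
qed

text \<open>Equality of orbits makes p divide both c (j - i) and Q x' (j - i); the determinant
  relation combines these to j - i itself, and both indices lie below p.\<close>

lemma inj_L1: "inj_on (\<lambda>v. torbit Q (hecke_L1 p Q v)) ({..<p} \<times> al_index Q M)"
proof (rule inj_onI)
  fix u v assume *: "u \<in> {..<p} \<times> al_index Q M" "v \<in> {..<p} \<times> al_index Q M"
    "torbit Q (hecke_L1 p Q u) = torbit Q (hecke_L1 p Q v)"
  obtain i u' where u: "u = (i, u')" "i < p" "u' \<in> al_index Q M" using *(1) by auto
  obtain j v' where v: "v = (j, v')" "j < p" "v' \<in> al_index Q M" using *(2) by auto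
  obtain x y c d where u': "u' = (c, d)" "al_lift Q (c, d) = (x, y, c, d)" "int Q * x * d - y * c = 1"
    by (rule al_indexE[OF u(3)])
  obtain x' y' c' d' where v': "v' = (c', d')" "al_lift Q (c', d') = (x', y', c', d')" "int Q * x' * d' - y' * c' = 1"
    by (rule al_indexE[OF v(3)])
  obtain t where t: "hecke_L1 p Q v = tshift Q t (hecke_L1 p Q u)" using *(3) by (auto simp: torbit_eq_iff)
  have c: "c' = c" and d: "c * int j + int p * d' = c * int i + int p * d" and x: "x' = x + t * c"
    and y: "int Q * x' * int j + int p * y' = int Q * x * int i + int p * y + t * (int Q * (c * int i + int p * d))"
    using t by (auto simp: hecke_L1_def u v u' v' tshift_def)
  have 1: "c * (int j - int i) = int p * (d - d')" using d by (simp add: algebra_simps)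
  have 2: "int Q * x' * (int j - int i) = int p * (y + t * int Q * d - y')" using y by (simp add: x algebra_simps)
  have "int j - int i = (int Q * x' * d' - y' * c') * (int j - int i)" using v'(3) by simp
  also have "\<dots> = d' * (int Q * x' * (int j - int i)) - y' * (c * (int j - int i))" by (simp add: c algebra_simps)
  also have "\<dots> = int p * (d' * (y + t * int Q * d - y') - y' * (d - d'))" unfolding 1 2 by (simp add: algebra_simps)
  finally have "int p dvd int j - int i" by simp
  hence "int j mod int p = int i mod int p" by (simp add: mod_eq_dvd_iff)
  hence ij: "i = j" using u(2) v(2) by simp
  hence "d = d'" using 1 p_pos by simp
  thus "u = v" using ij c by (simp add: u v u' v')
qed

lemma inj_L2: "inj_on (\<lambda>v. torbit Q (hecke_L2 p Q v)) (al_index Q M')"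
proof (rule inj_onI)
  fix u v assume *: "u \<in> al_index Q M'" "v \<in> al_index Q M'"
    "torbit Q (hecke_L2 p Q u) = torbit Q (hecke_L2 p Q v)"
  obtain x y c d where u: "u = (c, d)" "al_lift Q (c, d) = (x, y, c, d)" by (rule al_indexE[OF *(1)])
  obtain x' y' c' d' where v: "v = (c', d')" "al_lift Q (c', d') = (x', y', c', d')" by (rule al_indexE[OF *(2)])
  show "u = v" using *(3) p_pos by (auto simp: torbit_eq_iff hecke_L2_def u v tshift_def)
qed

lemma inj_R1: "inj_on (\<lambda>v. torbit Q (hecke_R1 p Q v)) (al_index Q M)"
proof (rule inj_onI)
  fix u v assume *: "u \<in> al_index Q M" "v \<in> al_index Q M"
    "torbit Q (hecke_R1 p Q u) = torbit Q (hecke_R1 p Q v)"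
  obtain x y c d where u: "u = (c, d)" "al_lift Q (c, d) = (x, y, c, d)" by (rule al_indexE[OF *(1)])
  obtain x' y' c' d' where v: "v = (c', d')" "al_lift Q (c', d') = (x', y', c', d')" by (rule al_indexE[OF *(2)])
  show "u = v" using *(3) p_pos by (auto simp: torbit_eq_iff hecke_R1_def u v tshift_def)
qed

text \<open>The lower row is p (c, d), so translations move the upper row by p-fold multiples of (c,
  Q d), and distinct j below p stay apart.\<close>

lemma inj_R2: "inj_on (\<lambda>v. torbit Q (hecke_R2 p Q v)) ({..<p} \<times> al_index Q M')"
proof (rule inj_onI)
  fix u v assume *: "u \<in> {..<p} \<times> al_index Q M'" "v \<in> {..<p} \<times> al_index Q M'"
    "torbit Q (hecke_R2 p Q u) = torbit Q (hecke_R2 p Q v)"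
  obtain i u' where u: "u = (i, u')" "i < p" "u' \<in> al_index Q M'" using *(1) by auto
  obtain j v' where v: "v = (j, v')" "j < p" "v' \<in> al_index Q M'" using *(2) by auto
  obtain x y c d where u': "u' = (c, d)" "al_lift Q (c, d) = (x, y, c, d)" "c > 0 \<or> c = 0 \<and> d > 0"
    by (rule al_indexE[OF u(3)])
  obtain x' y' c' d' where v': "v' = (c', d')" "al_lift Q (c', d') = (x', y', c', d')"
    by (rule al_indexE[OF v(3)])
  obtain t where t: "hecke_R2 p Q v = tshift Q t (hecke_R2 p Q u)" using *(3) by (auto simp: torbit_eq_iff)
  have eq: "c' = c" "d' = d" using t p_pos by (auto simp: hecke_R2_def u v u' v' tshift_def)
  hence uv: "u' = v'" by (simp add: u' v')
  hence xy: "x' = x" "y' = y" using u'(2) v'(2) eq by auto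
  have "x + int j * c = x + int i * c + t * (int p * c)" "y + int j * (int Q * d) = y + int i * (int Q * d) + t * (int Q * (int p * d))"
    using t by (auto simp: hecke_R2_def u v u' v' tshift_def eq xy)
  hence "(int j - int i - t * int p) * c = 0" "(int j - int i - t * int p) * (int Q * d) = 0"
    by (simp_all add: algebra_simps)
  hence "int j - int i = int p * t" using u'(3) Q by auto
  hence "int p dvd int j - int i" by simp
  hence "int j mod int p = int i mod int p" by (simp add: mod_eq_dvd_iff)
  hence "i = j" using u(2) v(2) by simp
  thus "u = v" using uv by (simp add: u v)
qed

lemma L1_subset:
  assumes "v \<in> {..<p} \<times> al_index Q M"
  shows "hecke_L1 p Q v \<in> tmats Q M (int p)"
proof -
  obtain i v' where v: "v = (i, v')" "v' \<in> al_index Q M" using assms by auto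
  obtain x y c d where v': "v' = (c, d)" "al_lift Q (c, d) = (x, y, c, d)" "int Q * x * d - y * c = 1"
    "int M dvd c" "c > 0 \<or> c = 0 \<and> d > 0"
    by (rule al_indexE[OF v(2)])
  have "int Q * x * (c * int i + int p * d) - (int Q * x * int i + int p * y) * c = int p * (int Q * x * d - y * c)"
    by (simp add: algebra_simps)
  thus ?thesis using v' p_pos by (auto simp: v hecke_L1_def tmats_def)
qed

lemma L2_subset:
  assumes "v \<in> al_index Q M'"
  shows "hecke_L2 p Q v \<in> tmats Q M (int p)"
proof -
  obtain x y c d where v': "v = (c, d)" "al_lift Q (c, d) = (x, y, c, d)" "int Q * x * d - y * c = 1"
    "int M' dvd c" "c > 0 \<or> c = 0 \<and> d > 0"
    by (rule al_indexE[OF assms])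
  have "int Q * (int p * x) * d - y * (int p * c) = int p * (int Q * x * d - y * c)"
    by (simp add: algebra_simps)
  thus ?thesis using v' p_pos by (auto simp: hecke_L2_def tmats_def dvd_M'_iff zero_less_mult_iff)
qed

lemma R1_subset:
  assumes "v \<in> al_index Q M"
  shows "hecke_R1 p Q v \<in> tmats Q M (int p)"
proof -
  obtain x y c d where v': "v = (c, d)" "al_lift Q (c, d) = (x, y, c, d)" "int Q * x * d - y * c = 1"
    "int M dvd c" "c > 0 \<or> c = 0 \<and> d > 0"
    by (rule al_indexE[OF assms])
  have "int Q * (int p * x) * d - int p * y * c = int p * (int Q * x * d - y * c)"
    by (simp add: algebra_simps)
  thus ?thesis using v' by (auto simp: hecke_R1_def tmats_def)
qed

lemma R2_subset:
  assumes "v \<in> {..<p} \<times> al_index Q M'"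
  shows "hecke_R2 p Q v \<in> tmats Q M (int p)"
proof -
  obtain j v' where v: "v = (j, v')" "v' \<in> al_index Q M'" using assms by auto
  obtain x y c d where v': "v' = (c, d)" "al_lift Q (c, d) = (x, y, c, d)" "int Q * x * d - y * c = 1"
    "int M' dvd c" "c > 0 \<or> c = 0 \<and> d > 0"
    by (rule al_indexE[OF v(2)])
  have "int Q * (x + int j * c) * (int p * d) - (y + int j * (int Q * d)) * (int p * c) = int p * (int Q * x * d - y * c)"
    by (simp add: algebra_simps)
  thus ?thesis using v' p_pos by (auto simp: v hecke_R2_def tmats_def dvd_M'_iff zero_less_mult_iff)
qed

text \<open>The first column tells the families apart: in L2 the entries x and c of the tuple are
  both divisible by p, in L1 they are those of a unimodular matrix, which p cannot both
  divide.\<close>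

lemma L1_L2_disjoint:
  assumes "u \<in> {..<p} \<times> al_index Q M" "v \<in> al_index Q M'"
  shows "torbit Q (hecke_L1 p Q u) \<noteq> torbit Q (hecke_L2 p Q v)"
proof
  assume eq: "torbit Q (hecke_L1 p Q u) = torbit Q (hecke_L2 p Q v)"
  obtain i u' where u: "u = (i, u')" "u' \<in> al_index Q M" using assms by auto
  obtain x y c d where u': "u' = (c, d)" "al_lift Q (c, d) = (x, y, c, d)" "int Q * x * d - y * c = 1"
    by (rule al_indexE[OF u(2)])
  obtain x' y' c' d' where v': "v = (c', d')" "al_lift Q (c', d') = (x', y', c', d')"
    by (rule al_indexE[OF assms(2)])
  obtain t where "hecke_L1 p Q u = tshift Q t (hecke_L2 p Q v)" using eq[symmetric] by (auto simp: torbit_eq_iff)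
  hence "x = int p * (x' + t * c')" "c = int p * c'"
    by (auto simp: hecke_L1_def hecke_L2_def u u' v' tshift_def algebra_simps)
  hence "int p dvd int Q * x * d - y * c" by (intro dvd_diff) auto
  thus False using u'(3) p_prime_int by (auto simp: not_prime_unit)
qed

text \<open>The same argument with the lower row, divisible by p in R2 and primitive in R1.\<close>

lemma R1_R2_disjoint:
  assumes "u \<in> al_index Q M" "v \<in> {..<p} \<times> al_index Q M'"
  shows "torbit Q (hecke_R1 p Q u) \<noteq> torbit Q (hecke_R2 p Q v)"
proof
  assume eq: "torbit Q (hecke_R1 p Q u) = torbit Q (hecke_R2 p Q v)"
  obtain j v' where v: "v = (j, v')" "v' \<in> al_index Q M'" using assms by auto
  obtain x y c d where u': "u = (c, d)" "al_lift Q (c, d) = (x, y, c, d)" "int Q * x * d - y * c = 1"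
    by (rule al_indexE[OF assms(1)])
  obtain x' y' c' d' where v': "v' = (c', d')" "al_lift Q (c', d') = (x', y', c', d')"
    by (rule al_indexE[OF v(2)])
  have "c = int p * c'" "d = int p * d'"
    using eq by (auto simp: hecke_R1_def hecke_R2_def v u' v' tshift_def torbit_eq_iff)
  hence "int p dvd int Q * x * d - y * c" by (intro dvd_diff) auto
  thus False using u'(3) p_prime_int by (auto simp: not_prime_unit)
qed

text \<open>The congruences say that the second column minus i times the first is divisible by p;
  that quotient is the second column of the other factor to the left of (1 i; 0 p).\<close>

lemma mem_L1:
  assumes T: "(X, Y, C, D) \<in> tmats Q M (int p)" and i: "i < p" "int p dvd D - C * int i" "int p dvd Y - int Q * X * int i"
  shows "torbit Q (X, Y, C, D) \<in> (\<lambda>v. torbit Q (hecke_L1 p Q v)) ` ({..<p} \<times> al_index Q M)"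
proof -
  have T': "int Q * X * D - Y * C = int p" "int M dvd C" "C > 0 \<or> C = 0 \<and> D > 0" using T by (auto simp: tmats_def)
  obtain d where d: "D = C * int i + int p * d" using i(2) by (metis add.commute diff_add_cancel dvdE)
  obtain y where y: "Y = int Q * X * int i + int p * y" using i(3) by (metis add.commute diff_add_cancel dvdE)
  have "int p * (int Q * X * d - y * C) = int p * 1" using T'(1) unfolding d y by (simp add: algebra_simps)
  hence det: "int Q * X * d - y * C = 1" using p_pos by simp
  have "C > 0 \<or> C = 0 \<and> d > 0" using T'(3) d p_pos by (auto simp: zero_less_mult_iff)
  hence mem: "(C, d) \<in> al_index Q M" using det T'(2) by (intro al_indexI) auto
  obtain t where t: "al_lift Q (C, d) = tshift Q t (X, y, C, d)" by (rule al_lift_shift[OF det])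
  have "hecke_L1 p Q (i, (C, d)) = tshift Q t (X, Y, C, D)"
    by (simp add: hecke_L1_def t tshift_def d y algebra_simps)
  hence "torbit Q (X, Y, C, D) = torbit Q (hecke_L1 p Q (i, (C, d)))" by simp
  thus ?thesis using mem i(1) by blast
qed

text \<open>The congruences say that after a translation by t the upper row is divisible by p, so (p
  0; 0 1) splits off on the left.\<close>

lemma mem_R1:
  assumes T: "(X, Y, C, D) \<in> tmats Q M (int p)" and t: "int p dvd X + t * C" "int p dvd Y + t * (int Q * D)"
  shows "torbit Q (X, Y, C, D) \<in> (\<lambda>v. torbit Q (hecke_R1 p Q v)) ` al_index Q M"
proof -
  have T': "int Q * X * D - Y * C = int p" "int M dvd C" "C > 0 \<or> C = 0 \<and> D > 0" using T by (auto simp: tmats_def)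
  obtain x where x: "X + t * C = int p * x" using t(1) by auto
  obtain y where y: "Y + t * (int Q * D) = int p * y" using t(2) by auto
  have "int p * (int Q * x * D - y * C) = int Q * (int p * x) * D - (int p * y) * C" by (simp add: algebra_simps)
  also have "\<dots> = int p" unfolding x[symmetric] y[symmetric] using T'(1) by (simp add: algebra_simps)
  finally have det: "int Q * x * D - y * C = 1" using p_pos by simp
  have mem: "(C, D) \<in> al_index Q M" using det T' by (intro al_indexI) auto
  obtain s where s: "al_lift Q (C, D) = tshift Q s (x, y, C, D)" by (rule al_lift_shift[OF det])
  have "hecke_R1 p Q (C, D) = tshift Q (int p * s + t) (X, Y, C, D)"
    using x y by (simp add: hecke_R1_def s tshift_def algebra_simps)
  hence "torbit Q (X, Y, C, D) = torbit Q (hecke_R1 p Q (C, D))" by simp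
  thus ?thesis using mem by blast
qed

text \<open>With C invertible modulo p, one congruence of each factorisation fixes the parameter i
  or j, and the determinant, which is 0 modulo p, forces the other.\<close>

lemma mem_L1_R1:
  assumes T: "(X, Y, C, D) \<in> tmats Q M (int p)" and C: "\<not> int p dvd C"
  shows "torbit Q (X, Y, C, D) \<in> (\<lambda>v. torbit Q (hecke_L1 p Q v)) ` ({..<p} \<times> al_index Q M)"
    "torbit Q (X, Y, C, D) \<in> (\<lambda>v. torbit Q (hecke_R1 p Q v)) ` al_index Q M"
proof -
  have T': "int Q * X * D - Y * C = int p" using T by (auto simp: tmats_def)
  obtain i where i: "i < p" "int p dvd D - C * int i" by (rule solve_mod_p[OF C])
  have "C * (Y - int Q * X * int i) = int Q * X * (D - C * int i) - int p"
    using T' by (simp add: algebra_simps)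
  hence "int p dvd C * (Y - int Q * X * int i)" using i(2) by simp
  hence "int p dvd Y - int Q * X * int i" using C p_prime_int by (simp add: prime_dvd_mult_iff)
  thus "torbit Q (X, Y, C, D) \<in> (\<lambda>v. torbit Q (hecke_L1 p Q v)) ` ({..<p} \<times> al_index Q M)"
    by (rule mem_L1[OF T i])
  obtain j where j: "int p dvd X - C * int j" by (rule solve_mod_p[OF C])
  have X: "int p dvd X + (- int j) * C" using j by (simp add: mult.commute)
  have "C * (Y + (- int j) * (int Q * D)) = int Q * D * (X + (- int j) * C) - int p"
    using T' by (simp add: algebra_simps)
  hence "int p dvd C * (Y + (- int j) * (int Q * D))" using X by (metis dvd_diff dvd_refl dvd_mult)
  hence "int p dvd Y + (- int j) * (int Q * D)" using C p_prime_int by (simp add: prime_dvd_mult_iff)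
  thus "torbit Q (X, Y, C, D) \<in> (\<lambda>v. torbit Q (hecke_R1 p Q v)) ` al_index Q M"
    by (rule mem_R1[OF T X])
qed

text \<open>Sorted by the first column modulo p: the orbit belongs to L2 if p divides both C and X,
  and to L1 otherwise. If p divides C but not X, the index i is found from Y, for which Q X must be
  invertible modulo p.\<close>

lemma L_union:
  assumes pQ: "\<not> p dvd Q"
  shows "(\<lambda>v. torbit Q (hecke_L1 p Q v)) ` ({..<p} \<times> al_index Q M) \<union> (\<lambda>v. torbit Q (hecke_L2 p Q v)) ` al_index Q M' =
    torbit Q ` tmats Q M (int p)"
proof (intro equalityI subsetI)
  fix o' assume "o' \<in> torbit Q ` tmats Q M (int p)"
  then obtain X Y C D where T: "(X, Y, C, D) \<in> tmats Q M (int p)" "o' = torbit Q (X, Y, C, D)" by auto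
  have T': "int Q * X * D - Y * C = int p" "int M dvd C" "C > 0 \<or> C = 0 \<and> D > 0" using T by (auto simp: tmats_def)
  consider "\<not> int p dvd C" | "int p dvd C" "\<not> int p dvd X" | "int p dvd C" "int p dvd X" by blast
  thus "o' \<in> (\<lambda>v. torbit Q (hecke_L1 p Q v)) ` ({..<p} \<times> al_index Q M) \<union> (\<lambda>v. torbit Q (hecke_L2 p Q v)) ` al_index Q M'"
  proof cases
    case 1
    thus ?thesis using mem_L1_R1(1)[OF T(1)] T(2) by blast
  next
    case 2
    have QX: "\<not> int p dvd int Q * X" using 2 pQ p_prime_int by (simp add: prime_dvd_mult_iff)
    obtain i where i: "i < p" "int p dvd Y - int Q * X * int i" by (rule solve_mod_p[OF QX])
    have "int Q * X * D = int p + Y * C" using T'(1) by simp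
    hence "int p dvd int Q * X * D" using 2 by simp
    hence "int p dvd D" using QX p_prime_int prime_dvd_multD by blast
    hence "int p dvd D - C * int i" using 2 by simp
    thus ?thesis using mem_L1[OF T(1) i(1) _ i(2)] T(2) by blast
  next
    case 3
    obtain c where c: "C = int p * c" using 3 by auto
    obtain x where x: "X = int p * x" using 3 by auto
    have "int p * (int Q * x * D - Y * c) = int p * 1" using T'(1) unfolding c x by (simp add: algebra_simps)
    hence det: "int Q * x * D - Y * c = 1" using p_pos by simp
    have mem: "(c, D) \<in> al_index Q M'"
      using det T' p_pos unfolding c dvd_M'_iff by (intro al_indexI) (auto simp: zero_less_mult_iff)
    obtain t where t: "al_lift Q (c, D) = tshift Q t (x, Y, c, D)" by (rule al_lift_shift[OF det])
    have "hecke_L2 p Q (c, D) = tshift Q t (X, Y, C, D)"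
      by (simp add: hecke_L2_def t tshift_def c x algebra_simps)
    hence "torbit Q (X, Y, C, D) = torbit Q (hecke_L2 p Q (c, D))" by simp
    thus ?thesis using mem T(2) by blast
  qed
qed (use L1_subset L2_subset in blast)

text \<open>The mirror image of \<open>L_union\<close>, sorted by the lower row (C, D) modulo
  p.\<close>

lemma R_union:
  assumes pQ: "\<not> p dvd Q"
  shows "(\<lambda>v. torbit Q (hecke_R1 p Q v)) ` al_index Q M \<union> (\<lambda>v. torbit Q (hecke_R2 p Q v)) ` ({..<p} \<times> al_index Q M') =
    torbit Q ` tmats Q M (int p)"
proof (intro equalityI subsetI)
  fix o' assume "o' \<in> torbit Q ` tmats Q M (int p)"
  then obtain X Y C D where T: "(X, Y, C, D) \<in> tmats Q M (int p)" "o' = torbit Q (X, Y, C, D)" by auto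
  have T': "int Q * X * D - Y * C = int p" "int M dvd C" "C > 0 \<or> C = 0 \<and> D > 0" using T by (auto simp: tmats_def)
  consider "\<not> int p dvd C" | "int p dvd C" "\<not> int p dvd D" | "int p dvd C" "int p dvd D" by blast
  thus "o' \<in> (\<lambda>v. torbit Q (hecke_R1 p Q v)) ` al_index Q M \<union> (\<lambda>v. torbit Q (hecke_R2 p Q v)) ` ({..<p} \<times> al_index Q M')"
  proof cases
    case 1
    thus ?thesis using mem_L1_R1(2)[OF T(1)] T(2) by blast
  next
    case 2
    have QD: "\<not> int p dvd int Q * D" using 2 pQ p_prime_int by (simp add: prime_dvd_mult_iff)
    obtain i where i: "int p dvd Y - int Q * D * int i" by (rule solve_mod_p[OF QD])
    have "(int Q * D) * X = int p + Y * C" using T'(1) by (simp add: mult_ac)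
    hence "int p dvd (int Q * D) * X" using 2 by simp
    hence "int p dvd X" using QD p_prime_int prime_dvd_multD by blast
    hence X: "int p dvd X + (- int i) * C" using 2 by simp
    have "int p dvd Y + (- int i) * (int Q * D)" using i by (simp add: mult_ac)
    thus ?thesis using mem_R1[OF T(1) X] T(2) by blast
  next
    case 3
    obtain c where c: "C = int p * c" using 3 by auto
    obtain d where d: "D = int p * d" using 3 by auto
    have "int p * (int Q * X * d - Y * c) = int p * 1" using T'(1) unfolding c d by (simp add: algebra_simps)
    hence det: "int Q * X * d - Y * c = 1" using p_pos by simp
    have mem: "(c, d) \<in> al_index Q M'"
      using det T' p_pos unfolding c d dvd_M'_iff by (intro al_indexI) (auto simp: zero_less_mult_iff)
    obtain t where t: "al_lift Q (c, d) = tshift Q t (X, Y, c, d)" by (rule al_lift_shift[OF det])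
    \<comment> \<open>Only -t modulo p matters: its residue selects (1 j; 0 p), and the multiple of
      p becomes a translation within the orbit.\<close>
    define j where "j = nat ((- t) mod int p)"
    have j: "j < p" "int j = (- t) mod int p" using p_pos by (auto simp: j_def nat_less_iff)
    define k where "k = (- t) div int p"
    have tk: "t = - (int p * k + int j)" unfolding j(2) k_def by simp
    have "hecke_R2 p Q (j, (c, d)) = tshift Q (- k) (X, Y, C, D)"
      by (simp add: hecke_R2_def t tshift_def c d tk algebra_simps)
    hence "torbit Q (X, Y, C, D) = torbit Q (hecke_R2 p Q (j, (c, d)))" by simp
    thus ?thesis using mem T(2) j(1) by blast
  qed
qed (use R1_subset R2_subset in blast)

text \<open>If p divides Q, the determinant relation keeps p from dividing c, so every matrix on
  either side falls under \<open>mem_L1_R1\<close> and has both factorisations. L2 and R2 have no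
  part here, just as Q is absent from the plicate.\<close>

lemma L1_eq_R1:
  assumes pQ: "p dvd Q"
  shows "(\<lambda>v. torbit Q (hecke_L1 p Q v)) ` ({..<p} \<times> al_index Q M) = (\<lambda>v. torbit Q (hecke_R1 p Q v)) ` al_index Q M"
proof -
  have npc: "\<not> int p dvd c" if "int Q * x * d - y * c = 1" for x y c d
  proof
    assume "int p dvd c"
    moreover have "int p dvd int Q" using pQ by simp
    ultimately have "int p dvd int Q * x * d - y * c" by (intro dvd_diff) auto
    thus False using that p_prime_int by (auto simp: not_prime_unit)
  qed
  show ?thesis
  proof (intro equalityI image_subsetI)
    fix v assume v: "v \<in> {..<p} \<times> al_index Q M"
    obtain i v' where v': "v = (i, v')" "v' \<in> al_index Q M" using v by auto
    obtain x y c d where l: "v' = (c, d)" "al_lift Q (c, d) = (x, y, c, d)" "int Q * x * d - y * c = 1"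
      by (rule al_indexE[OF v'(2)])
    show "torbit Q (hecke_L1 p Q v) \<in> (\<lambda>v. torbit Q (hecke_R1 p Q v)) ` al_index Q M"
      using L1_subset[OF v] mem_L1_R1(2) npc[OF l(3)] by (auto simp: hecke_L1_def v' l)
  next
    fix v assume v: "v \<in> al_index Q M"
    obtain x y c d where l: "v = (c, d)" "al_lift Q (c, d) = (x, y, c, d)" "int Q * x * d - y * c = 1"
      by (rule al_indexE[OF v])
    show "torbit Q (hecke_R1 p Q v) \<in> (\<lambda>v. torbit Q (hecke_L1 p Q v)) ` ({..<p} \<times> al_index Q M)"
      using R1_subset[OF v] mem_L1_R1(1) npc[OF l(3)] by (auto simp: hecke_R1_def l)
  qed
qed

end

section \<open>Summing over orbits\<close>

lemma torbit_value:
  assumes "Im \<tau> > 0" "Q > 0" "T \<in> tmats Q M r"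
  shows "niebur_f n s (al_point Q (SOME T'. T' \<in> torbit Q T) \<tau>) = niebur_f n s (al_point Q T \<tau>)"
proof -
  obtain x y c d where T: "T = (x, y, c, d)" "c \<noteq> 0 \<or> d \<noteq> 0" using assms(3) by (auto simp: tmats_def)
  have "(SOME T'. T' \<in> torbit Q T) \<in> torbit Q T" by (rule someI[of "\<lambda>T'. T' \<in> torbit Q T", OF torbit_self])
  then obtain t where "(SOME T'. T' \<in> torbit Q T) = tshift Q t T" by (auto simp: torbit_def)
  thus ?thesis using al_point_tshift[OF assms(1,2) T(2), of t x y] by (simp add: T niebur_f_shift)
qed

lemma al_point_hecke:
  assumes p: "p > 0" and Q: "Q > 0"
  shows "al_point Q (hecke_L1 p Q (i, v)) \<tau> = al_point Q (al_lift Q v) ((\<tau> + of_nat i) / of_nat p)"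
    "al_point Q (hecke_L2 p Q v) \<tau> = al_point Q (al_lift Q v) (of_nat p * \<tau>)"
    "al_point Q (hecke_R1 p Q v) \<tau> = of_nat p * al_point Q (al_lift Q v) \<tau>"
proof -
  obtain x y c d where l: "al_lift Q v = (x, y, c, d)" by (metis surj_pair)
  have P: "complex_of_nat p \<noteq> 0" using p by simp
  define z where "z = (\<tau> + of_nat i) / complex_of_nat p"
  have z: "of_nat p * z = \<tau> + of_nat i" using P by (simp add: z_def)
  have "al_point Q (x, y, c, d) z =
     (of_nat p * (of_nat Q * of_int x * z + of_int y)) / (of_nat p * (of_nat Q * (of_int c * z + of_int d)))"
    using P by (simp add: al_point_def)
  also have "of_nat p * (of_nat Q * of_int x * z + of_int y) =
     of_nat Q * of_int x * (of_nat p * z) + of_nat p * of_int y"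
    by (simp add: algebra_simps)
  also have "of_nat p * (of_nat Q * (of_int c * z + of_int d)) =
     of_nat Q * (of_int c * (of_nat p * z) + of_nat p * of_int d)"
    by (simp add: algebra_simps)
  also have "(of_nat Q * of_int x * (of_nat p * z) + of_nat p * of_int y) /
      (of_nat Q * (of_int c * (of_nat p * z) + of_nat p * of_int d)) = al_point Q (hecke_L1 p Q (i, v)) \<tau>"
    unfolding z by (simp add: al_point_def hecke_L1_def l algebra_simps)
  finally show "al_point Q (hecke_L1 p Q (i, v)) \<tau> = al_point Q (al_lift Q v) ((\<tau> + of_nat i) / of_nat p)"
    by (simp add: l z_def)
  show "al_point Q (hecke_L2 p Q v) \<tau> = al_point Q (al_lift Q v) (of_nat p * \<tau>)"
    by (simp add: al_point_def hecke_L2_def l mult_ac)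
  show "al_point Q (hecke_R1 p Q v) \<tau> = of_nat p * al_point Q (al_lift Q v) \<tau>"
    by (simp add: al_point_def hecke_R1_def l algebra_simps)
qed

lemma al_point_hecke_R2:
  assumes p: "p > 0" and Q: "Q > 0" and \<tau>: "Im \<tau> > 0" and v: "v \<in> al_index Q M"
  shows "al_point Q (hecke_R2 p Q (j, v)) \<tau> = (al_point Q (al_lift Q v) \<tau> + of_nat j) / of_nat p"
proof -
  obtain x y c d where l: "v = (c, d)" "al_lift Q (c, d) = (x, y, c, d)" "c > 0 \<or> c = 0 \<and> d > 0"
    by (rule al_indexE[OF v])
  have cd: "c \<noteq> 0 \<or> d \<noteq> 0" using l(3) by auto
  have "al_point Q (hecke_R2 p Q (j, v)) \<tau> = al_point Q (tshift Q (int j) (x, y, c, d)) \<tau> / of_nat p"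
    by (simp add: al_point_def hecke_R2_def tshift_def l algebra_simps)
  thus ?thesis using al_point_tshift[OF \<tau> Q cd, of "int j" x y] by (simp add: l)
qed

lemma niebur_f_mult: "niebur_f n s (of_nat p * z) = niebur_f (p * n) s z"
  by (simp add: niebur_f_def mult_ac)

lemma sum_niebur_f_div:
  assumes p: "p > 0"
  shows "(\<Sum>j<p. niebur_f n s ((z + of_nat j) / of_nat p)) =
    (if p dvd n then of_nat p * niebur_f (n div p) s z else 0)"
proof -
  define B where "B = ee (- (real n * Re z / real p)) * of_real (sqrt (real n * Im z / real p)) *
     bessel_I (s - 1 / 2) (2 * pi * real n * (Im z / real p))"
  have "niebur_f n s ((z + of_nat j) / of_nat p) = B * ec p (- int n * int j)" for j
  proof -
    have "Re ((z + of_nat j) / of_nat p) = (Re z + real j) / real p" "Im ((z + of_nat j) / of_nat p) = Im z / real p"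
      by (simp_all add: Re_divide_of_nat Im_divide_of_nat)
    moreover have "ee (- real n * ((Re z + real j) / real p)) = ee (- (real n * Re z / real p)) * ec p (- int n * int j)"
      unfolding ec_def ee_add [symmetric] by (simp add: add_divide_distrib algebra_simps)
    ultimately show ?thesis by (simp add: niebur_f_def B_def mult_ac)
  qed
  hence "(\<Sum>j<p. niebur_f n s ((z + of_nat j) / of_nat p)) = B * (\<Sum>j<p. ec p (- int n * int j))"
    by (simp add: sum_distrib_left)
  also have "\<dots> = (if p dvd n then of_nat p * B else 0)" by (subst sum_ec[OF p]) simp
  also have "B = niebur_f (n div p) s z" if "p dvd n"
  proof -
    from \<open>p dvd n\<close> obtain k where k: "n = p * k" by (auto elim!: dvdE)
    have "real n * Re z / real p = real k * Re z" "real n * Im z / real p = real k * Im z"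
      "2 * pi * real n * (Im z / real p) = 2 * pi * real k * Im z"
      using p by (simp_all add: k)
    moreover have "n div p = k" using k p by simp
    ultimately show ?thesis by (simp add: B_def niebur_f_def)
  qed
  hence "(if p dvd n then of_nat p * B else 0) = (if p dvd n then of_nat p * niebur_f (n div p) s z else 0)"
    by auto
  finally show ?thesis .
qed

text \<open>One sum over translation orbits, computed twice: through L1 and L2 it gives the left
  side, through R1 and R2 the right side. If p divides Q, only L1 = R1 remains.\<close>

lemma al_sum_hecke:
  fixes p Q M n :: nat
  assumes p: "prime p" and Q: "Q > 0" and M: "M > 0" and n: "n \<ge> 1" and \<tau>: "Im \<tau> > 0" and s: "Re s > 1"
  shows "(\<Sum>i<p. al_sum Q M (niebur_f n s) ((\<tau> + of_nat i) / of_nat p)) +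
      (if p dvd Q then 0 else al_sum Q (M div gcd p M) (niebur_f n s) (of_nat p * \<tau>)) =
    al_sum Q M (niebur_f (p * n) s) \<tau> +
      (if p dvd n \<and> \<not> p dvd Q then of_nat p * al_sum Q (M div gcd p M) (niebur_f (n div p) s) \<tau> else 0)"
proof -
  define M' where "M' = M div gcd p M"
  note ctx = p Q M M'_def
  have p0: "p > 0" using p prime_gt_0_nat by blast
  have Q1: "Q \<ge> 1" using Q by simp
  define F where "F = (\<lambda>o'. niebur_f n s (al_point Q (SOME T'. T' \<in> o') \<tau>))"
  have F: "F (torbit Q T) = niebur_f n s (al_point Q T \<tau>)" if "T \<in> tmats Q M (int p)" for T
    unfolding F_def by (rule torbit_value[OF \<tau> Q that])
  have hs: "((\<lambda>v. niebur_f m s (al_point Q (al_lift Q v) z)) has_sum al_sum Q K (niebur_f m s) z) (al_index Q K)"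
    if "Im z > 0" "m \<ge> 1" for z K m
    unfolding al_sum_def by (rule has_sum_infsum[OF has_sum_imp_summable[OF has_sum_al[OF Q1 that(2,1) s]]])
  define BL1 where "BL1 = (\<lambda>v. torbit Q (hecke_L1 p Q v)) ` ({..<p} \<times> al_index Q M)"
  define BL2 where "BL2 = (\<lambda>v. torbit Q (hecke_L2 p Q v)) ` al_index Q M'"
  define BR1 where "BR1 = (\<lambda>v. torbit Q (hecke_R1 p Q v)) ` al_index Q M"
  define BR2 where "BR2 = (\<lambda>v. torbit Q (hecke_R2 p Q v)) ` ({..<p} \<times> al_index Q M')"
  define SL1 where "SL1 = (\<Sum>i<p. al_sum Q M (niebur_f n s) ((\<tau> + of_nat i) / of_nat p))"
  have L1: "(F has_sum SL1) BL1"
  proof -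
    have "((\<lambda>v. niebur_f n s (al_point Q (hecke_L1 p Q v) \<tau>)) has_sum SL1) ({..<p} \<times> al_index Q M)"
      unfolding SL1_def
    proof (rule has_sum_Sigma_finite)
      fix i
      have "Im ((\<tau> + of_nat i) / of_nat p) > 0" using \<tau> p0 by (simp add: Im_divide_of_nat)
      from hs[OF this n] show "((\<lambda>v. niebur_f n s (al_point Q (hecke_L1 p Q (i, v)) \<tau>)) has_sum
         al_sum Q M (niebur_f n s) ((\<tau> + of_nat i) / of_nat p)) (al_index Q M)"
        by (simp add: al_point_hecke[OF p0 Q])
    qed auto
    also have "?this \<longleftrightarrow> ((F \<circ> (\<lambda>v. torbit Q (hecke_L1 p Q v))) has_sum SL1) ({..<p} \<times> al_index Q M)"
      by (rule has_sum_cong) (simp add: F[OF L1_subset[OF ctx]])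
    also have "\<dots> \<longleftrightarrow> (F has_sum SL1) BL1"
      unfolding BL1_def by (rule has_sum_reindex[OF inj_L1[OF ctx], symmetric])
    finally show ?thesis .
  qed
  have R1: "(F has_sum al_sum Q M (niebur_f (p * n) s) \<tau>) BR1"
  proof -
    have "((\<lambda>v. niebur_f n s (al_point Q (hecke_R1 p Q v) \<tau>)) has_sum al_sum Q M (niebur_f (p * n) s) \<tau>) (al_index Q M)"
      using hs[OF \<tau>, of "p * n" M] n p0 by (simp add: al_point_hecke[OF p0 Q] niebur_f_mult)
    also have "?this \<longleftrightarrow> ((F \<circ> (\<lambda>v. torbit Q (hecke_R1 p Q v))) has_sum al_sum Q M (niebur_f (p * n) s) \<tau>) (al_index Q M)"
      by (rule has_sum_cong) (simp add: F[OF R1_subset[OF ctx]])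
    also have "\<dots> \<longleftrightarrow> (F has_sum al_sum Q M (niebur_f (p * n) s) \<tau>) BR1"
      unfolding BR1_def by (rule has_sum_reindex[OF inj_R1[OF ctx], symmetric])
    finally show ?thesis .
  qed
  show ?thesis
  proof (cases "p dvd Q")
    case True
    have "BL1 = BR1" unfolding BL1_def BR1_def by (rule L1_eq_R1[OF ctx True])
    hence "SL1 = al_sum Q M (niebur_f (p * n) s) \<tau>" using L1 R1 has_sum_unique by metis
    thus ?thesis using True by (simp add: SL1_def)
  next
    case False
    have L2: "(F has_sum al_sum Q M' (niebur_f n s) (of_nat p * \<tau>)) BL2"
    proof -
      have "((\<lambda>v. niebur_f n s (al_point Q (hecke_L2 p Q v) \<tau>)) has_sum al_sum Q M' (niebur_f n s) (of_nat p * \<tau>)) (al_index Q M')"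
        using hs[of "of_nat p * \<tau>" n M'] n p0 \<tau> by (simp add: al_point_hecke[OF p0 Q])
      also have "?this \<longleftrightarrow> ((F \<circ> (\<lambda>v. torbit Q (hecke_L2 p Q v))) has_sum al_sum Q M' (niebur_f n s) (of_nat p * \<tau>)) (al_index Q M')"
        by (rule has_sum_cong) (simp add: F[OF L2_subset[OF ctx]])
      also have "\<dots> \<longleftrightarrow> (F has_sum al_sum Q M' (niebur_f n s) (of_nat p * \<tau>)) BL2"
        unfolding BL2_def by (rule has_sum_reindex[OF inj_L2[OF ctx], symmetric])
      finally show ?thesis .
    qed
    define \<Omega> where "\<Omega> = torbit Q ` tmats Q M (int p)"
    have \<Omega>L: "BL1 \<union> BL2 = \<Omega>" unfolding BL1_def BL2_def \<Omega>_def by (rule L_union[OF ctx False])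
    have \<Omega>R: "BR1 \<union> BR2 = \<Omega>" unfolding BR1_def BR2_def \<Omega>_def by (rule R_union[OF ctx False])
    have dL: "BL1 \<inter> BL2 = {}" unfolding BL1_def BL2_def using L1_L2_disjoint[OF ctx] by blast
    have dR: "BR1 \<inter> BR2 = {}" unfolding BR1_def BR2_def using R1_R2_disjoint[OF ctx] by blast
    have L: "(F has_sum (SL1 + al_sum Q M' (niebur_f n s) (of_nat p * \<tau>))) \<Omega>"
      using has_sum_Un_disjoint[OF L1 L2 dL] unfolding \<Omega>L .
    \<comment> \<open>Summability over R2 is inherited from all of \<Omega>, where the left
      decomposition has established it; its value can then be computed by iterated
      summation.\<close>
    have "BR2 \<subseteq> \<Omega>" using \<Omega>R by blast
    hence R2: "(F has_sum infsum F BR2) BR2"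
      using summable_on_subset_banach[OF has_sum_imp_summable[OF L]] by (intro has_sum_infsum)
    have R: "(F has_sum (al_sum Q M (niebur_f (p * n) s) \<tau> + infsum F BR2)) \<Omega>"
      using has_sum_Un_disjoint[OF R1 R2 dR] unfolding \<Omega>R .
    have V: "infsum F BR2 = (if p dvd n then of_nat p * al_sum Q M' (niebur_f (n div p) s) \<tau> else 0)"
    proof -
      have "((\<lambda>v. F (torbit Q (hecke_R2 p Q v))) has_sum infsum F BR2) ({..<p} \<times> al_index Q M')"
        using R2 unfolding BR2_def by (subst (asm) has_sum_reindex[OF inj_R2[OF ctx]]) (simp add: o_def)
      also have "?this \<longleftrightarrow> ((\<lambda>v. niebur_f n s (al_point Q (hecke_R2 p Q v) \<tau>)) has_sum infsum F BR2) ({..<p} \<times> al_index Q M')"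
        by (rule has_sum_cong) (simp add: F[OF R2_subset[OF ctx]])
      also have "\<dots> \<longleftrightarrow> ((\<lambda>(v, j). niebur_f n s ((al_point Q (al_lift Q v) \<tau> + of_nat j) / of_nat p)) has_sum infsum F BR2) (al_index Q M' \<times> {..<p})"
        by (rule has_sum_reindex_bij_witness[of _ prod.swap prod.swap]) (auto simp: al_point_hecke_R2[OF p0 Q \<tau>])
      finally have sw: "((\<lambda>(v, j). niebur_f n s ((al_point Q (al_lift Q v) \<tau> + of_nat j) / of_nat p)) has_sum infsum F BR2) (al_index Q M' \<times> {..<p})" .
      \<comment> \<open>The inner sum over j is finite and equals \<open>sum_niebur_f_div\<close>,
        which vanishes unless p divides n.\<close>
      have h: "((\<lambda>v. if p dvd n then of_nat p * niebur_f (n div p) s (al_point Q (al_lift Q v) \<tau>) else 0) has_sum infsum F BR2) (al_index Q M')"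
        by (rule has_sum_SigmaD[OF sw]) (simp add: has_sum_finiteI sum_niebur_f_div[OF p0])
      show ?thesis
      proof (cases "p dvd n")
        case True
        have "n div p \<ge> 1" using True n p0 by (auto elim!: dvdE)
        hence "((\<lambda>v. of_nat p * niebur_f (n div p) s (al_point Q (al_lift Q v) \<tau>)) has_sum
           (of_nat p * al_sum Q M' (niebur_f (n div p) s) \<tau>)) (al_index Q M')"
          by (intro has_sum_cmult_right hs \<tau>)
        thus ?thesis using h True has_sum_unique by auto
      next
        case False
        thus ?thesis using h has_sum_unique[OF _ has_sum_0_simp] by auto
      qed
    qed
    have "SL1 + al_sum Q M' (niebur_f n s) (of_nat p * \<tau>) = al_sum Q M (niebur_f (p * n) s) \<tau> + infsum F BR2"
      by (rule has_sum_unique[OF L R])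
    thus ?thesis using False unfolding V SL1_def M'_def by simp
  qed
qed

section \<open>The plicate group and the identity for j\<close>

lemma largest_generating_set_al_closed:
  assumes "N \<ge> 1" "largest_generating_set N S"
  shows "al_closed N S"
  using assms largest_generating_set_closed[OF assms]
  by (auto simp: al_closed_def largest_generating_set_def)

text \<open>An exact divisor Q with p | Q contains the full power of p in N and so cannot divide N /
  p; one prime to p loses nothing. Thus the plicate set consists of the Q prime to p, with the
  cofactors N^(p) / Q that \<open>al_sum_hecke\<close> calls for. The law \<open>al_star\<close>
  introduces no new primes, so closure persists.\<close>

lemma plicate_facts:
  assumes cl: "al_closed N S" and p: "prime p"
  shows "insert 1 (plicate_set p N S) = {Q \<in> insert 1 S. \<not> p dvd Q}"
    "\<And>Q. Q \<in> insert 1 S \<Longrightarrow> \<not> p dvd Q \<Longrightarrow> plicate_level p N div Q = N div Q div gcd p (N div Q)"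
    "al_closed (plicate_level p N) (plicate_set p N S)"
proof -
  note D = al_closedD[OF cl]
  define N' where "N' = plicate_level p N"
  have gcd_eq: "gcd p k = (if p dvd k then p else 1)" for k
    using p by (auto simp: gcd_nat.absorb1 prime_imp_coprime)
  have Q_facts: "Q dvd N" "coprime Q (N div Q)" "Q > 0" if "Q \<in> insert 1 S" for Q
    using D(4,5)[OF that] by (auto simp: exact_divisors_def)
  have decomp: "Q dvd N' \<and> N' div Q = N div Q div gcd p (N div Q) \<and> coprime Q (N' div Q)"
    if Q: "Q \<in> insert 1 S" and pQ: "\<not> p dvd Q" for Q
  proof -
    obtain k where k: "N = Q * k" using Q_facts(1)[OF Q] by auto
    have kd: "N div Q = k" using k Q_facts(3)[OF Q] by simp
    have g: "gcd p N = gcd p k" using pQ p unfolding k gcd_eq by (simp add: prime_dvd_mult_iff)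
    have "N' = Q * (k div gcd p k)"
      by (simp only: N'_def plicate_level_def g) (simp add: k div_mult_swap)
    hence "N' div Q = k div gcd p k" "Q dvd N'" using Q_facts(3)[OF Q] by auto
    moreover have "coprime Q (k div gcd p k)"
    proof -
      have "k div gcd p k dvd k" by (metis dvd_div_mult_self dvd_triv_left gcd_dvd2)
      thus ?thesis using Q_facts(2)[OF Q] unfolding kd by (meson coprime_divisors dvd_refl)
    qed
    ultimately show ?thesis by (simp add: kd)
  qed
  show 2: "plicate_level p N div Q = N div Q div gcd p (N div Q)" if "Q \<in> insert 1 S" "\<not> p dvd Q" for Q
    using decomp[OF that] by (simp add: N'_def)
  have ndvd: "\<not> Q dvd N'" if Q: "Q \<in> insert 1 S" and pQ: "p dvd Q" for Q
  proof
    assume "Q dvd N'"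
    then obtain m where m: "N' = Q * m" by auto
    have "p dvd N" using pQ Q_facts(1)[OF Q] dvd_trans by blast
    hence "N = p * N'" by (simp add: N'_def plicate_level_def gcd_eq)
    hence "N div Q = p * m" using m Q_facts(3)[OF Q] by simp
    hence "p dvd N div Q" by simp
    hence "is_unit p" using pQ Q_facts(2)[OF Q] by (meson coprime_common_divisor)
    thus False using p by (simp add: not_prime_unit)
  qed
  show 1: "insert 1 (plicate_set p N S) = {Q \<in> insert 1 S. \<not> p dvd Q}"
    using decomp ndvd p unfolding plicate_set_def N'_def[symmetric] by (auto simp: not_prime_unit)
  have "N' \<ge> 1"
  proof -
    have "N' > 0" using D(1) by (simp add: N'_def plicate_level_def div_greater_zero_iff dvd_imp_le)
    thus ?thesis by simp
  qed
  moreover have "plicate_set p N S \<subseteq> exact_divisors N' - {1}"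
  proof
    fix Q assume Q: "Q \<in> plicate_set p N S"
    hence "Q \<in> insert 1 S" "\<not> p dvd Q" using 1 by blast+
    from decomp[OF this] have "Q \<in> exact_divisors N'" unfolding exact_divisors_def by blast
    moreover have "Q \<noteq> 1" using Q cl by (auto simp: plicate_set_def al_closed_def)
    ultimately show "Q \<in> exact_divisors N' - {1}" by simp
  qed
  moreover have "al_star Q R \<in> insert 1 (plicate_set p N S)"
    if QR: "Q \<in> insert 1 (plicate_set p N S)" "R \<in> insert 1 (plicate_set p N S)" for Q R
  proof -
    have q: "Q \<in> insert 1 S" "R \<in> insert 1 S" "\<not> p dvd Q" "\<not> p dvd R" using QR unfolding 1 by auto
    have "al_star Q R dvd Q * R" unfolding al_star_def
      by (intro mult_dvd_mono) (metis dvd_div_mult_self dvd_triv_left gcd_dvd1 gcd_dvd2)+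
    hence "\<not> p dvd al_star Q R" using q p by (meson dvd_trans prime_dvd_multD)
    thus ?thesis unfolding 1 using D(6)[OF q(1,2)] by blast
  qed
  ultimately show "al_closed (plicate_level p N) (plicate_set p N S)"
    unfolding al_closed_def N'_def by blast
qed

lemma niebur_G_hecke:
  assumes cl: "al_closed N S" and p: "prime p" and n: "n \<ge> 1" and \<tau>: "Im \<tau> > 0" and s: "Re s > 1"
  shows "(\<Sum>i<p. niebur_G (Gamma_plus N S) n ((\<tau> + of_nat i) / of_nat p) s) +
      niebur_G (Gamma_plicate p N S) n (of_nat p * \<tau>) s =
    niebur_G (Gamma_plus N S) (p * n) \<tau> s +
      (if p dvd n then of_nat p * niebur_G (Gamma_plicate p N S) (n div p) \<tau> s else 0)"
proof -
  note D = al_closedD[OF cl] and P = plicate_facts[OF cl p]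
  note D' = al_closedD[OF P(3)]
  have p0: "p > 0" using p prime_gt_0_nat by blast
  define S1 where "S1 = insert 1 S"
  have fin: "finite S1" using D(2) by (simp add: S1_def)
  have G: "niebur_G (Gamma_plus N S) m z s = 2 * of_real pi * (\<Sum>Q\<in>S1. al_sum Q (N div Q) (niebur_f m s) z)"
    if "m \<ge> 1" "Im z > 0" for m z
    unfolding S1_def by (rule niebur_G_eq_sum[OF D(1,3,6) that s])
  have G': "niebur_G (Gamma_plicate p N S) m z s = 2 * of_real pi *
      (\<Sum>Q\<in>S1. if p dvd Q then 0 else al_sum Q (N div Q div gcd p (N div Q)) (niebur_f m s) z)"
    if "m \<ge> 1" "Im z > 0" for m z
  proof -
    have "niebur_G (Gamma_plicate p N S) m z s = 2 * of_real pi *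
       (\<Sum>Q\<in>{Q \<in> S1. \<not> p dvd Q}. al_sum Q (plicate_level p N div Q) (niebur_f m s) z)"
      unfolding S1_def P(1)[symmetric] Gamma_plicate_def by (rule niebur_G_eq_sum[OF D'(1,3,6) that s])
    also have "(\<Sum>Q\<in>{Q \<in> S1. \<not> p dvd Q}. al_sum Q (plicate_level p N div Q) (niebur_f m s) z) =
       (\<Sum>Q\<in>S1. if p dvd Q then 0 else al_sum Q (N div Q div gcd p (N div Q)) (niebur_f m s) z)"
      using fin P(2) by (intro sum.mono_neutral_cong_left) (auto simp: S1_def)
    finally show ?thesis .
  qed
  have Im1: "Im ((\<tau> + of_nat i) / of_nat p) > 0" for i using \<tau> p0 by (simp add: Im_divide_of_nat)
  have Im2: "Im (of_nat p * \<tau>) > 0" using \<tau> p0 by simp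
  have NQ: "Q > 0 \<and> N div Q > 0" if "Q \<in> S1" for Q
    using D(1) D(4)[of Q] D(5)[of Q] that by (auto simp: S1_def exact_divisors_def div_greater_zero_iff dvd_imp_le)
  have "(\<Sum>i<p. niebur_G (Gamma_plus N S) n ((\<tau> + of_nat i) / of_nat p) s) + niebur_G (Gamma_plicate p N S) n (of_nat p * \<tau>) s =
    2 * of_real pi * (\<Sum>Q\<in>S1. (\<Sum>i<p. al_sum Q (N div Q) (niebur_f n s) ((\<tau> + of_nat i) / of_nat p)) +
      (if p dvd Q then 0 else al_sum Q (N div Q div gcd p (N div Q)) (niebur_f n s) (of_nat p * \<tau>)))"
    unfolding G[OF n Im1] G'[OF n Im2] sum_distrib_left [symmetric] sum.distrib
    by (subst sum.swap) (simp only: distrib_left)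
  also have "\<dots> = 2 * of_real pi * (\<Sum>Q\<in>S1. al_sum Q (N div Q) (niebur_f (p * n) s) \<tau> +
      (if p dvd n \<and> \<not> p dvd Q then of_nat p * al_sum Q (N div Q div gcd p (N div Q)) (niebur_f (n div p) s) \<tau> else 0))"
    using NQ by (intro arg_cong2[where f = "(*)"] refl sum.cong al_sum_hecke p n \<tau> s) auto
  also have "\<dots> = niebur_G (Gamma_plus N S) (p * n) \<tau> s +
      (if p dvd n then of_nat p * niebur_G (Gamma_plicate p N S) (n div p) \<tau> s else 0)"
  proof (cases "p dvd n")
    case True
    have m: "n div p \<ge> 1" using True n p0 by (auto elim!: dvdE)
    have "(\<Sum>Q\<in>S1. if p dvd n \<and> \<not> p dvd Q then of_nat p * al_sum Q (N div Q div gcd p (N div Q)) (niebur_f (n div p) s) \<tau> else 0) =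
       of_nat p * (\<Sum>Q\<in>S1. if p dvd Q then 0 else al_sum Q (N div Q div gcd p (N div Q)) (niebur_f (n div p) s) \<tau>)"
      unfolding sum_distrib_left using True by (intro sum.cong) auto
    moreover have "niebur_G (Gamma_plus N S) (p * n) \<tau> s = 2 * of_real pi * (\<Sum>Q\<in>S1. al_sum Q (N div Q) (niebur_f (p * n) s) \<tau>)"
      using n p0 by (intro G \<tau>) simp
    ultimately show ?thesis using True unfolding G'[OF m \<tau>] sum.distrib by (simp add: algebra_simps)
  next
    case False
    moreover have "niebur_G (Gamma_plus N S) (p * n) \<tau> s = 2 * of_real pi * (\<Sum>Q\<in>S1. al_sum Q (N div Q) (niebur_f (p * n) s) \<tau>)"
      using n p0 by (intro G \<tau>) simp
    ultimately show ?thesis by simp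
  qed
  finally show ?thesis .
qed

lemma niebur_j_hecke:
  assumes cl: "al_closed N S" and p: "prime p" and n: "n \<ge> 1" and \<tau>: "Im \<tau> > 0"
  shows "U_star p (niebur_j (Gamma_plus N S) n) \<tau> + niebur_j (Gamma_plicate p N S) n (of_nat p * \<tau>) =
    niebur_j (Gamma_plus N S) (p * n) \<tau> +
      (if p dvd n then of_nat p * niebur_j (Gamma_plicate p N S) (n div p) \<tau> else 0)"
proof -
  define N' where "N' = plicate_level p N"
  define S' where "S' = plicate_set p N S"
  have cl': "al_closed N' S'" unfolding N'_def S'_def by (rule plicate_facts(3)[OF cl p])
  have Gp: "Gamma_plicate p N S = Gamma_plus N' S'" by (simp add: Gamma_plicate_def N'_def S'_def)
  have p0: "p > 0" using p prime_gt_0_nat by blast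
  have Im1: "Im ((\<tau> + of_nat i) / of_nat p) > 0" for i using \<tau> p0 by (simp add: Im_divide_of_nat)
  have Im2: "Im (of_nat p * \<tau>) > 0" using \<tau> p0 by simp
  have pn: "p * n \<ge> 1" using p0 n by simp
  have m: "n div p \<ge> 1" if "p dvd n" using that n p0 by (auto elim!: dvdE)
  define g where "g = (\<lambda>s. (\<Sum>i<p. niebur_cont N S n ((\<tau> + of_nat i) / of_nat p) s) + niebur_cont N' S' n (of_nat p * \<tau>) s)"
  define h where "h = (\<lambda>s. niebur_cont N S (p * n) \<tau> s + (if p dvd n then of_nat p * niebur_cont N' S' (n div p) \<tau> s else 0))"
  have "g 1 = h 1"
  proof (rule half_plane_continuation_unique)
    show "g holomorphic_on {s. Re s > 15 / 16}"
      unfolding g_def by (intro holomorphic_intros niebur_cont_holomorphic cl cl' n Im1 Im2)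
    show "h holomorphic_on {s. Re s > 15 / 16}"
    proof (cases "p dvd n")
      case True
      have "h = (\<lambda>s. niebur_cont N S (p * n) \<tau> s + of_nat p * niebur_cont N' S' (n div p) \<tau> s)"
        using True by (simp add: h_def)
      thus ?thesis
        by (simp only:) (intro holomorphic_intros niebur_cont_holomorphic cl cl' pn \<tau> m[OF True])
    next
      case False
      hence "h = niebur_cont N S (p * n) \<tau>" by (simp add: h_def)
      thus ?thesis by (simp only:) (intro niebur_cont_holomorphic cl pn \<tau>)
    qed
    fix s :: complex assume s: "Re s > 1"
    show "g s = h s"
      using niebur_G_hecke[OF cl p n \<tau> s] m unfolding g_def h_def Gp
      by (simp add: niebur_G_eq_cont[OF cl n Im1 s] niebur_G_eq_cont[OF cl' n Im2 s]
          niebur_G_eq_cont[OF cl pn \<tau> s] niebur_G_eq_cont[OF cl' _ \<tau> s] split: if_splits)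
  qed auto
  thus ?thesis using m unfolding g_def h_def U_star_def Gp
    by (simp add: niebur_j_eq_cont[OF cl n Im1] niebur_j_eq_cont[OF cl' n Im2]
        niebur_j_eq_cont[OF cl pn \<tau>] niebur_j_eq_cont[OF cl' _ \<tau>] split: if_splits)
qed

text \<open>Integrate \<open>niebur_j_hecke\<close> over one period at height 1. The constant term
  is the mean of j on any horizontal line, so scaling the variable by p preserves it and
  \<open>U_star\<close> multiplies it by p.\<close>

lemma niebur_c_hecke:
  assumes cl: "al_closed N S" and p: "prime p" and n: "n \<ge> 1"
  shows "of_nat p * niebur_c (Gamma_plus N S) n 0 + niebur_c (Gamma_plicate p N S) n 0 =
    niebur_c (Gamma_plus N S) (p * n) 0 +
      (if p dvd n then of_nat p * niebur_c (Gamma_plicate p N S) (n div p) 0 else 0)"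
proof -
  have cl': "al_closed (plicate_level p N) (plicate_set p N S)" by (rule plicate_facts(3)[OF cl p])
  have p0: "p > 0" using p prime_gt_0_nat by blast
  have pn: "p * n \<ge> 1" using p0 n by simp
  have m: "n div p \<ge> 1" if "p dvd n" using that n p0 by (auto elim!: dvdE)
  have ex: "\<exists>c. is_niebur_expansion (Gamma_plus N S) k c" "\<exists>c. is_niebur_expansion (Gamma_plicate p N S) k c"
    if "k \<ge> 1" for k
    using niebur_expansion_exists[OF cl that] niebur_expansion_exists[OF cl' that] by (auto simp: Gamma_plicate_def)
  have L: "((\<lambda>x. U_star p (niebur_j (Gamma_plus N S) n) (Complex x 1) + niebur_j (Gamma_plicate p N S) n (of_nat p * Complex x 1))
     has_integral (of_nat p * niebur_c (Gamma_plus N S) n 0 + niebur_c (Gamma_plicate p N S) n 0)) {0..1}"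
    using ex[OF n] p0 n by (intro has_integral_add) (metis niebur_j_integral_U_star niebur_j_integral_scaled zero_less_one)+
  have R: "((\<lambda>x. niebur_j (Gamma_plus N S) (p * n) (Complex x 1) +
      (if p dvd n then of_nat p * niebur_j (Gamma_plicate p N S) (n div p) (Complex x 1) else 0))
     has_integral (niebur_c (Gamma_plus N S) (p * n) 0 +
      (if p dvd n then of_nat p * niebur_c (Gamma_plicate p N S) (n div p) 0 else 0))) {0..1}"
  proof (rule has_integral_add)
    show "((\<lambda>x. niebur_j (Gamma_plus N S) (p * n) (Complex x 1)) has_integral niebur_c (Gamma_plus N S) (p * n) 0) {0..1}"
      using ex(1)[OF pn] pn niebur_j_integral zero_less_one by blast
    show "((\<lambda>x. if p dvd n then of_nat p * niebur_j (Gamma_plicate p N S) (n div p) (Complex x 1) else 0) has_integral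
      (if p dvd n then of_nat p * niebur_c (Gamma_plicate p N S) (n div p) 0 else 0)) {0..1}"
    proof (cases "p dvd n")
      case True
      obtain c where "is_niebur_expansion (Gamma_plicate p N S) (n div p) c" using ex(2)[OF m[OF True]] by blast
      from has_integral_mult_right[OF niebur_j_integral[OF this m[OF True] zero_less_one], of "of_nat p"]
      show ?thesis using True by simp
    qed simp
  qed
  have "(\<lambda>x. U_star p (niebur_j (Gamma_plus N S) n) (Complex x 1) + niebur_j (Gamma_plicate p N S) n (of_nat p * Complex x 1)) =
     (\<lambda>x. niebur_j (Gamma_plus N S) (p * n) (Complex x 1) +
      (if p dvd n then of_nat p * niebur_j (Gamma_plicate p N S) (n div p) (Complex x 1) else 0))"
    using niebur_j_hecke[OF cl p n] by (simp add: fun_eq_iff)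
  thus ?thesis using has_integral_unique[OF L] R by simp
qed

section \<open>From j to J\<close>

lemma niebur_J_of_nat:
  assumes "n \<ge> 1"
  shows "niebur_J \<Gamma> (of_nat n) \<tau> = niebur_j \<Gamma> n \<tau> - niebur_c \<Gamma> n 0"
  using assms by (simp add: niebur_J_def)

lemma niebur_J_divide:
  assumes n: "n \<ge> 1" and p: "p > 0"
  shows "niebur_J \<Gamma> (of_nat n / of_nat p) \<tau> =
    (if p dvd n then niebur_j \<Gamma> (n div p) \<tau> - niebur_c \<Gamma> (n div p) 0 else 0)"
proof (cases "p dvd n")
  case True
  have "of_nat n / of_nat p = (of_nat (n div p) :: rat)" using True p by (auto elim!: dvdE)
  moreover have "n div p \<ge> 1" using True n p by (auto elim!: dvdE)
  ultimately show ?thesis using True niebur_J_of_nat by simp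
next
  case False
  have "of_nat n / of_nat p \<notin> (\<nat> :: rat set)"
  proof
    assume "of_nat n / of_nat p \<in> (\<nat> :: rat set)"
    then obtain k where "of_nat n / of_nat p = (of_nat k :: rat)" by (auto elim!: Nats_cases)
    hence "(of_nat n :: rat) = of_nat (k * p)" using p by (simp add: field_simps)
    hence "n = k * p" by (simp only: of_nat_eq_iff)
    thus False using False by simp
  qed
  thus ?thesis using False n p by (simp add: niebur_J_def)
qed

theorem theorem1p1:
  fixes N n p :: nat and S :: "nat set" and \<tau> :: complex
  assumes "N \<ge> 1"
    and "largest_generating_set N S"
    and "n \<ge> 1"
    and "prime p"
    and "\<tau> \<in> upper_half_plane"
  shows "U_star p (niebur_J (Gamma_plus N S) (of_nat n)) \<tau>
           + niebur_J (Gamma_plicate p N S) (of_nat n) (of_nat p * \<tau>)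
         = niebur_J (Gamma_plus N S) (of_nat (p * n)) \<tau>
           + of_nat p * niebur_J (Gamma_plicate p N S) (of_nat n / of_nat p) \<tau>"
proof -
  have cl: "al_closed N S" by (rule largest_generating_set_al_closed[OF assms(1,2)])
  have p0: "p > 0" using assms(4) prime_gt_0_nat by blast
  have pn: "p * n \<ge> 1" using p0 assms(3) by simp
  have \<tau>: "Im \<tau> > 0" using assms(5) by (simp add: upper_half_plane_def)
  have U: "U_star p (niebur_J (Gamma_plus N S) (of_nat n)) \<tau> =
     U_star p (niebur_j (Gamma_plus N S) n) \<tau> - of_nat p * niebur_c (Gamma_plus N S) n 0"
    by (simp add: U_star_def niebur_J_of_nat[OF assms(3)] sum_subtractf)
  show ?thesis
    unfolding U niebur_J_of_nat[OF assms(3)] niebur_J_of_nat[OF pn] niebur_J_divide[OF assms(3) p0]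
    using niebur_j_hecke[OF cl assms(4,3) \<tau>] niebur_c_hecke[OF cl assms(4,3)]
    by (cases "p dvd n") (simp_all add: algebra_simps)
qed

end
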